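(* Let $0<r\le\frac23$, $0<\alpha\le\frac12$, $0\le\rho,\delta\le1$, and $k\in\mathbb{N}$ with $k>\frac n2$. Let $a\in S^m_{\rho,\delta,0,2k}(\mathbb{T}^n\times\mathbb{Z}^n)$. Assume $0<w_1=\alpha n<2k-n$, $1<p_1\le2$, $q_1=(\alpha+\frac1{p_1'})^{-1}$, and $m<-\frac nr-w_1-2k\delta$. Then $T_a:B^{w_1}_{p_1,q_1}(\mathbb{T}^n)\to B^{w_1}_{p_1,q_1}(\mathbb{T}^n)$ is $r$-nuclear and its nuclear trace satisfies $\mathrm{Tr}(T_a)=\sum_{\xi\in\mathbb{Z}^n}\int_{\mathbb{T}^n}a(x,\xi)dx=\sum_n\lambda_n(T_a)$, where $(\lambda_n(T_a))$ is the sequence of eigenvalues of $T_a$ with multiplicities taken into account.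
   Context: $\widehat f(\xi)=\int_{\mathbb{T}^n}e^{-i2\pi x\cdot\xi}f(x)dx$, $\langle\xi\rangle=(1+|\xi|^2)^{1/2}$. $S^m_{\rho,\delta,0,\mu}(\mathbb{T}^n\times\mathbb{Z}^n)$: functions $a(x,\xi)$ smooth in $x$ for each $\xi\in\mathbb{Z}^n$ with $|\partial_x^\beta a(x,\xi)|\le C_\beta\langle\xi\rangle^{m+\delta|\beta|}$ for $|\beta|\le\mu$. $T_au(x)=\sum_{\xi\in\mathbb{Z}^n}e^{i2\pi x\cdot\xi}a(x,\xi)\widehat u(\xi)$. Periodic Besov spaces: $\|f\|_{B^w_{p,q}}=\big(\sum_{m\ge0}2^{mwq}\|\sum_{2^m\le|\xi|<2^{m+1}}e^{i2\pi x\cdot\xi}\widehat f(\xi)\|^q_{L^p(\mathbb{T}^n)}\big)^{1/q}$. $p'$ is the conjugate exponent. $T:E\to E$ is $r$-nuclear if $T=\sum_ne'_n(\cdot)y_n$ with $\sum_n\|e'_n\|^r_{E'}\|y_n\|^r_E<\infty$; its nuclear trace is $\sum_ne'_n(y_n)$.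
   Formalization: The first dyadic block (m=0) in the Besov norm is taken as |ξ|<2, including ξ=0; with 1≤|ξ|<2 as written, constants have norm zero and the trace formula fails, e.g. for a(x,0)=1 and a(x,ξ)=0 when ξ≠0. *)

theory Defs
  imports "HOL-Analysis.Analysis"
begin

text \<open>Torus \<open>T^n\<close> = \<open>R^n/Z^n\<close>: functions on \<open>T^n\<close> are represented as
  1-periodic functions on \<open>real^'n\<close>; the dimension is \<open>n = CARD('n)\<close>.
  Frequencies \<open>\<xi> \<in> Z^n\<close> are functions \<open>'n \<Rightarrow> int\<close>.\<close>

type_synonym 'n tfun = "real^'n \<Rightarrow> complex"

definition periodic_fn :: "(real^'n \<Rightarrow> 'b) \<Rightarrow> bool" where
  "periodic_fn f \<longleftrightarrow> (\<forall>x i. f (x + axis i 1) = f x)"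

definition cube :: "(real^'n) set" where
  "cube = cbox 0 One"

definition dotZ :: "real^'n \<Rightarrow> ('n \<Rightarrow> int) \<Rightarrow> real" where
  "dotZ x \<xi> = (\<Sum>i\<in>UNIV. x $ i * real_of_int (\<xi> i))"

definition normZ :: "('n::finite \<Rightarrow> int) \<Rightarrow> real" where
  "normZ \<xi> = sqrt (\<Sum>i\<in>UNIV. (real_of_int (\<xi> i))\<^sup>2)"

definition japZ :: "('n::finite \<Rightarrow> int) \<Rightarrow> real" where
  "japZ \<xi> = sqrt (1 + (normZ \<xi>)\<^sup>2)"

definition cexpo :: "real^'n \<Rightarrow> ('n \<Rightarrow> int) \<Rightarrow> complex" where
  "cexpo x \<xi> = exp (\<i> * complex_of_real (2 * pi * dotZ x \<xi>))"

definition fhat :: "'n::finite tfun \<Rightarrow> ('n \<Rightarrow> int) \<Rightarrow> complex" where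
  "fhat f \<xi> = (LINT x:cube|lborel. cnj (cexpo x \<xi>) * f x)"

text \<open>Partial derivative in direction \<open>i\<close> and iterated partial derivatives
  along a list of directions (\<open>\<partial>^\<beta>\<close> with \<open>|\<beta>| = length\<close> of the list).\<close>
definition pderiv_dir :: "'n \<Rightarrow> (real^'n \<Rightarrow> complex) \<Rightarrow> real^'n \<Rightarrow> complex" where
  "pderiv_dir i g x = vector_derivative (\<lambda>t. g (x + t *\<^sub>R axis i 1)) (at 0)"

fun mdiff :: "'n list \<Rightarrow> (real^'n \<Rightarrow> complex) \<Rightarrow> real^'n \<Rightarrow> complex" where
  "mdiff [] g = g"
| "mdiff (i # is) g = pderiv_dir i (mdiff is g)"

definition smooth_fn :: "(real^'n \<Rightarrow> complex) \<Rightarrow> bool" where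
  "smooth_fn g \<longleftrightarrow> (\<forall>is. continuous_on UNIV (mdiff is g) \<and>
      (\<forall>i x. (\<lambda>t. mdiff is g (x + t *\<^sub>R axis i 1)) differentiable (at 0)))"

text \<open>Symbol class \<open>S^m_{\<rho>,\<delta>,0,\<mu>}(T^n \<times> Z^n)\<close>.  (\<open>\<rho>\<close> does not enter the
  defining estimates, as in the definition given.)\<close>
definition symbol_class ::
  "real \<Rightarrow> real \<Rightarrow> real \<Rightarrow> nat \<Rightarrow> (real^'n::finite \<Rightarrow> ('n \<Rightarrow> int) \<Rightarrow> complex) set" where
  "symbol_class m \<rho> \<delta> \<mu> = {a. (\<forall>\<xi>. periodic_fn (\<lambda>x. a x \<xi>) \<and> smooth_fn (\<lambda>x. a x \<xi>)) \<and>
      (\<forall>is. length is \<le> \<mu> \<longrightarrow> (\<exists>C. \<forall>x \<xi>.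
          norm (mdiff is (\<lambda>y. a y \<xi>) x) \<le> C * japZ \<xi> powr (m + \<delta> * real (length is))))}"

definition Top :: "(real^'n::finite \<Rightarrow> ('n \<Rightarrow> int) \<Rightarrow> complex) \<Rightarrow> 'n tfun \<Rightarrow> 'n tfun" where
  "Top a u = (\<lambda>x. infsum (\<lambda>\<xi>. cexpo x \<xi> * a x \<xi> * fhat u \<xi>) UNIV)"

definition dyadic :: "nat \<Rightarrow> ('n::finite \<Rightarrow> int) set" where
  "dyadic m = {\<xi>. (if m = 0 then normZ \<xi> < 2
                   else 2 ^ m \<le> normZ \<xi> \<and> normZ \<xi> < 2 ^ (m + 1))}"

definition block :: "nat \<Rightarrow> 'n::finite tfun \<Rightarrow> 'n tfun" where
  "block m f = (\<lambda>x. \<Sum>\<xi>\<in>dyadic m. cexpo x \<xi> * fhat f \<xi>)"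

definition Lp_norm :: "real \<Rightarrow> 'n::finite tfun \<Rightarrow> real" where
  "Lp_norm p g = (LINT x:cube|lborel. norm (g x) powr p) powr (1 / p)"

definition besov_norm :: "real \<Rightarrow> real \<Rightarrow> real \<Rightarrow> 'n::finite tfun \<Rightarrow> real" where
  "besov_norm w p q f =
     (\<Sum>m. 2 powr (real m * w * q) * Lp_norm p (block m f) powr q) powr (1 / q)"

definition besov :: "real \<Rightarrow> real \<Rightarrow> real \<Rightarrow> 'n::finite tfun set" where
  "besov w p q = {f. periodic_fn f \<and> set_integrable lborel cube f \<and>
      summable (\<lambda>m. 2 powr (real m * w * q) * Lp_norm p (block m f) powr q)}"

text \<open>Generic (semi)normed function space given by a carrier \<open>E\<close> and norm \<open>N\<close>.
  Elements with \<open>N u = 0\<close> are identified with 0.\<close>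

definition dual_space :: "'a tfun set \<Rightarrow> ('a tfun \<Rightarrow> real) \<Rightarrow> ('a tfun \<Rightarrow> complex) set" where
  "dual_space E N = {L. (\<forall>u\<in>E. \<forall>v\<in>E. \<forall>c. L (\<lambda>x. c * u x + v x) = c * L u + L v) \<and>
                       (\<exists>C. \<forall>u\<in>E. norm (L u) \<le> C * N u)}"

definition dual_norm :: "'a tfun set \<Rightarrow> ('a tfun \<Rightarrow> real) \<Rightarrow> ('a tfun \<Rightarrow> complex) \<Rightarrow> real" where
  "dual_norm E N L = Sup {norm (L u) | u. u \<in> E \<and> N u \<le> 1}"

definition nuclear_rep ::
  "real \<Rightarrow> 'a tfun set \<Rightarrow> ('a tfun \<Rightarrow> real) \<Rightarrow> ('a tfun \<Rightarrow> 'a tfun)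
     \<Rightarrow> (nat \<Rightarrow> 'a tfun \<Rightarrow> complex) \<Rightarrow> (nat \<Rightarrow> 'a tfun) \<Rightarrow> bool" where
  "nuclear_rep r E N T e y \<longleftrightarrow>
     (\<forall>j. e j \<in> dual_space E N \<and> y j \<in> E) \<and>
     summable (\<lambda>j. dual_norm E N (e j) powr r * N (y j) powr r) \<and>
     (\<forall>u\<in>E. (\<lambda>K. N (\<lambda>x. T u x - (\<Sum>j<K. e j u * y j x))) \<longlonglongrightarrow> 0)"

definition r_nuclear :: "real \<Rightarrow> 'a tfun set \<Rightarrow> ('a tfun \<Rightarrow> real) \<Rightarrow> ('a tfun \<Rightarrow> 'a tfun) \<Rightarrow> bool" where
  "r_nuclear r E N T \<longleftrightarrow> (\<forall>u\<in>E. T u \<in> E) \<and> (\<exists>e y. nuclear_rep r E N T e y)"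

definition is_eigenvalue :: "'a tfun set \<Rightarrow> ('a tfun \<Rightarrow> real) \<Rightarrow> ('a tfun \<Rightarrow> 'a tfun) \<Rightarrow> complex \<Rightarrow> bool" where
  "is_eigenvalue E N T c0 \<longleftrightarrow> (\<exists>u\<in>E. N u \<noteq> 0 \<and> N (\<lambda>x. T u x - c0 * u x) = 0)"

definition gen_eigenspace :: "'a tfun set \<Rightarrow> ('a tfun \<Rightarrow> real) \<Rightarrow> ('a tfun \<Rightarrow> 'a tfun) \<Rightarrow> complex \<Rightarrow> 'a tfun set" where
  "gen_eigenspace E N T c0 = {u\<in>E. \<exists>k. N (((\<lambda>v x. T v x - c0 * v x) ^^ k) u) = 0}"

definition alg_mult :: "'a tfun set \<Rightarrow> ('a tfun \<Rightarrow> real) \<Rightarrow> ('a tfun \<Rightarrow> 'a tfun) \<Rightarrow> complex \<Rightarrow> enat" where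
  "alg_mult E N T c0 = Sup {enat (card S) | S. finite S \<and> S \<subseteq> gen_eigenspace E N T c0 \<and>
      (\<forall>c. N (\<lambda>x. \<Sum>s\<in>S. c s * s x) = 0 \<longrightarrow> (\<forall>s\<in>S. c s = 0))}"

end

theory Submission
  imports Defs "HOL-Complex_Analysis.Complex_Analysis" "HOL-Library.Function_Algebras"
    "Jordan_Normal_Form.Schur_Decomposition"
begin

text \<open>
  On Fourier coefficients \<open>T\<^sub>a\<close> acts as the matrix \<open>A \<eta> \<xi>\<close>, the coefficient of
  \<open>a(\<cdot>, \<xi>)\<close> at \<open>\<eta> - \<xi>\<close>, and it factors through the space of bounded sequences.
  Integration by parts bounds \<open>A \<eta> \<xi>\<close> by \<open>\<langle>\<xi>\<rangle>\<close> to a power below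
  \<open>- (3/2) n - w\<^sub>1\<close>, times a decaying function of \<open>\<eta> - \<xi>\<close>. Expanding \<open>u\<close> into its
  Fourier coefficients is then already a nuclear representation.

  Conjugating with a power of \<open>\<langle>\<xi>\<rangle>\<close> gives a matrix dominated by \<open>\<theta> \<otimes> \<beta>\<close> with
  \<open>\<theta>\<close> square summable and \<open>\<beta>\<close> summable to some power \<open>\<rho> < 1\<close>. By Hadamard's
  inequality its Fredholm determinant \<open>det (1 - z A)\<close> is entire of order at most \<open>\<rho>\<close>.
  If \<open>A v = \<mu> v\<close>, projecting \<open>v\<close> away is a rank one modification of \<open>A\<close> that divides
  the determinant by \<open>1 - z \<mu>\<close> and lowers the dimension of the generalised eigenspace by one;
  hence algebraic multiplicities are orders of zeros. As the order is less than one, no exponential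
  factor occurs, and comparing derivatives at \<open>0\<close> gives the sum of the eigenvalues.
\<close>

section \<open>Hadamard's inequality\<close>

text \<open>The exponent 2/3 is the reciprocal of 1/2 + 1. Hadamard's inequality measures columns in
  the Euclidean norm, so the row weight \<theta> must be square summable, which takes a decay of
  more than n/2; the column weight \<beta> must be summable to a power below one, which takes more
  than n. As n/r \<ge> (3/2) n, the hypothesis on m leaves room for both, and the positive
  smoothness \<open>w\<^sub>1\<close> supplies the strict surplus. Lidskii's formula fails for
  nuclear operators on general Banach spaces, so the matrix has to carry the argument. Passing
  through bounded sequences makes this possible: Fourier coefficients are bounded by the Besov norm,
  and every bounded sequence is mapped into the Besov space. Hence for nonzero \<mu> the generalised
  eigenspaces of the operator and of the matrix have the same dimension. That the trace is the same
  for all representations is a separate matter, settled by truncating the functions of an arbitrary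
  one to finitely many frequencies.\<close>

definition fdet :: "nat \<Rightarrow> (nat \<Rightarrow> nat \<Rightarrow> complex) \<Rightarrow> complex" where
  "fdet n f = Determinant.det (mat n n (\<lambda>(i, j). f i j))"

lemma fdet_leibniz:
  "fdet n f = (\<Sum>p | p permutes {0..<n}. signof p * (\<Prod>j<n. f (p j) j))"
proof -
  have "fdet n f = (\<Sum>p | p permutes {0..<n}. signof p *
      (\<Prod>j<n. mat n n (\<lambda>(i, j). f i j) $$ (p j, j)))"
    unfolding fdet_def by (rule det_col) auto
  also have "\<dots> = (\<Sum>p | p permutes {0..<n}. signof p * (\<Prod>j<n. f (p j) j))"
    by (intro sum.cong refl arg_cong2[of _ _ _ _ "(*)"] prod.cong) (auto simp: permutes_in_image[of _ "{0..<n}", simplified])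
  finally show ?thesis .
qed

lemma fdet_cong:
  assumes "\<And>i j. i < n \<Longrightarrow> j < n \<Longrightarrow> f i j = g i j"
  shows "fdet n f = fdet n g"
  unfolding fdet_def using assms by (auto intro!: arg_cong[of _ _ Determinant.det] eq_matI)

lemma fdet_col_linear:
  assumes "p < n"
  shows "fdet n (\<lambda>i j. if j = p then x i + c * y i else f i j) =
    fdet n (\<lambda>i j. if j = p then x i else f i j) + c * fdet n (\<lambda>i j. if j = p then y i else f i j)"
proof -
  have split: "(\<Prod>j<n. if j = p then g (q j) else f (q j) j) = g (q p) * (\<Prod>j\<in>{..<n} - {p}. f (q j) j)" for g q
    using assms by (subst prod.remove[of _ p]) (auto intro!: arg_cong2[of _ _ _ _ "(*)"] prod.cong)
  show ?thesis
    unfolding fdet_leibniz split[of "\<lambda>i. x i + c * y i"] split[of x] split[of y]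
    by (simp add: algebra_simps sum.distrib sum_distrib_left)
qed

lemma fdet_scale_cols: "fdet n (\<lambda>i j. c j * f i j) = (\<Prod>j<n. c j) * fdet n f"
  unfolding fdet_leibniz by (simp add: prod.distrib sum_distrib_left mult_ac)

lemma fdet_zero_col:
  assumes "p < n" "\<And>i. i < n \<Longrightarrow> f i p = 0"
  shows "fdet n f = 0"
  unfolding fdet_leibniz using assms
  by (intro sum.neutral ballI) (auto intro!: bexI[of _ p] simp: permutes_in_image[of _ "{0..<n}", simplified])

lemma fdet_cnj_transpose: "fdet n (\<lambda>i j. cnj (f j i)) = cnj (fdet n f)"
proof -
  have "fdet n (\<lambda>i j. f j i) = fdet n f"
    unfolding fdet_def by (subst det_transpose[symmetric, of _ n]) (auto intro!: arg_cong[of _ _ Determinant.det] eq_matI)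
  moreover have "fdet n (\<lambda>i j. cnj (g i j)) = cnj (fdet n g)" for g
    unfolding fdet_leibniz by (simp add: sign_def)
  ultimately show ?thesis by metis
qed

lemma fdet_mult: "fdet n (\<lambda>i j. \<Sum>k<n. f i k * g k j) = fdet n f * fdet n g"
proof -
  have "mat n n (\<lambda>(i, j). \<Sum>k<n. f i k * g k j) = mat n n (\<lambda>(i, j). f i j) * mat n n (\<lambda>(i, j). g i j)"
    by (rule eq_matI) (auto simp: scalar_prod_def atLeast0LessThan)
  then show ?thesis unfolding fdet_def by (simp add: det_mult[of _ n])
qed

text \<open>Cyclicity of the trace. It transfers the known trace of the Gram matrix to the
  eigenvalues on the diagonal of a Schur form.\<close>

lemma trace_similar:
  fixes A B :: "complex mat"
  assumes "A \<in> carrier_mat n n" "similar_mat A B"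
  shows "(\<Sum>i<n. A $$ (i, i)) = (\<Sum>i<n. B $$ (i, i))"
proof -
  from assms obtain P Q where "similar_mat_wit A B P Q"
    unfolding similar_mat_def by auto
  from similar_mat_witD2[OF assms(1) this]
  have w: "Q * P = 1\<^sub>m n" "A = P * B * Q" "B \<in> carrier_mat n n" "P \<in> carrier_mat n n" "Q \<in> carrier_mat n n"
    by auto
  have comm: "(\<Sum>i<n. (X * Y) $$ (i, i)) = (\<Sum>i<n. (Y * X) $$ (i, i))"
    if "X \<in> carrier_mat n n" "Y \<in> carrier_mat n n" for X Y :: "complex mat"
  proof -
    have "(\<Sum>i<n. (X * Y) $$ (i, i)) = (\<Sum>i<n. \<Sum>k<n. X $$ (i, k) * Y $$ (k, i))"
      using that by (auto simp: scalar_prod_def atLeast0LessThan intro!: sum.cong)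
    also have "\<dots> = (\<Sum>k<n. \<Sum>i<n. Y $$ (k, i) * X $$ (i, k))"
      by (subst sum.swap) (simp add: mult.commute)
    also have "\<dots> = (\<Sum>i<n. (Y * X) $$ (i, i))"
      using that by (auto simp: scalar_prod_def atLeast0LessThan intro!: sum.cong)
    finally show ?thesis .
  qed
  have "(\<Sum>i<n. A $$ (i, i)) = (\<Sum>i<n. (Q * (P * B)) $$ (i, i))"
    unfolding w(2) by (rule comm) (use w in auto)
  also have "Q * (P * B) = B"
    using w by (subst assoc_mult_mat[symmetric, of _ n n _ n _ n]) auto
  finally show ?thesis .
qed

text \<open>The Gram matrix has nonnegative eigenvalues, so \<open>1 + x \<le> exp x\<close> bounds their product by the
  exponential of their sum.\<close>

lemma norm_fdet_le_one:
  assumes unit: "\<And>j. j < n \<Longrightarrow> (\<Sum>i<n. (norm (f i j))\<^sup>2) = 1"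
  shows "norm (fdet n f) \<le> 1"
proof -
  define G where "G = mat n n (\<lambda>(i, j). \<Sum>k<n. cnj (f k i) * f k j)"
  have Gc: "G \<in> carrier_mat n n" unfolding G_def by auto
  have detG: "Determinant.det G = of_real ((norm (fdet n f))\<^sup>2)"
  proof -
    have "Determinant.det G = fdet n (\<lambda>i j. \<Sum>k<n. cnj (f k i) * f k j)"
      unfolding fdet_def G_def ..
    also have "\<dots> = cnj (fdet n f) * fdet n f"
      by (simp add: fdet_mult fdet_cnj_transpose[symmetric])
    also have "\<dots> = of_real ((norm (fdet n f))\<^sup>2)"
      by (metis complex_norm_square mult.commute)
    finally show ?thesis .
  qed
  obtain es where es: "char_poly G = (\<Prod>a\<leftarrow>es. [:- a, 1:])"
    using char_poly_factorized[OF Gc] by auto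
  obtain B where B: "B \<in> carrier_mat n n" "upper_triangular B" "similar_mat G B"
    using schur_decomposition_exists[OF Gc es] by auto
  have "\<exists>x\<ge>0. B $$ (i, i) = complex_of_real x" if i: "i < n" for i
  proof -
    have "poly (char_poly G) (B $$ (i, i)) = 0"
      unfolding char_poly_similar[OF B(3)] char_poly_upper_triangular[OF B(1,2)]
      using i B(1) by (auto simp: poly_prod_list diag_mat_def prod_list_zero_iff)
    then have "eigenvalue G (B $$ (i, i))"
      using eigenvalue_root_char_poly[OF Gc] by simp
    then obtain v where v: "v \<in> carrier_vec n" "v \<noteq> 0\<^sub>v n" "G *\<^sub>v v = B $$ (i, i) \<cdot>\<^sub>v v"
      using Gc unfolding eigenvalue_def eigenvector_def by auto
    \<comment> \<open>\<open>?w\<close> is the image of \<open>v\<close> under \<open>f\<close>. The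
      quadratic form of the Gram matrix at \<open>v\<close> is its squared length, so the eigenvalue
      is a quotient of squared lengths.\<close>
    let ?w = "\<lambda>k. \<Sum>j<n. f k j * vec_index v j"
    define s where "s = (\<Sum>l<n. (norm (vec_index v l))\<^sup>2)"
    have Gv: "(\<Sum>j<n. (\<Sum>k<n. cnj (f k l) * f k j) * vec_index v j) = B $$ (i, i) * vec_index v l" if "l < n" for l
    proof -
      have "vec_index (G *\<^sub>v v) l = (\<Sum>j<n. (\<Sum>k<n. cnj (f k l) * f k j) * vec_index v j)"
        using that v(1) by (auto simp: G_def scalar_prod_def atLeast0LessThan intro!: sum.cong)
      then show ?thesis using v that by auto
    qed
    have "B $$ (i, i) * of_real s = (\<Sum>l<n. cnj (vec_index v l) * (B $$ (i, i) * vec_index v l))"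
      unfolding s_def of_real_sum sum_distrib_left
      by (intro sum.cong refl) (metis complex_norm_square mult.commute mult.assoc)
    also have "\<dots> = (\<Sum>l<n. cnj (vec_index v l) * (\<Sum>j<n. (\<Sum>k<n. cnj (f k l) * f k j) * vec_index v j))"
      by (intro sum.cong refl) (simp add: Gv)
    also have "\<dots> = (\<Sum>l<n. \<Sum>j<n. \<Sum>k<n. cnj (f k l * vec_index v l) * (f k j * vec_index v j))"
      by (simp add: sum_distrib_left sum_distrib_right mult_ac)
    also have "\<dots> = (\<Sum>l<n. \<Sum>k<n. \<Sum>j<n. cnj (f k l * vec_index v l) * (f k j * vec_index v j))"
      by (rule sum.cong[OF refl sum.swap])
    also have "\<dots> = (\<Sum>k<n. \<Sum>l<n. \<Sum>j<n. cnj (f k l * vec_index v l) * (f k j * vec_index v j))"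
      by (rule sum.swap)
    also have "\<dots> = (\<Sum>k<n. cnj (?w k) * ?w k)"
      by (simp add: sum_product)
    also have "\<dots> = of_real (\<Sum>k<n. (norm (?w k))\<^sup>2)"
      unfolding of_real_sum by (intro sum.cong refl) (metis complex_norm_square mult.commute)
    finally have eq: "B $$ (i, i) * of_real s = of_real (\<Sum>k<n. (norm (?w k))\<^sup>2)" .
    have "s \<noteq> 0"
    proof
      assume "s = 0"
      then have "\<forall>l<n. vec_index v l = 0"
        unfolding s_def by (subst (asm) sum_nonneg_eq_0_iff) auto
      then show False using v(1,2) by (auto intro!: eq_vecI)
    qed
    then have "s > 0" unfolding s_def by (metis less_eq_real_def sum_nonneg zero_le_power2)
    then have "B $$ (i, i) = of_real ((\<Sum>k<n. (norm (?w k))\<^sup>2) / s)"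
      using eq by (simp add: field_simps)
    moreover have "(\<Sum>k<n. (norm (?w k))\<^sup>2) / s \<ge> 0"
      using \<open>s > 0\<close> by (intro divide_nonneg_pos sum_nonneg) auto
    ultimately show ?thesis by blast
  qed
  then obtain x where x: "\<And>i. i < n \<Longrightarrow> x i \<ge> 0 \<and> B $$ (i, i) = complex_of_real (x i)"
    by metis
  have "complex_of_real (\<Sum>i<n. x i) = (\<Sum>i<n. B $$ (i, i))"
    using x by simp
  also have "\<dots> = (\<Sum>i<n. G $$ (i, i))"
    using trace_similar[OF Gc B(3)] by simp
  also have "\<dots> = (\<Sum>i<n. of_real (\<Sum>k<n. (norm (f k i))\<^sup>2))"
    by (intro sum.cong refl) (auto simp: G_def complex_norm_square[symmetric] mult.commute[of "cnj _"] intro!: sum.cong)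
  also have "\<dots> = of_real (real n)"
    using unit by simp
  finally have tr: "(\<Sum>i<n. x i) = real n" by (metis of_real_eq_iff)
  have "Determinant.det G = Determinant.det B"
    using det_similar[OF B(3)] .
  also have "\<dots> = (\<Prod>i<n. B $$ (i, i))"
    using det_upper_triangular[OF B(2,1)] B(1)
    by (simp add: diag_mat_def prod.list_conv_set_nth atLeast0LessThan)
  also have "\<dots> = of_real (\<Prod>i<n. x i)"
    using x by simp
  finally have "(norm (fdet n f))\<^sup>2 = (\<Prod>i<n. x i)"
    unfolding detG by (metis of_real_eq_iff)
  \<comment> \<open>The exponents are shifted by one so that they add up to the trace minus
    \<open>n\<close>, which is zero.\<close>
  also have "\<dots> \<le> (\<Prod>i<n. exp (x i - 1))"
  proof (rule prod_mono)
    fix i assume "i \<in> {..<n}"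
    then show "0 \<le> x i \<and> x i \<le> exp (x i - 1)"
      using x exp_ge_add_one_self[of "x i - 1"] by auto
  qed
  also have "\<dots> = 1"
    by (simp add: exp_sum[symmetric] sum_subtractf tr)
  finally show ?thesis by (simp add: power_le_one_iff)
qed

definition colnorm :: "nat \<Rightarrow> (nat \<Rightarrow> complex) \<Rightarrow> real" where
  "colnorm n x = L2_set (\<lambda>i. norm (x i)) {..<n}"

lemma colnorm_nonneg [simp]: "0 \<le> colnorm n x"
  unfolding colnorm_def by (rule L2_set_nonneg)

text \<open>Scaling the columns to unit length reduces to \<open>norm_fdet_le_one\<close>. A zero
  column cannot be scaled, but there the determinant vanishes.\<close>

theorem hadamard: "norm (fdet n f) \<le> (\<Prod>j<n. colnorm n (\<lambda>i. f i j))"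
proof (cases "\<exists>p<n. colnorm n (\<lambda>i. f i p) = 0")
  case True
  then obtain p where p: "p < n" "colnorm n (\<lambda>i. f i p) = 0" by blast
  then have "\<And>i. i < n \<Longrightarrow> f i p = 0"
    unfolding colnorm_def by (subst (asm) L2_set_eq_0_iff) auto
  with p(1) have "fdet n f = 0" by (rule fdet_zero_col)
  then show ?thesis by (simp add: prod_nonneg)
next
  case False
  let ?c = "\<lambda>j. colnorm n (\<lambda>i. f i j)"
  have pos: "?c j > 0" if "j < n" for j
    unfolding less_le using False that by auto
  define g where "g = (\<lambda>i j. inverse (of_real (?c j)) * f i j)"
  have "norm (fdet n g) \<le> 1"
  proof (rule norm_fdet_le_one)
    fix j assume j: "j < n"
    have "(norm (g i j))\<^sup>2 = (norm (f i j))\<^sup>2 / (?c j)\<^sup>2" for i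
      by (simp add: g_def norm_divide power_divide inverse_eq_divide)
    then have "(\<Sum>i<n. (norm (g i j))\<^sup>2) = (\<Sum>i<n. (norm (f i j))\<^sup>2) / (?c j)\<^sup>2"
      by (simp add: sum_divide_distrib)
    also have "(\<Sum>i<n. (norm (f i j))\<^sup>2) = (?c j)\<^sup>2"
      by (simp add: colnorm_def L2_set_def sum_nonneg)
    finally show "(\<Sum>i<n. (norm (g i j))\<^sup>2) = 1"
      using pos[OF j] by simp
  qed
  moreover have "fdet n f = fdet n (\<lambda>i j. of_real (?c j) * g i j)"
    unfolding g_def using pos by (intro fdet_cong) (simp add: less_imp_neq[symmetric])
  then have "fdet n f = (\<Prod>j<n. of_real (?c j)) * fdet n g"
    by (simp only: fdet_scale_cols)
  then have "norm (fdet n f) = (\<Prod>j<n. ?c j) * norm (fdet n g)"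
    by (simp add: norm_mult prod_norm[symmetric])
  ultimately show ?thesis
    by (simp add: mult_left_le prod_nonneg)
qed

section \<open>Perturbing the columns of a determinant\<close>

lemma colnorm_triangle: "colnorm n (\<lambda>i. x i + y i) \<le> colnorm n x + colnorm n y"
proof -
  have "colnorm n (\<lambda>i. x i + y i) \<le> L2_set (\<lambda>i. norm (x i) + norm (y i)) {..<n}"
    unfolding colnorm_def by (intro L2_set_mono) (auto intro: norm_triangle_ineq)
  also have "\<dots> \<le> colnorm n x + colnorm n y"
    unfolding colnorm_def by (rule L2_set_triangle_ineq)
  finally show ?thesis .
qed

lemma colnorm_unit: "j < n \<Longrightarrow> colnorm n (\<lambda>i. if i = j then 1 else 0) = 1"
proof -
  assume "j < n"
  have "(\<Sum>i<n. (norm (if i = j then 1 else 0 :: complex))\<^sup>2) = (\<Sum>i<n. if i = j then 1 else 0)"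
    by (intro sum.cong) auto
  with \<open>j < n\<close> show ?thesis by (simp add: colnorm_def L2_set_def)
qed

text \<open>The columns of \<open>f\<close> are exchanged for those of \<open>g\<close> one at a
  time. By linearity each exchange changes the determinant by one whose exchanged column is the
  difference, and Hadamard bounds it. Since 1 + x \<le> exp x, the remaining columns contribute one
  exponential common to all exchanges.\<close>

lemma fdet_perturb:
  assumes "\<And>j. j < n \<Longrightarrow> colnorm n (\<lambda>i. f i j) \<le> 1 + x j"
    and "\<And>j. j < n \<Longrightarrow> colnorm n (\<lambda>i. g i j) \<le> 1 + x j"
    and "\<And>j. j < n \<Longrightarrow> colnorm n (\<lambda>i. f i j - g i j) \<le> d j"
    and "\<And>j. 0 \<le> x j"
  shows "norm (fdet n f - fdet n g) \<le> (\<Sum>j<n. d j) * exp (\<Sum>j<n. x j)"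
proof -
  define h where "h = (\<lambda>k i j. if j < k then g i j else f i j)"
  have step: "norm (fdet n (h k) - fdet n (h (Suc k))) \<le> d k * exp (\<Sum>j<n. x j)" if k: "k < n" for k
  proof -
    let ?D = "\<lambda>i j. if j = k then f i k - g i k else h k i j"
    have "fdet n (h k) = fdet n (\<lambda>i j. if j = k then g i k + 1 * (f i k - g i k) else h k i j)"
      by (rule fdet_cong) (auto simp: h_def)
    also have "\<dots> = fdet n (\<lambda>i j. if j = k then g i k else h k i j) + 1 * fdet n ?D"
      by (rule fdet_col_linear[OF k])
    also have "fdet n (\<lambda>i j. if j = k then g i k else h k i j) = fdet n (h (Suc k))"
      by (rule fdet_cong) (auto simp: h_def)
    finally have "norm (fdet n (h k) - fdet n (h (Suc k))) = norm (fdet n ?D)"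
      by simp
    also have "\<dots> \<le> (\<Prod>j<n. colnorm n (\<lambda>i. ?D i j))"
      by (rule hadamard)
    also have "\<dots> = colnorm n (\<lambda>i. f i k - g i k) * (\<Prod>j\<in>{..<n} - {k}. colnorm n (\<lambda>i. h k i j))"
      using k by (subst prod.remove[of _ k]) (auto intro!: prod.cong)
    also have "\<dots> \<le> d k * (\<Prod>j\<in>{..<n} - {k}. exp (x j))"
    proof (intro mult_mono prod_mono conjI)
      show "colnorm n (\<lambda>i. f i k - g i k) \<le> d k" using assms(3) k by simp
      then show "0 \<le> d k" using colnorm_nonneg order_trans by blast
      fix j assume "j \<in> {..<n} - {k}"
      then have "colnorm n (\<lambda>i. h k i j) \<le> 1 + x j"
        using assms(1,2)[of j] by (cases "j < k") (auto simp: h_def)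
      then show "colnorm n (\<lambda>i. h k i j) \<le> exp (x j)"
        using exp_ge_add_one_self[of "x j"] by linarith
    qed (auto intro!: prod_nonneg)
    also have "\<dots> \<le> d k * exp (\<Sum>j<n. x j)"
    proof (rule mult_left_mono)
      show "0 \<le> d k" using assms(3)[OF k] colnorm_nonneg order_trans by blast
      show "(\<Prod>j\<in>{..<n} - {k}. exp (x j)) \<le> exp (\<Sum>j<n. x j)"
        using assms(4) by (auto simp: exp_sum[symmetric] intro!: sum_mono2)
    qed
    finally show ?thesis .
  qed
  have "fdet n f - fdet n g = fdet n (h 0) - fdet n (h n)"
    by (intro arg_cong2[of _ _ _ _ "(-)"] fdet_cong) (auto simp: h_def)
  also have "\<dots> = (\<Sum>k<n. fdet n (h k) - fdet n (h (Suc k)))"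
    by (rule sum_lessThan_telescope'[of "\<lambda>k. fdet n (h k)" n, symmetric])
  also have "norm \<dots> \<le> (\<Sum>k<n. d k * exp (\<Sum>j<n. x j))"
    by (rule sum_norm_le) (use step in auto)
  finally show ?thesis by (simp add: sum_distrib_right)
qed

section \<open>Entire functions of order less than one\<close>

text \<open>\<open>mult \<mu>\<close> is the order of \<open>1 / \<mu>\<close> as a zero of \<open>d\<close>.\<close>

locale genus_zero =
  fixes d :: "complex \<Rightarrow> complex" and mult :: "complex \<Rightarrow> nat" and K \<rho> :: real
  assumes entire: "d holomorphic_on UNIV"
    and d_0: "d 0 = 1"
    and K_pos: "0 < K" and \<rho>_pos: "0 < \<rho>" and \<rho>_less: "\<rho> < 1"
    and growth: "\<And>z. norm (d z) \<le> exp (K * norm z powr \<rho>)"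
    and factor: "\<And>\<mu>. \<mu> \<noteq> 0 \<Longrightarrow>
      \<exists>h. h holomorphic_on UNIV \<and> h (1 / \<mu>) \<noteq> 0 \<and> (\<forall>z. d z = (1 - z * \<mu>) ^ mult \<mu> * h z)"
begin

text \<open>The elements of \<open>M\<close> are reciprocals of zeros of \<open>d\<close>, so this
  is a partial product of the canonical product of genus zero.\<close>

definition zprod :: "complex set \<Rightarrow> complex \<Rightarrow> complex" where
  "zprod M z = (\<Prod>\<mu>\<in>M. (1 - z * \<mu>) ^ mult \<mu>)"

lemma zprod_deriv:
  "finite M \<Longrightarrow> zprod M 0 = 1 \<and> (zprod M has_field_derivative - (\<Sum>\<mu>\<in>M. of_nat (mult \<mu>) * \<mu>)) (at 0)"
proof (induction M rule: finite_induct)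
  case empty
  then show ?case by (simp add: zprod_def)
next
  case (insert \<nu> M)
  have eq: "zprod (insert \<nu> M) = (\<lambda>z. (1 - z * \<nu>) ^ mult \<nu> * zprod M z)"
    using insert.hyps by (auto simp: zprod_def fun_eq_iff)
  have "((\<lambda>z. (1 - z * \<nu>) ^ mult \<nu>) has_field_derivative - (of_nat (mult \<nu>) * \<nu>)) (at 0)"
    by (rule derivative_eq_intros refl | simp)+
  from DERIV_mult[OF this conjunct2[OF insert.IH]] show ?case
    using insert by (simp add: eq algebra_simps)
qed

lemma zprod_holomorphic [holomorphic_intros]: "zprod M holomorphic_on A"
  unfolding zprod_def[abs_def] by (intro holomorphic_intros)

text \<open>The locale splits off one zero at a time. To combine the factorisations, the new
  quotient is described in two ways, by dividing \<open>g\<close> away from 1/\<nu> and as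
  \<open>h\<close> over \<open>zprod M\<close> where that product is nonzero. The two agree where
  both make sense, and the open sets cover the plane.\<close>

lemma divide_zeros:
  assumes "finite M" "0 \<notin> M"
  shows "\<exists>g. g holomorphic_on UNIV \<and> (\<forall>z. d z = zprod M z * g z) \<and> (\<forall>\<mu>\<in>M. g (1 / \<mu>) \<noteq> 0)"
  using assms
proof (induction M rule: finite_induct)
  case empty
  then show ?case using entire by (intro exI[of _ d]) (auto simp: zprod_def)
next
  case (insert \<nu> M)
  then obtain g where g: "g holomorphic_on UNIV" "\<And>z. d z = zprod M z * g z" "\<And>\<mu>. \<mu> \<in> M \<Longrightarrow> g (1 / \<mu>) \<noteq> 0"
    by auto
  have \<nu>: "\<nu> \<noteq> 0" using insert by auto
  obtain h where h: "h holomorphic_on UNIV" "h (1 / \<nu>) \<noteq> 0" "\<And>z. d z = (1 - z * \<nu>) ^ mult \<nu> * h z"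
    using factor[OF \<nu>] by blast
  define U where "U = {z. zprod M z \<noteq> 0}"
  define g' where "g' = (\<lambda>z. if z = 1 / \<nu> then h z / zprod M z else g z / (1 - z * \<nu>) ^ mult \<nu>)"
  have nz: "1 - z * \<nu> \<noteq> 0" if "z \<noteq> 1 / \<nu>" for z
    using that \<nu> by (auto simp: field_simps)
  have eqU: "g' z = h z / zprod M z" if "z \<in> U" for z
    using that g(2)[of z] h(3)[of z] nz[of z] by (auto simp: g'_def U_def field_simps)
  have "open U"
    unfolding U_def
    by (intro open_Collect_neq continuous_intros holomorphic_on_imp_continuous_on zprod_holomorphic)
  have in_U: "1 / \<nu> \<in> U"
    unfolding U_def zprod_def using insert.hyps \<nu> insert.prems by (auto simp: field_simps)
  have "(\<lambda>z. g z / (1 - z * \<nu>) ^ mult \<nu>) holomorphic_on (UNIV - {1 / \<nu>})"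
    by (intro holomorphic_intros holomorphic_on_subset[OF g(1)]) (auto dest: nz)
  then have "g' holomorphic_on (UNIV - {1 / \<nu>})"
    by (rule holomorphic_transform) (auto simp: g'_def)
  moreover have "g' holomorphic_on U"
    by (subst holomorphic_cong[OF refl eqU])
      (auto intro!: holomorphic_intros holomorphic_on_subset[OF h(1)] simp: U_def)
  ultimately have "g' holomorphic_on (U \<union> (UNIV - {1 / \<nu>}))"
    using \<open>open U\<close> by (intro holomorphic_on_Un) auto
  moreover have "U \<union> (UNIV - {1 / \<nu>}) = UNIV" using in_U by auto
  ultimately have "g' holomorphic_on UNIV" by simp
  moreover have "d z = zprod (insert \<nu> M) z * g' z" for z
  proof -
    have "zprod (insert \<nu> M) z = (1 - z * \<nu>) ^ mult \<nu> * zprod M z"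
      using insert.hyps by (auto simp: zprod_def)
    then show ?thesis
      using h(3)[of z] g(2)[of z] nz[of z] in_U by (auto simp: g'_def U_def)
  qed
  moreover have "g' (1 / \<mu>) \<noteq> 0" if "\<mu> \<in> insert \<nu> M" for \<mu>
    using that in_U h(2) g(3) insert.hyps insert.prems \<nu> by (auto simp: g'_def U_def field_simps)
  ultimately show ?case by blast
qed

text \<open>On the circle of radius \<open>3 R\<close> every factor \<open>1 - z \<mu>\<close> with \<open>1 / R \<le> \<bar>\<mu>\<bar>\<close> has modulus at least \<open>2\<close>.\<close>

lemma quotient_bound:
  assumes "finite M" "0 \<notin> M" "0 < R" "\<And>\<mu>. \<mu> \<in> M \<Longrightarrow> 1 / R \<le> norm \<mu>"
    and g: "g holomorphic_on UNIV" "\<And>z. d z = zprod M z * g z"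
    and z: "norm z \<le> 3 * R"
  shows "2 ^ (\<Sum>\<mu>\<in>M. mult \<mu>) * norm (g z) \<le> exp (K * (3 * R) powr \<rho>)"
proof -
  have bd: "norm (g w) \<le> exp (K * (3 * R) powr \<rho>) / 2 ^ (\<Sum>\<mu>\<in>M. mult \<mu>)" if w: "w \<in> frontier (cball 0 (3 * R))" for w
  proof -
    have nw: "norm w = 3 * R" using w \<open>0 < R\<close> by (simp add: frontier_cball)
    have "2 ^ (\<Sum>\<mu>\<in>M. mult \<mu>) = (\<Prod>\<mu>\<in>M. (2::real) ^ mult \<mu>)"
      by (simp add: power_sum)
    also have "\<dots> \<le> (\<Prod>\<mu>\<in>M. norm (1 - w * \<mu>) ^ mult \<mu>)"
    proof (intro prod_mono conjI power_mono)
      fix \<mu> assume "\<mu> \<in> M"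
      then have "3 \<le> norm (w * \<mu>)"
        using assms(4)[of \<mu>] \<open>0 < R\<close> by (simp add: norm_mult nw field_simps)
      then show "2 \<le> norm (1 - w * \<mu>)"
        using norm_triangle_ineq3[of 1 "w * \<mu>"] by simp
    qed auto
    also have "\<dots> = norm (zprod M w)"
      by (simp add: zprod_def prod_norm[symmetric] norm_power)
    finally have "2 ^ (\<Sum>\<mu>\<in>M. mult \<mu>) * norm (g w) \<le> norm (d w)"
      unfolding g(2) norm_mult by (rule mult_right_mono) simp
    also have "\<dots> \<le> exp (K * (3 * R) powr \<rho>)"
      using growth[of w] nw by simp
    finally show ?thesis by (simp add: field_simps)
  qed
  have "norm (g z) \<le> exp (K * (3 * R) powr \<rho>) / 2 ^ (\<Sum>\<mu>\<in>M. mult \<mu>)"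
  proof (rule maximum_modulus_frontier[of g "cball 0 (3 * R)"])
    show "g holomorphic_on interior (cball 0 (3 * R))"
      using g(1) by (rule holomorphic_on_subset) auto
    show "continuous_on (closure (cball 0 (3 * R))) g"
      using g(1) by (intro holomorphic_on_imp_continuous_on) (rule holomorphic_on_subset, auto)
  qed (use bd z in auto)
  then show ?thesis by (simp add: field_simps)
qed

text \<open>A substitute for Jensen's formula: the quotient has value 1 at the origin, so
  \<open>quotient_bound\<close> there limits the exponent of 2.\<close>

lemma count_zeros:
  assumes "finite M" "0 \<notin> M" "0 < R" "\<And>\<mu>. \<mu> \<in> M \<Longrightarrow> 1 / R \<le> norm \<mu>"
  shows "real (\<Sum>\<mu>\<in>M. mult \<mu>) \<le> K * (3 * R) powr \<rho> / ln 2"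
proof -
  obtain g where g: "g holomorphic_on UNIV" "\<And>z. d z = zprod M z * g z"
    using divide_zeros[OF assms(1,2)] by blast
  have "g 0 = 1" using g(2)[of 0] d_0 zprod_deriv[OF assms(1)] by simp
  then have "2 ^ (\<Sum>\<mu>\<in>M. mult \<mu>) \<le> exp (K * (3 * R) powr \<rho>)"
    using quotient_bound[OF assms g, of 0] \<open>0 < R\<close> by simp
  then have "ln (2 ^ (\<Sum>\<mu>\<in>M. mult \<mu>)) \<le> K * (3 * R) powr \<rho>"
    by (metis ln_exp ln_le_cancel_iff exp_gt_zero zero_less_numeral zero_less_power)
  then show ?thesis by (simp add: ln_realpow field_simps)
qed

definition spec :: "complex set" where
  "spec = {\<mu>. \<mu> \<noteq> 0 \<and> mult \<mu> \<noteq> 0}"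

lemma finite_spec:
  assumes "0 < R"
  shows "finite {\<mu> \<in> spec. 1 / R \<le> norm \<mu>}"
proof (rule ccontr)
  define N where "N = Suc (nat \<lceil>K * (3 * R) powr \<rho> / ln 2\<rceil>)"
  assume "infinite {\<mu> \<in> spec. 1 / R \<le> norm \<mu>}"
  then obtain M where M: "M \<subseteq> {\<mu> \<in> spec. 1 / R \<le> norm \<mu>}" "finite M" "card M = N"
    by (metis infinite_arbitrarily_large)
  have "real N = (\<Sum>\<mu>\<in>M. 1)" using M by simp
  also have "\<dots> \<le> real (\<Sum>\<mu>\<in>M. mult \<mu>)"
    unfolding of_nat_sum using M by (intro sum_mono) (auto simp: spec_def Suc_le_eq)
  also have "\<dots> \<le> K * (3 * R) powr \<rho> / ln 2"
    using M assms by (intro count_zeros) (auto simp: spec_def)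
  finally show False unfolding N_def by linarith
qed

text \<open>After division by the zeros in the disc of radius \<open>R\<close> there is a logarithm \<open>l\<close> with real
  part at most \<open>B\<close>; the map \<open>l / (2 B - l)\<close> into the unit disc turns this into a bound for the
  derivative at \<open>0\<close>.\<close>

lemma log_deriv_bound:
  assumes "0 < R"
  shows "norm (deriv d 0 + (\<Sum>\<mu> | \<mu> \<in> spec \<and> 1 / R \<le> norm \<mu>. of_nat (mult \<mu>) * \<mu>))
    \<le> 4 * K * (3 * R) powr \<rho> / R"
proof -
  define M where "M = {\<mu> \<in> spec. 1 / R \<le> norm \<mu>}"
  have M: "finite M" "0 \<notin> M" "\<And>\<mu>. \<mu> \<in> M \<Longrightarrow> 1 / R \<le> norm \<mu>"
    using finite_spec[OF assms] by (auto simp: M_def spec_def)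
  obtain g where g: "g holomorphic_on UNIV" "\<And>z. d z = zprod M z * g z" "\<And>\<mu>. \<mu> \<in> M \<Longrightarrow> g (1 / \<mu>) \<noteq> 0"
    using divide_zeros[OF M(1,2)] by blast
  note P = zprod_deriv[OF M(1)]
  have g0: "g 0 = 1" using g(2)[of 0] d_0 P by simp
  have g_nz: "g z \<noteq> 0" if "z \<in> ball 0 R" for z
  proof
    assume "g z = 0"
    then have dz: "d z = 0" using g(2) by simp
    then have z: "z \<noteq> 0" using d_0 by auto
    have "mult (1 / z) \<noteq> 0"
    proof
      assume "mult (1 / z) = 0"
      then show False using factor[of "1 / z"] z dz by auto
    qed
    then have "1 / z \<in> M"
      using z that assms by (auto simp: M_def spec_def norm_divide field_simps)
    then show False using g(3)[of "1 / z"] \<open>g z = 0\<close> by simp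
  qed
  obtain l0 where l0: "l0 holomorphic_on ball 0 R" "\<And>z. z \<in> ball 0 R \<Longrightarrow> g z = exp (l0 z)"
    using contractible_imp_holomorphic_log[OF holomorphic_on_subset[OF g(1) subset_UNIV]
        convex_imp_contractible[OF convex_ball] g_nz] by metis
  define l where "l = (\<lambda>z. l0 z - l0 0)"
  have l: "l holomorphic_on ball 0 R" unfolding l_def by (intro holomorphic_intros l0)
  have gl: "g z = exp (l z)" if "z \<in> ball 0 R" for z
    using l0(2)[OF that] l0(2)[of 0] assms g0 by (simp add: l_def exp_diff)
  define B where "B = K * (3 * R) powr \<rho>"
  have B: "B > 0" using K_pos assms by (simp add: B_def)
  have Re_l: "Re (l z) \<le> B" if "z \<in> ball 0 R" for z
  proof -
    have "1 * norm (g z) \<le> 2 ^ (\<Sum>\<mu>\<in>M. mult \<mu>) * norm (g z)"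
      by (intro mult_right_mono) auto
    also have "\<dots> \<le> exp B"
      unfolding B_def using that assms by (intro quotient_bound M g) auto
    finally show ?thesis using gl[OF that] by simp
  qed
  define F where "F = (\<lambda>z. l z / (2 * of_real B - l z))"
  have den: "2 * of_real B - l z \<noteq> 0" if "z \<in> ball 0 R" for z
    using Re_l[OF that] B by (auto simp: complex_eq_iff)
  have F: "F holomorphic_on ball 0 R"
    unfolding F_def using den by (intro holomorphic_intros l) auto
  have F_le: "norm (F z) \<le> 1" if "z \<in> ball 0 R" for z
  proof -
    have "(norm (l z))\<^sup>2 \<le> (norm (2 * of_real B - l z))\<^sup>2"
      using Re_l[OF that] B unfolding cmod_power2 by (simp add: power2_eq_square algebra_simps)
    then have "norm (l z) \<le> norm (2 * of_real B - l z)" by simp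
    then show ?thesis unfolding F_def norm_divide using den[OF that] by (simp add: divide_le_eq)
  qed
  \<comment> \<open>\<open>F\<close> is controlled on the open disc only, hence the radius
    \<open>R / 2\<close> and the bound \<open>2 / R\<close>. As \<open>l 0 = 0\<close>, the
    derivative of \<open>F\<close> at 0 is that of \<open>l\<close> divided by \<open>2 * B\<close>;
    together this produces the constant 4.\<close>
  have "norm ((deriv ^^ 1) F 0) \<le> fact 1 * 1 / (R / 2) ^ 1"
  proof (rule Cauchy_inequality)
    show "F holomorphic_on ball 0 (R / 2)" using F by (rule holomorphic_on_subset) (use assms in auto)
    show "continuous_on (cball 0 (R / 2)) F"
      using holomorphic_on_imp_continuous_on[OF F] by (rule continuous_on_subset) (use assms in auto)
  qed (use assms F_le in auto)
  then have F': "norm (deriv F 0) \<le> 2 / R" by simp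
  have l': "(l has_field_derivative deriv l 0) (at 0)"
    using l assms by (intro holomorphic_derivI[of l "ball 0 R"]) auto
  have "(F has_field_derivative
      (deriv l 0 * (2 * of_real B - l 0) - l 0 * (- deriv l 0)) / (2 * of_real B - l 0)\<^sup>2) (at 0)"
    unfolding F_def power2_eq_square using den[of 0] assms
    by (intro DERIV_divide l') (auto intro!: derivative_eq_intros l')
  then have "deriv F 0 = deriv l 0 / (2 * of_real B)"
    using B by (auto simp: l_def power2_eq_square dest!: DERIV_imp_deriv)
  with F' have l'_bound: "norm (deriv l 0) \<le> 4 * B / R"
    using B assms by (simp add: norm_divide norm_mult field_simps)
  have "((\<lambda>z. exp (l z)) has_field_derivative deriv l 0) (at 0)"
    using DERIV_fun_exp[OF l'] by (simp add: l_def)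
  then have "(g has_field_derivative deriv l 0) (at 0)"
    by (rule has_field_derivative_transform_within_open[of _ _ _ "ball 0 R"]) (use assms gl in auto)
  moreover have d_eq: "d = (\<lambda>z. zprod M z * g z)" using g(2) by auto
  ultimately have "((\<lambda>z. zprod M z * g z) has_field_derivative
      - (\<Sum>\<mu>\<in>M. of_nat (mult \<mu>) * \<mu>) * g 0 + deriv l 0 * zprod M 0) (at 0)"
    by (intro DERIV_mult conjunct2[OF P])
  then
  have "(d has_field_derivative - (\<Sum>\<mu>\<in>M. of_nat (mult \<mu>) * \<mu>) + deriv l 0) (at 0)"
    using P g0 d_eq by simp
  then have "deriv d 0 + (\<Sum>\<mu>\<in>M. of_nat (mult \<mu>) * \<mu>) = deriv l 0"
    by (simp add: DERIV_imp_deriv)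
  then show ?thesis using l'_bound by (simp add: M_def B_def)
qed

text \<open>Dyadic shells: by \<open>count_zeros\<close> the total multiplicity in the shell at
  height 2^-j is at most a constant times 2^(j \<rho>), and each element has modulus at most 2^-j.
  Since \<rho> < 1 this leaves a convergent geometric series, with a bound independent of
  \<open>M\<close>.\<close>

lemma small_spec_sum:
  assumes "finite M" "M \<subseteq> {\<mu> \<in> spec. norm \<mu> < 1}"
  shows "(\<Sum>\<mu>\<in>M. real (mult \<mu>) * norm \<mu>) \<le> (K * 6 powr \<rho> / ln 2) / (1 - 2 powr (\<rho> - 1))"
proof -
  \<comment> \<open>The index of the shell containing \<mu>. The upper bound for the modulus comes
    from minimality or, at index 0, from the modulus being below 1.\<close>
  define \<l> where "\<l> = (\<lambda>\<mu>::complex. LEAST j. (1/2) ^ Suc j \<le> norm \<mu>)"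
  define q :: real where "q = 2 powr (\<rho> - 1)"
  have q: "0 < q" "q < 1" using \<rho>_less by (auto simp: q_def powr_less_one)
  have \<l>: "(1/2) ^ Suc (\<l> \<mu>) \<le> norm \<mu>" "norm \<mu> \<le> (1/2) ^ \<l> \<mu>" if "\<mu> \<in> M" for \<mu>
  proof -
    have \<mu>: "\<mu> \<noteq> 0" "norm \<mu> < 1" using that assms by (auto simp: spec_def)
    obtain j where "(1/2) ^ j < norm \<mu>"
      using real_arch_pow_inv[of "norm \<mu>" "1/2"] \<mu> by auto
    then have "(1/2) ^ Suc j \<le> norm \<mu>"
      unfolding power_Suc using zero_le_power[of "1 / 2 :: real" j] norm_ge_zero[of \<mu>] by linarith
    then show "(1/2) ^ Suc (\<l> \<mu>) \<le> norm \<mu>" unfolding \<l>_def by (rule LeastI)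
    show "norm \<mu> \<le> (1/2) ^ \<l> \<mu>"
    proof (cases "\<l> \<mu>")
      case 0
      then show ?thesis using \<mu> by simp
    next
      case (Suc i)
      then have "\<not> (1/2) ^ Suc i \<le> norm \<mu>" unfolding \<l>_def by (intro not_less_Least) simp
      then show ?thesis using Suc by simp
    qed
  qed
  have "(\<Sum>\<mu>\<in>M. real (mult \<mu>) * norm \<mu>) \<le> (\<Sum>\<mu>\<in>M. real (mult \<mu>) * (1/2) ^ \<l> \<mu>)"
    by (intro sum_mono mult_left_mono \<l>) auto
  also have "\<dots> = (\<Sum>j\<in>\<l> ` M. \<Sum>\<mu> | \<mu> \<in> M \<and> \<l> \<mu> = j. real (mult \<mu>) * (1/2) ^ \<l> \<mu>)"
    by (rule sum.image_gen[OF assms(1)])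
  also have "\<dots> \<le> (\<Sum>j\<in>\<l> ` M. (K * 6 powr \<rho> / ln 2) * q ^ j)"
  proof (rule sum_mono)
    fix j assume "j \<in> \<l> ` M"
    have "(\<Sum>\<mu> | \<mu> \<in> M \<and> \<l> \<mu> = j. real (mult \<mu>) * (1/2) ^ \<l> \<mu>)
      = (1/2) ^ j * real (\<Sum>\<mu> | \<mu> \<in> M \<and> \<l> \<mu> = j. mult \<mu>)"
      by (simp add: sum_distrib_left mult.commute)
    also have "\<dots> \<le> (1/2) ^ j * (K * (3 * 2 ^ Suc j) powr \<rho> / ln 2)"
    proof (rule mult_left_mono[OF count_zeros])
      fix \<mu> assume "\<mu> \<in> {\<mu> \<in> M. \<l> \<mu> = j}"
      then show "1 / 2 ^ Suc j \<le> norm \<mu>" using \<l>(1)[of \<mu>] by (auto simp: power_one_over)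
    qed (use assms in \<open>auto simp: spec_def\<close>)
    also have "(3 * 2 ^ Suc j) powr \<rho> = 6 powr \<rho> * (2 powr \<rho>) ^ j"
    proof -
      have "(3 * 2 ^ Suc j :: real) = 6 * 2 powr real j" by (simp add: powr_realpow)
      then show ?thesis by (simp add: powr_mult powr_powr powr_realpow[symmetric] mult.commute)
    qed
    also have "(1/2) ^ j * (K * (6 powr \<rho> * (2 powr \<rho>) ^ j) / ln 2) = (K * 6 powr \<rho> / ln 2) * q ^ j"
      by (simp add: q_def powr_diff power_divide field_simps)
    finally show "(\<Sum>\<mu> | \<mu> \<in> M \<and> \<l> \<mu> = j. real (mult \<mu>) * (1/2) ^ \<l> \<mu>) \<le> (K * 6 powr \<rho> / ln 2) * q ^ j" .
  qed
  also have "\<dots> = (K * 6 powr \<rho> / ln 2) * (\<Sum>j\<in>\<l> ` M. q ^ j)"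
    by (simp add: sum_distrib_left)
  also have "\<dots> \<le> (K * 6 powr \<rho> / ln 2) * (1 / (1 - q))"
  proof (rule mult_left_mono)
    show "(\<Sum>j\<in>\<l> ` M. q ^ j) \<le> 1 / (1 - q)"
      using sum_le_suminf[of "\<lambda>j. q ^ j" "\<l> ` M"] suminf_geometric[of q] summable_geometric[of q] q assms(1)
      by auto
  qed (use K_pos in auto)
  finally show ?thesis by (simp add: q_def)
qed

text \<open>Absolute summability allows the unordered sum to be computed along the exhaustion by
  \<open>1 / R \<le> norm \<mu>\<close>. Along it the error in \<open>log_deriv_bound\<close> is of
  size R^(\<rho> - 1), which tends to 0 because \<rho> < 1.\<close>

theorem spec_sum: "((\<lambda>\<mu>. of_nat (mult \<mu>) * \<mu>) has_sum - deriv d 0) spec"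
proof -
  let ?f = "\<lambda>\<mu>. of_nat (mult \<mu>) * \<mu> :: complex"
  have "(\<lambda>\<mu>. real (mult \<mu>) * norm \<mu>) summable_on {\<mu> \<in> spec. norm \<mu> < 1}"
    by (rule nonneg_bdd_above_summable_on) (auto intro!: bdd_aboveI2 small_spec_sum)
  moreover have "(\<lambda>\<mu>. real (mult \<mu>) * norm \<mu>) summable_on {\<mu> \<in> spec. 1 / 1 \<le> norm \<mu>}"
    using finite_spec[of 1] by (intro summable_on_finite) auto
  ultimately have un: "(\<lambda>\<mu>. real (mult \<mu>) * norm \<mu>) summable_on {\<mu> \<in> spec. norm \<mu> < 1} \<union> {\<mu> \<in> spec. 1 / 1 \<le> norm \<mu>}"
    by (intro summable_on_Un_disjoint) auto
  have "{\<mu> \<in> spec. norm \<mu> < 1} \<union> {\<mu> \<in> spec. 1 / 1 \<le> norm \<mu>} = spec" by auto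
  with un have "(\<lambda>\<mu>. norm (?f \<mu>)) summable_on spec"
    by (simp add: norm_mult)
  then have "?f summable_on spec" by (rule abs_summable_summable)
  then have sum: "(?f has_sum infsum ?f spec) spec" by simp
  define M where "M = (\<lambda>n. {\<mu> \<in> spec. 1 / real (Suc n) \<le> norm \<mu>})"
  have fin: "finite (M n)" for n unfolding M_def by (rule finite_spec) simp
  have lim: "filterlim M (finite_subsets_at_top spec) sequentially"
    unfolding filterlim_finite_subsets_at_top
  proof safe
    fix X assume X: "finite X" "X \<subseteq> spec"
    have "\<forall>\<^sub>F n in sequentially. \<forall>\<mu>\<in>X. 1 / real (Suc n) \<le> norm \<mu>"
      unfolding eventually_ball_finite_distrib[OF X(1)]
    proof
      fix \<mu> assume "\<mu> \<in> X"
      then have "0 < norm \<mu>" using X by (auto simp: spec_def)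
      then have "\<forall>\<^sub>F n in sequentially. 1 / real (Suc n) < norm \<mu>"
        using LIMSEQ_inverse_real_of_nat by (auto simp: inverse_eq_divide dest!: order_tendstoD(2))
      then show "\<forall>\<^sub>F n in sequentially. 1 / real (Suc n) \<le> norm \<mu>"
        by eventually_elim simp
    qed
    then show "\<forall>\<^sub>F n in sequentially. finite (M n) \<and> X \<subseteq> M n \<and> M n \<subseteq> spec"
      by eventually_elim (use X fin in \<open>auto simp: M_def\<close>)
  qed
  have lim1: "(\<lambda>n. sum ?f (M n)) \<longlonglongrightarrow> infsum ?f spec"
    using filterlim_compose[OF sum[unfolded has_sum_def] lim] .
  have "(\<lambda>n. deriv d 0 + sum ?f (M n)) \<longlonglongrightarrow> 0"
  proof (rule Lim_null_comparison)
    show "\<forall>\<^sub>F n in sequentially. norm (deriv d 0 + sum ?f (M n)) \<le> 4 * K * 3 powr \<rho> * real (Suc n) powr (\<rho> - 1)"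
    proof (intro always_eventually allI)
      fix n
      have "norm (deriv d 0 + sum ?f (M n)) \<le> 4 * K * (3 * real (Suc n)) powr \<rho> / real (Suc n)"
        unfolding M_def by (rule log_deriv_bound) simp
      also have "\<dots> = 4 * K * 3 powr \<rho> * real (Suc n) powr (\<rho> - 1)"
        by (simp only: powr_mult powr_diff) simp
      finally show "norm (deriv d 0 + sum ?f (M n)) \<le> 4 * K * 3 powr \<rho> * real (Suc n) powr (\<rho> - 1)" .
    qed
    have "filterlim (\<lambda>n. real (Suc n)) at_top sequentially"
      using filterlim_compose[OF filterlim_real_sequentially filterlim_Suc] .
    then have "(\<lambda>n. real (Suc n) powr (\<rho> - 1)) \<longlonglongrightarrow> 0"
      using \<rho>_less by (intro tendsto_neg_powr) auto
    then show "(\<lambda>n. 4 * K * 3 powr \<rho> * real (Suc n) powr (\<rho> - 1)) \<longlonglongrightarrow> 0"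
      by (rule tendsto_mult_right_zero)
  qed
  then have "deriv d 0 + infsum ?f spec = 0"
    using LIMSEQ_unique[OF tendsto_add[OF tendsto_const lim1]] by blast
  then show ?thesis using sum by (simp add: add_eq_0_iff)
qed

end

section \<open>Fredholm determinants of weighted matrices\<close>

text \<open>Expanding \<open>f\<close> along column \<open>p\<close> and \<open>g\<close> along row
  \<open>p\<close> leaves the same minor in both. The crosswise form avoids dividing by entries that
  may vanish.\<close>

lemma fdet_cofactor:
  assumes p: "p < n"
    and f: "\<And>i. i < n \<Longrightarrow> i \<noteq> p \<Longrightarrow> f i p = 0"
    and g: "\<And>j. j < n \<Longrightarrow> j \<noteq> p \<Longrightarrow> g p j = 0"
    and fg: "\<And>i j. i \<noteq> p \<Longrightarrow> j \<noteq> p \<Longrightarrow> f i j = g i j"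
  shows "fdet n f * g p p = fdet n g * f p p"
proof -
  let ?F = "mat n n (\<lambda>(i, j). f i j)" and ?G = "mat n n (\<lambda>(i, j). g i j)"
  have "fdet n f = (\<Sum>i<n. ?F $$ (i, p) * cofactor ?F i p)"
    unfolding fdet_def by (rule laplace_expansion_column) (use p in auto)
  also have "\<dots> = (\<Sum>i<n. if i = p then f p p * cofactor ?F p p else 0)"
    using p f by (intro sum.cong) auto
  finally have 1: "fdet n f = f p p * cofactor ?F p p" using p by simp
  have "fdet n g = (\<Sum>j<n. ?G $$ (p, j) * cofactor ?G p j)"
    unfolding fdet_def by (rule laplace_expansion_row) (use p in auto)
  also have "\<dots> = (\<Sum>j<n. if j = p then g p p * cofactor ?G p p else 0)"
    using p g by (intro sum.cong) auto
  finally have 2: "fdet n g = g p p * cofactor ?G p p" using p by simp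
  have "mat_delete ?F p p = mat_delete ?G p p"
    by (rule eq_matI) (auto simp: mat_delete_def fg)
  then show ?thesis by (simp add: 1 2 cofactor_def)
qed

text \<open>Cramer's rule, read as a determinant identity rather than as a way to solve a
  system.\<close>

lemma fdet_replace_col:
  assumes "p < n"
  shows "fdet n (\<lambda>i j. if j = p then \<Sum>k<n. f i k * x k else f i j) = x p * fdet n f"
proof -
  let ?A = "mat n n (\<lambda>(i, j). f i j)" and ?x = "vec n x"
  have "replace_col ?A (?A *\<^sub>v ?x) p = mat n n (\<lambda>(i, j). if j = p then \<Sum>k<n. f i k * x k else f i j)"
    by (rule eq_matI) (auto simp: replace_col_def scalar_prod_def atLeast0LessThan)
  with cramer_lemma_mat[of ?A n ?x p] assms show ?thesis
    unfolding fdet_def by simp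
qed

text \<open>Makes sections of different size comparable by \<open>fdet_perturb\<close>. The entries
  of \<open>f\<close> below the small block are kept, so that the padded array agrees with the
  larger section in all of the first \<open>n\<close> columns; block triangularity tolerates
  them.\<close>

lemma fdet_pad:
  assumes "n \<le> N"
  shows "fdet n f = fdet N (\<lambda>i j. if j < n then f i j else if i = j then 1 else 0)"
proof -
  have "mat N N (\<lambda>(i, j). if j < n then f i j else if i = j then 1 else 0) =
    four_block_mat (mat n n (\<lambda>(i, j). f i j)) (0\<^sub>m n (N - n))
      (mat (N - n) n (\<lambda>(i, j). f (i + n) j)) (1\<^sub>m (N - n))"
    using assms by (intro eq_matI) auto
  then show ?thesis
    unfolding fdet_def
    using det_four_block_mat_upper_right_zero[of "mat n n (\<lambda>(i, j). f i j)" n "0\<^sub>m n (N - n)" "N - n"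
        "mat (N - n) n (\<lambda>(i, j). f (i + n) j)" "1\<^sub>m (N - n)"]
    by simp
qed

lemma fdet_null_vector:
  assumes "fdet n f = 0"
  shows "\<exists>v. (\<exists>i<n. v i \<noteq> 0) \<and> (\<forall>i\<ge>n. v i = 0) \<and> (\<forall>i<n. (\<Sum>j<n. f i j * v j) = 0)"
proof -
  let ?A = "mat n n (\<lambda>(i, j). f i j)"
  obtain v where v: "v \<in> carrier_vec n" "v \<noteq> 0\<^sub>v n" "?A *\<^sub>v v = 0\<^sub>v n"
    using assms det_0_iff_vec_prod_zero[of ?A n] unfolding fdet_def by auto
  let ?v = "\<lambda>i. if i < n then vec_index v i else 0"
  have "\<exists>i<n. ?v i \<noteq> 0"
  proof (rule ccontr)
    assume "\<not> (\<exists>i<n. ?v i \<noteq> 0)"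
    then have "v = 0\<^sub>v n" using v(1) by (intro eq_vecI) auto
    then show False using v(2) by contradiction
  qed
  moreover have "(\<Sum>j<n. f i j * ?v j) = 0" if "i < n" for i
  proof -
    have "vec_index (?A *\<^sub>v v) i = (\<Sum>j<n. f i j * ?v j)"
      using that v(1) by (auto simp: scalar_prod_def atLeast0LessThan intro!: sum.cong)
    then show ?thesis using v(3) that by simp
  qed
  ultimately show ?thesis by (intro exI[of _ ?v]) auto
qed

text \<open>Lowers the order of the Hadamard bound from one to \<rho>. For x \<le> 1 it follows from
  x \<le> x^\<rho>, for larger x from ln x = ln (x^\<rho>) / \<rho>.\<close>

lemma one_plus_le_exp_powr:
  fixes x \<rho> :: real
  assumes "0 \<le> x" "0 < \<rho>" "\<rho> < 1"
  shows "1 + x \<le> exp (2 * x powr \<rho> / \<rho>)"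
proof (cases "x \<le> 1")
  case True
  have "x \<le> x powr \<rho>"
    using True assms powr_mono'[of \<rho> 1 x] by (cases "x = 0") auto
  also have "\<dots> \<le> 2 * x powr \<rho> / \<rho>"
  proof -
    have "\<rho> * x powr \<rho> \<le> 2 * x powr \<rho>" using assms by (intro mult_right_mono) auto
    then show ?thesis using assms by (simp add: field_simps)
  qed
  finally have "exp x \<le> exp (2 * x powr \<rho> / \<rho>)" by simp
  then show ?thesis using exp_ge_add_one_self[of x] by linarith
next
  case False
  then have x: "x > 1" by simp
  have "ln (1 + x) \<le> ln (2 * x)" using x by simp
  also have "\<dots> = ln 2 + ln x" using x by (simp add: ln_mult)
  also have "ln x = ln (x powr \<rho>) / \<rho>" using assms x by (simp add: ln_powr)
  also have "\<dots> \<le> (x powr \<rho> - 1) / \<rho>"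
    using assms x by (intro divide_right_mono ln_le_minus_one) auto
  also have "ln (2::real) \<le> 1" using ln_le_minus_one[of 2] by simp
  also have "1 + (x powr \<rho> - 1) / \<rho> \<le> 2 * x powr \<rho> / \<rho>"
  proof -
    have "(\<rho> + (x powr \<rho> - 1)) / \<rho> \<le> 2 * x powr \<rho> / \<rho>"
      using assms powr_ge_zero[of x \<rho>] by (intro divide_right_mono) linarith+
    then show ?thesis using assms by (simp add: add_divide_distrib)
  qed
  finally have "exp (ln (1 + x)) \<le> exp (2 * x powr \<rho> / \<rho>)" by simp
  then show ?thesis using x by simp
qed

text \<open>\<theta> weighs the rows and is square summable because column lengths are Euclidean.
  \<beta> weighs the columns, and its summability exponent \<rho> becomes the order of the
  determinant.\<close>

locale weights =
  fixes \<theta> \<beta> :: "nat \<Rightarrow> real" and \<rho> :: real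
  assumes \<theta>_pos: "\<And>i. 0 < \<theta> i" and \<beta>_pos: "\<And>i. 0 < \<beta> i"
    and \<theta>_l2: "summable (\<lambda>i. (\<theta> i)\<^sup>2)"
    and \<beta>_l\<rho>: "summable (\<lambda>i. \<beta> i powr \<rho>)"
    and \<rho>_pos: "0 < \<rho>" and \<rho>_less: "\<rho> < 1"
begin

definition T :: real where "T = sqrt (\<Sum>i. (\<theta> i)\<^sup>2)"

lemma T_pos: "0 < T"
  unfolding T_def real_sqrt_gt_0_iff using \<theta>_l2 \<theta>_pos by (intro suminf_pos) (auto simp: less_imp_neq[symmetric])

lemma L2_\<theta>: "L2_set \<theta> {..<n} \<le> T"
  unfolding T_def L2_set_def by (intro real_sqrt_le_mono sum_le_suminf \<theta>_l2) auto

lemma \<theta>_le_T: "\<theta> i \<le> T"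
proof -
  have "(\<theta> i)\<^sup>2 \<le> (\<Sum>i. (\<theta> i)\<^sup>2)"
    using sum_le_suminf[OF \<theta>_l2, of "{i}"] by simp
  then show ?thesis unfolding T_def using real_le_rsqrt by blast
qed

lemma summable_\<beta>: "summable \<beta>"
proof (rule summable_comparison_test_ev[OF _ \<beta>_l\<rho>])
  have "\<forall>\<^sub>F i in sequentially. \<beta> i powr \<rho> < 1"
    using summable_LIMSEQ_zero[OF \<beta>_l\<rho>] by (rule order_tendstoD) simp
  then show "\<forall>\<^sub>F i in sequentially. norm (\<beta> i) \<le> \<beta> i powr \<rho>"
  proof eventually_elim
    case (elim i)
    then have "\<beta> i \<le> 1" using \<beta>_pos[of i] \<rho>_pos by (smt (verit) ge_one_powr_ge_zero)
    then show ?case using \<beta>_pos[of i] \<rho>_less powr_mono'[of \<rho> 1 "\<beta> i"] by simp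
  qed
qed

section \<open>Finite sections and their limit\<close>

definition adm :: "real \<Rightarrow> (nat \<Rightarrow> nat \<Rightarrow> complex) \<Rightarrow> bool" where
  "adm C A \<longleftrightarrow> 0 < C \<and> (\<forall>i j. norm (A i j) \<le> C * \<theta> i * \<beta> j)"

lemma adm_pos: "adm C A \<Longrightarrow> 0 < C" and admD: "adm C A \<Longrightarrow> norm (A i j) \<le> C * \<theta> i * \<beta> j"
  unfolding adm_def by auto

definition sdet :: "(nat \<Rightarrow> nat \<Rightarrow> complex) \<Rightarrow> nat \<Rightarrow> complex \<Rightarrow> complex" where
  "sdet A n z = fdet n (\<lambda>i j. (if i = j then 1 else 0) - z * A i j)"

definition fredholm :: "(nat \<Rightarrow> nat \<Rightarrow> complex) \<Rightarrow> complex \<Rightarrow> complex" where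
  "fredholm A z = lim (\<lambda>n. sdet A n z)"

definition tail :: "nat \<Rightarrow> real" where "tail n = (\<Sum>j. \<beta> (j + n))"

lemma tail_tendsto: "tail \<longlonglongrightarrow> 0"
  unfolding tail_def by (rule suminf_exist_split2[OF summable_\<beta>])

lemma sum_le_tail: "n \<le> N \<Longrightarrow> (\<Sum>j\<in>{n..<N}. \<beta> j) \<le> tail n"
proof -
  assume "n \<le> N"
  then have "(\<Sum>j\<in>{n..<N}. \<beta> j) = (\<Sum>j<N - n. \<beta> (j + n))"
    by (intro sum.reindex_bij_witness[of _ "\<lambda>j. j + n" "\<lambda>j. j - n"]) auto
  also have "\<dots> \<le> tail n"
    unfolding tail_def by (intro sum_le_suminf summable_ignore_initial_segment summable_\<beta>) (auto simp: \<beta>_pos less_imp_le)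
  finally show ?thesis .
qed

lemma colnorm_le:
  assumes "\<And>i. i < n \<Longrightarrow> norm (x i) \<le> c * \<theta> i" "0 \<le> c"
  shows "colnorm n x \<le> c * T"
proof -
  have "colnorm n x \<le> L2_set (\<lambda>i. c * \<theta> i) {..<n}"
    unfolding colnorm_def using assms by (intro L2_set_mono) auto
  also have "\<dots> = c * L2_set \<theta> {..<n}"
    using assms(2) by (simp add: L2_set_right_distrib)
  also have "\<dots> \<le> c * T" using L2_\<theta> assms(2) by (rule mult_left_mono)
  finally show ?thesis .
qed

lemma colnorm_sdet:
  assumes "adm C A" "j < n"
  shows "colnorm n (\<lambda>i. (if i = j then 1 else 0) - z * A i j) \<le> 1 + norm z * C * T * \<beta> j"
proof -
  have "colnorm n (\<lambda>i. (if i = j then 1 else 0) + (- z) * A i j) \<le> 1 + colnorm n (\<lambda>i. - z * A i j)"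
    using colnorm_triangle[of n "\<lambda>i. if i = j then 1 else 0" "\<lambda>i. - z * A i j"] colnorm_unit[OF assms(2)] by simp
  also have "colnorm n (\<lambda>i. - z * A i j) \<le> (norm z * C * \<beta> j) * T"
  proof (rule colnorm_le)
    fix i show "norm (- z * A i j) \<le> norm z * C * \<beta> j * \<theta> i"
      using mult_left_mono[OF admD[OF assms(1), of i j], of "norm z"] by (simp add: norm_mult mult_ac)
  qed (use adm_pos[OF assms(1)] \<beta>_pos[of j] in auto)
  finally show ?thesis by (simp add: mult_ac)
qed

text \<open>Bounds the product of the column lengths of every finite section, uniformly in its
  size.\<close>

definition expB :: "real \<Rightarrow> complex \<Rightarrow> real" where
  "expB C z = exp (norm z * C * T * suminf \<beta>)"

lemma sum_\<beta>_le: "0 < C \<Longrightarrow> exp (\<Sum>j<n. norm z * C * T * \<beta> j) \<le> expB C z"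
proof -
  assume "0 < C"
  moreover have "(\<Sum>j<n. \<beta> j) \<le> suminf \<beta>"
    by (intro sum_le_suminf summable_\<beta>) (auto simp: \<beta>_pos less_imp_le)
  ultimately show ?thesis unfolding expB_def sum_distrib_left[symmetric]
    using T_pos by (intro exp_mono mult_left_mono) auto
qed

text \<open>After padding by unit columns the two sections differ only in the columns from
  \<open>n\<close> on, whose lengths add up to a multiple of the tail of \<beta>.\<close>

lemma sdet_step:
  assumes A: "adm C A" and "n \<le> N"
  shows "norm (sdet A n z - sdet A N z) \<le> norm z * C * T * tail n * expB C z"
proof -
  note C = adm_pos[OF A]
  let ?x = "\<lambda>j. norm z * C * T * \<beta> j"
  let ?d = "\<lambda>j. if j < n then 0 else ?x j"
  have x_nonneg: "0 \<le> ?x j" for j using C T_pos \<beta>_pos[of j] by simp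
  let ?P = "\<lambda>i j. if j < n then (if i = j then 1 else 0) - z * A i j else if i = j then 1 else 0"
  have "norm (fdet N ?P - sdet A N z) \<le> (\<Sum>j<N. ?d j) * exp (\<Sum>j<N. ?x j)"
    unfolding sdet_def
  proof (rule fdet_perturb)
    fix j assume j: "j < N"
    show "colnorm N (\<lambda>i. (if i = j then 1 else 0) - z * A i j) \<le> 1 + ?x j"
      by (rule colnorm_sdet[OF A j])
    then show "colnorm N (\<lambda>i. ?P i j) \<le> 1 + ?x j"
      using colnorm_unit[OF j] x_nonneg[of j] by (cases "j < n") auto
    show "colnorm N (\<lambda>i. ?P i j - ((if i = j then 1 else 0) - z * A i j)) \<le> ?d j"
    proof (cases "j < n")
      case True
      then show ?thesis by (simp add: colnorm_def L2_set_def)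
    next
      case False
      have "colnorm N (\<lambda>i. z * A i j) \<le> (norm z * C * \<beta> j) * T"
      proof (rule colnorm_le)
        fix i show "norm (z * A i j) \<le> norm z * C * \<beta> j * \<theta> i"
          using mult_left_mono[OF admD[OF A, of i j], of "norm z"] by (simp add: norm_mult mult_ac)
      qed (use C \<beta>_pos[of j] in auto)
      then show ?thesis using False by (simp add: mult_ac)
    qed
  qed (rule x_nonneg)
  also have "(\<Sum>j<N. ?d j) = (\<Sum>j\<in>{n..<N}. ?x j)"
    by (rule sum.mono_neutral_cong_right) auto
  also have "\<dots> = norm z * C * T * (\<Sum>j\<in>{n..<N}. \<beta> j)"
    by (simp add: sum_distrib_left)
  also have "\<dots> * exp (\<Sum>j<N. ?x j) \<le> norm z * C * T * tail n * expB C z"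
    using C T_pos sum_le_tail[OF assms(2)] sum_\<beta>_le[OF C]
    by (intro mult_mono mult_left_mono mult_nonneg_nonneg) (auto intro!: sum_nonneg order.trans[OF _ sum_le_tail[OF assms(2)]] simp: \<beta>_pos less_imp_le)
  finally show ?thesis
    unfolding sdet_def by (subst fdet_pad[OF assms(2)])
qed

lemma sdet_tendsto:
  assumes A: "adm C A"
  shows "(\<lambda>n. sdet A n z) \<longlonglongrightarrow> fredholm A z"
proof -
  let ?b = "\<lambda>n. norm z * C * T * tail n * expB C z"
  have b: "?b \<longlonglongrightarrow> 0"
    by (rule tendsto_eq_intros tail_tendsto refl | simp)+
  have "Cauchy (\<lambda>n. sdet A n z)"
  proof (rule metric_CauchyI)
    fix e :: real assume "e > 0"
    then have "\<forall>\<^sub>F n in sequentially. ?b n < e / 2"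
      by (intro order_tendstoD(2)[OF b]) simp
    then obtain M where M: "?b M < e / 2"
      by (meson eventually_happens' trivial_limit_sequentially)
    have "dist (sdet A m z) (sdet A n z) < e" if "m \<ge> M" "n \<ge> M" for m n
    proof -
      have "dist (sdet A m z) (sdet A n z) \<le> dist (sdet A M z) (sdet A m z) + dist (sdet A M z) (sdet A n z)"
        by (metis dist_commute dist_triangle)
      then show ?thesis using sdet_step[OF A that(1), of z] sdet_step[OF A that(2), of z] M
        by (simp add: dist_norm)
    qed
    then show "\<exists>M. \<forall>m\<ge>M. \<forall>n\<ge>M. dist (sdet A m z) (sdet A n z) < e" by blast
  qed
  then show ?thesis
    unfolding fredholm_def by (simp add: Cauchy_convergent_iff convergent_LIMSEQ_iff)
qed

lemma sdet_fredholm: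
  assumes A: "adm C A"
  shows "norm (sdet A n z - fredholm A z) \<le> norm z * C * T * tail n * expB C z"
proof (rule tendsto_upperbound)
  show "(\<lambda>N. norm (sdet A n z - sdet A N z)) \<longlonglongrightarrow> norm (sdet A n z - fredholm A z)"
    by (intro tendsto_intros sdet_tendsto[OF A])
  show "\<forall>\<^sub>F N in sequentially. norm (sdet A n z - sdet A N z) \<le> norm z * C * T * tail n * expB C z"
    using eventually_ge_at_top[of n] by eventually_elim (rule sdet_step[OF A])
qed simp

lemma sdet_uniform_limit:
  assumes A: "adm C A" and "bounded X"
  shows "uniform_limit X (sdet A) (fredholm A) sequentially"
proof -
  obtain R where R: "\<And>z. z \<in> X \<Longrightarrow> norm z \<le> R" "0 < R"
    using assms(2) bounded_pos by blast
  note C = adm_pos[OF A]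
  let ?b = "\<lambda>n. R * C * T * tail n * exp (R * C * T * suminf \<beta>)"
  have b: "?b \<longlonglongrightarrow> 0"
    by (rule tendsto_eq_intros tail_tendsto refl | simp)+
  have tail: "0 \<le> tail n" for n
    using sum_le_tail[of n n] by simp
  have sb: "0 \<le> suminf \<beta>" using summable_\<beta> \<beta>_pos by (simp add: suminf_nonneg less_imp_le)
  show ?thesis
  proof (rule uniform_limitI)
    fix e :: real assume "e > 0"
    then have "\<forall>\<^sub>F n in sequentially. ?b n < e"
      by (intro order_tendstoD(2)[OF b]) simp
    then show "\<forall>\<^sub>F n in sequentially. \<forall>z\<in>X. dist (sdet A n z) (fredholm A z) < e"
    proof eventually_elim
      case (elim n)
      show ?case
      proof
        fix z assume "z \<in> X"
        then have z: "norm z \<le> R" using R by blast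
        have "norm (sdet A n z - fredholm A z) \<le> norm z * C * T * tail n * expB C z"
          by (rule sdet_fredholm[OF A])
        also have "\<dots> \<le> ?b n"
          unfolding expB_def using z C T_pos tail[of n] sb R(2)
          by (intro mult_mono exp_mono mult_nonneg_nonneg) auto
        finally show "dist (sdet A n z) (fredholm A z) < e" using elim by (simp add: dist_norm)
      qed
    qed
  qed
qed

lemma sdet_holomorphic: "sdet A n holomorphic_on X"
  unfolding sdet_def[abs_def] fdet_leibniz by (intro holomorphic_intros)

lemma fredholm_entire:
  assumes A: "adm C A"
  shows "fredholm A holomorphic_on UNIV"
proof (rule holomorphic_uniform_sequence[OF _ sdet_holomorphic])
  fix z show "\<exists>d>0. cball z d \<subseteq> UNIV \<and> uniform_limit (cball z d) (sdet A) (fredholm A) sequentially"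
    by (intro exI[of _ 1]) (auto intro!: sdet_uniform_limit[OF A])
qed auto

lemma fredholm_0: assumes A: "adm C A" shows "fredholm A 0 = 1"
proof -
  have "sdet A n 0 = 1" for n
  proof -
    have "mat n n (\<lambda>(i, j). (if i = j then 1 else 0) - 0 * A i j) = 1\<^sub>m n"
      by (rule eq_matI) auto
    then show ?thesis unfolding sdet_def fdet_def by simp
  qed
  then show ?thesis using sdet_fredholm[OF A, of 0 0] by simp
qed

text \<open>A permutation other than the identity moves at least two points, so its product still
  contains a vanishing Kronecker factor after one factor has been differentiated.\<close>

lemma sdet_deriv: "deriv (sdet A n) 0 = - (\<Sum>i<n. A i i)"
proof -
  let ?\<delta> = "\<lambda>p j. if p j = j then 1 else 0 :: complex"
  have "((\<lambda>z. \<Prod>j<n. ?\<delta> p j - z * A (p j) j) has_field_derivative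
      (\<Sum>j<n. (- A (p j) j) * (\<Prod>i\<in>{..<n} - {j}. ?\<delta> p i - 0 * A (p i) i))) (at 0)" for p
    by (rule has_field_derivative_prod) (auto intro!: derivative_eq_intros)
  then have "(sdet A n has_field_derivative (\<Sum>p | p permutes {0..<n}. signof p *
      (\<Sum>j<n. (- A (p j) j) * (\<Prod>i\<in>{..<n} - {j}. ?\<delta> p i)))) (at 0)"
    unfolding sdet_def[abs_def] fdet_leibniz by (intro DERIV_sum DERIV_cmult) simp
  also have "(\<Sum>p | p permutes {0..<n}. signof p * (\<Sum>j<n. (- A (p j) j) * (\<Prod>i\<in>{..<n} - {j}. ?\<delta> p i)))
    = (\<Sum>p\<in>{id}. signof p * (\<Sum>j<n. (- A (p j) j) * (\<Prod>i\<in>{..<n} - {j}. ?\<delta> p i)))"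
  proof (rule sum.mono_neutral_right)
    show "\<forall>p\<in>{p. p permutes {0..<n}} - {id}. signof p * (\<Sum>j<n. (- A (p j) j) * (\<Prod>i\<in>{..<n} - {j}. ?\<delta> p i)) = 0"
    proof
      fix p assume p: "p \<in> {p. p permutes {0..<n}} - {id}"
      then have perm: "p permutes {0..<n}" and "p \<noteq> id" by auto
      then obtain i where i: "p i \<noteq> i" by (auto simp: fun_eq_iff)
      then have "i \<in> {0..<n}" using permutes_not_in[OF perm] by blast
      then have i': "i < n" "p i < n" using permutes_in_image[OF perm, of i] by auto
      have pp: "p (p i) \<noteq> p i" using i permutes_inj[OF perm] by (auto dest: injD)
      have "(\<Prod>i\<in>{..<n} - {j}. ?\<delta> p i) = 0" for j
      proof (cases "j = i")
        case True
        then show ?thesis using i i' pp by (intro prod_zero) (auto intro!: bexI[of _ "p i"])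
      next
        case False
        then show ?thesis using i i' by (intro prod_zero) (auto intro!: bexI[of _ i])
      qed
      then show "signof p * (\<Sum>j<n. (- A (p j) j) * (\<Prod>i\<in>{..<n} - {j}. ?\<delta> p i)) = 0" by simp
    qed
  qed (auto simp: finite_permutations permutes_id)
  also have "\<dots> = - (\<Sum>i<n. A i i)"
    by (simp add: sum_negf)
  finally show ?thesis by (rule DERIV_imp_deriv)
qed

lemma summable_diag:
  assumes A: "adm C A"
  shows "summable (\<lambda>i. A i i)"
proof (rule summable_comparison_test')
  show "summable (\<lambda>i. C * T * \<beta> i)" by (intro summable_mult summable_\<beta>)
  fix i :: nat assume "0 \<le> i"
  have "norm (A i i) \<le> C * \<theta> i * \<beta> i" by (rule admD[OF A])
  also have "\<dots> \<le> C * T * \<beta> i"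
    using \<theta>_le_T adm_pos[OF A] \<beta>_pos[of i] by (intro mult_right_mono mult_left_mono) auto
  finally show "norm (A i i) \<le> C * T * \<beta> i" .
qed

lemma fredholm_deriv:
  assumes A: "adm C A"
  shows "deriv (fredholm A) 0 = - (\<Sum>i. A i i)"
proof -
  have "(\<lambda>n. (deriv ^^ 1) (sdet A n) 0) \<longlonglongrightarrow> (deriv ^^ 1) (fredholm A) 0"
    by (rule higher_deriv_complex_uniform_limit[where A = "ball 0 1"])
      (auto intro!: sdet_uniform_limit[OF A] always_eventually sdet_holomorphic)
  then have "(\<lambda>n. - (\<Sum>i<n. A i i)) \<longlonglongrightarrow> deriv (fredholm A) 0"
    by (simp add: sdet_deriv)
  moreover have "(\<lambda>n. - (\<Sum>i<n. A i i)) \<longlonglongrightarrow> - (\<Sum>i. A i i)"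
    by (intro tendsto_minus summable_LIMSEQ summable_diag[OF A])
  ultimately show ?thesis by (rule LIMSEQ_unique)
qed

text \<open>The exponents that \<open>one_plus_le_exp_powr\<close> supplies for all columns, added
  up, with the power of \<open>norm z\<close> taken out.\<close>

definition growthK :: "real \<Rightarrow> real" where
  "growthK C = 2 * (C * T) powr \<rho> / \<rho> * (\<Sum>i. \<beta> i powr \<rho>)"

lemma growthK_pos: "0 < C \<Longrightarrow> 0 < growthK C"
  unfolding growthK_def using T_pos \<rho>_pos \<beta>_pos \<beta>_l\<rho>
  by (intro mult_pos_pos divide_pos_pos suminf_pos) (auto simp: less_imp_neq[symmetric])

lemma fredholm_growth:
  assumes A: "adm C A"
  shows "norm (fredholm A z) \<le> exp (growthK C * norm z powr \<rho>)"
proof (rule tendsto_upperbound)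
  note C = adm_pos[OF A]
  show "(\<lambda>n. norm (sdet A n z)) \<longlonglongrightarrow> norm (fredholm A z)"
    by (intro tendsto_intros sdet_tendsto[OF A])
  have "norm (sdet A n z) \<le> exp (growthK C * norm z powr \<rho>)" for n
  proof -
    have x_nonneg: "0 \<le> norm z * C * T * \<beta> j" for j using C T_pos \<beta>_pos[of j] by simp
    have "norm (sdet A n z) \<le> (\<Prod>j<n. colnorm n (\<lambda>i. (if i = j then 1 else 0) - z * A i j))"
      unfolding sdet_def by (rule hadamard)
    also have "\<dots> \<le> (\<Prod>j<n. exp (2 * (norm z * C * T * \<beta> j) powr \<rho> / \<rho>))"
    proof (intro prod_mono conjI)
      fix j assume "j \<in> {..<n}"
      then have "colnorm n (\<lambda>i. (if i = j then 1 else 0) - z * A i j) \<le> 1 + norm z * C * T * \<beta> j"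
        by (intro colnorm_sdet[OF A]) auto
      also have "\<dots> \<le> exp (2 * (norm z * C * T * \<beta> j) powr \<rho> / \<rho>)"
        by (rule one_plus_le_exp_powr[OF x_nonneg \<rho>_pos \<rho>_less])
      finally show "colnorm n (\<lambda>i. (if i = j then 1 else 0) - z * A i j) \<le> \<dots>" .
    qed auto
    also have "\<dots> = exp (\<Sum>j<n. 2 * (norm z * C * T * \<beta> j) powr \<rho> / \<rho>)"
      by (simp add: exp_sum)
    also have "(\<Sum>j<n. 2 * (norm z * C * T * \<beta> j) powr \<rho> / \<rho>) = 2 * (C * T) powr \<rho> / \<rho> * norm z powr \<rho> * (\<Sum>j<n. \<beta> j powr \<rho>)"
      using C T_pos \<beta>_pos by (simp add: powr_mult less_imp_le sum_distrib_left sum_divide_distrib mult_ac)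
    also have "\<dots> \<le> 2 * (C * T) powr \<rho> / \<rho> * norm z powr \<rho> * (\<Sum>j. \<beta> j powr \<rho>)"
      using \<rho>_pos by (intro mult_left_mono sum_le_suminf \<beta>_l\<rho>) auto
    finally show ?thesis by (simp add: growthK_def mult_ac)
  qed
  then show "\<forall>\<^sub>F n in sequentially. norm (sdet A n z) \<le> exp (growthK C * norm z powr \<rho>)" by simp
qed simp

end

section \<open>Deflation of eigenvalues\<close>

text \<open>Algebraic multiplicities are dimensions over the complex numbers, hence the explicit
  complex scaling.\<close>

interpretation fv: vector_space "\<lambda>(c::complex) (v::nat \<Rightarrow> complex) i. c * v i"
  by unfold_locales (auto simp: fun_eq_iff algebra_simps)

lemma sum_delta_minus:
  fixes z :: complex
  shows "(\<Sum>k<n. ((if i = k then 1 else 0) - z * a k) * v k) = (\<Sum>k<n. if i = k then v k else 0) - z * (\<Sum>k<n. a k * v k)"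
proof -
  have "((if i = k then 1 else 0) - z * a k) * v k = (if i = k then v k else 0) - z * (a k * v k)" for k
    by (simp add: algebra_simps)
  then show ?thesis by (simp add: sum_subtractf sum_distrib_left)
qed

context weights
begin

text \<open>An admissible matrix maps bounded sequences into this space, so bounded eigenvectors for
  nonzero eigenvalues belong to it automatically. Domination by \<theta> is also what keeps a matrix
  admissible when a multiple of such a vector is subtracted from its columns.\<close>

definition V :: "(nat \<Rightarrow> complex) set" where
  "V = {v. \<exists>C. \<forall>i. norm (v i) \<le> C * \<theta> i}"

definition app :: "(nat \<Rightarrow> nat \<Rightarrow> complex) \<Rightarrow> (nat \<Rightarrow> complex) \<Rightarrow> nat \<Rightarrow> complex" where
  "app A v i = (\<Sum>j. A i j * v j)"

lemma VE:
  assumes "v \<in> V"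
  obtains C where "0 < C" "\<And>i. norm (v i) \<le> C * \<theta> i"
proof -
  obtain C where C: "\<And>i. norm (v i) \<le> C * \<theta> i" using assms by (auto simp: V_def)
  have "norm (v i) \<le> max 1 C * \<theta> i" for i
    using C[of i] mult_right_mono[of C "max 1 C" "\<theta> i"] \<theta>_pos[of i] by linarith
  then show thesis by (intro that[of "max 1 C"]) auto
qed

lemma V_lincomb: "v \<in> V \<Longrightarrow> w \<in> V \<Longrightarrow> (\<lambda>i. c * v i + w i) \<in> V"
proof -
  assume "v \<in> V" "w \<in> V"
  then obtain C D where C: "\<And>i. norm (v i) \<le> C * \<theta> i" and D: "\<And>i. norm (w i) \<le> D * \<theta> i"
    by (auto simp: V_def)
  have "norm (c * v i + w i) \<le> (norm c * C + D) * \<theta> i" for i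
    using norm_triangle_ineq[of "c * v i" "w i"] mult_left_mono[OF C[of i], of "norm c"] D[of i]
    by (simp add: norm_mult algebra_simps)
  then show ?thesis by (auto simp: V_def)
qed

lemma V_0: "(\<lambda>i. 0) \<in> V"
  by (auto simp: V_def intro!: exI[of _ 0])

lemma V_scale: "v \<in> V \<Longrightarrow> (\<lambda>i. c * v i) \<in> V"
  using V_lincomb[OF _ V_0, of v c] by simp

lemma app_summable:
  assumes A: "adm C A" and v: "\<And>j. norm (v j) \<le> D" and "0 \<le> D"
  shows "summable (\<lambda>j. norm (A i j * v j))" "norm (app A v i) \<le> C * D * suminf \<beta> * \<theta> i"
proof -
  have le: "norm (A i j * v j) \<le> C * \<theta> i * D * \<beta> j" for j
  proof -
    have "norm (A i j) * norm (v j) \<le> (C * \<theta> i * \<beta> j) * D"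
      using admD[OF A] v adm_pos[OF A] \<theta>_pos[of i] \<beta>_pos[of j] by (intro mult_mono) auto
    then show ?thesis by (simp add: norm_mult mult_ac)
  qed
  then show s: "summable (\<lambda>j. norm (A i j * v j))"
    by (intro summable_comparison_test'[OF summable_mult[OF summable_\<beta>, of "C * \<theta> i * D"]]) simp
  have "norm (app A v i) \<le> (\<Sum>j. norm (A i j * v j))"
    unfolding app_def by (rule summable_norm[OF s])
  also have "\<dots> \<le> (\<Sum>j. C * \<theta> i * D * \<beta> j)"
    by (rule suminf_le[OF le s summable_mult[OF summable_\<beta>]])
  also have "\<dots> = C * D * suminf \<beta> * \<theta> i"
    using suminf_mult[OF summable_\<beta>, of "C * \<theta> i * D"] by (simp add: mult_ac)
  finally show "norm (app A v i) \<le> C * D * suminf \<beta> * \<theta> i" .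
qed

lemma V_bounded: assumes "v \<in> V" obtains D where "0 \<le> D" "\<And>j. norm (v j) \<le> D"
proof -
  obtain C where C: "0 < C" "\<And>i. norm (v i) \<le> C * \<theta> i" using VE[OF assms] by blast
  have "norm (v i) \<le> C * T" for i
    using C(2)[of i] mult_left_mono[OF \<theta>_le_T[of i], of C] C(1) by linarith
  then show thesis using C(1) T_pos by (intro that[of "C * T"]) auto
qed

lemma app_sums:
  assumes "adm C A" "v \<in> V"
  shows "(\<lambda>j. A i j * v j) sums app A v i"
proof -
  obtain D where "0 \<le> D" "\<And>j. norm (v j) \<le> D" using V_bounded[OF assms(2)] by blast
  then have "summable (\<lambda>j. norm (A i j * v j))"
    using app_summable(1)[OF assms(1), of v D] by blast
  from summable_norm_cancel[OF this] show ?thesis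
    unfolding app_def by (rule summable_sums)
qed

lemma app_V: assumes "adm C A" "v \<in> V" shows "app A v \<in> V"
proof -
  obtain D where "0 \<le> D" "\<And>j. norm (v j) \<le> D" using V_bounded[OF assms(2)] by blast
  then have "\<And>i. norm (app A v i) \<le> C * D * suminf \<beta> * \<theta> i"
    using app_summable(2)[OF assms(1), of v D] by blast
  then show ?thesis by (auto simp: V_def)
qed

lemma app_lincomb:
  assumes "adm C A" "v \<in> V" "w \<in> V"
  shows "app A (\<lambda>i. c * v i + w i) i = c * app A v i + app A w i"
proof -
  have "(\<lambda>j. c * (A i j * v j) + A i j * w j) sums (c * app A v i + app A w i)"
    by (intro sums_add sums_mult app_sums[OF assms(1)] assms)
  then show ?thesis
    unfolding app_def[of A "\<lambda>i. c * v i + w i"] by (intro sums_unique[symmetric]) (simp add: algebra_simps)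
qed

definition shift :: "(nat \<Rightarrow> nat \<Rightarrow> complex) \<Rightarrow> complex \<Rightarrow> (nat \<Rightarrow> complex) \<Rightarrow> nat \<Rightarrow> complex" where
  "shift A \<mu> v = (\<lambda>i. app A v i - \<mu> * v i)"

lemma shift_V: "adm C A \<Longrightarrow> v \<in> V \<Longrightarrow> shift A \<mu> v \<in> V"
  using V_lincomb[of v "app A v" "- \<mu>"] app_V by (simp add: shift_def)

lemma shift_pow_V: "adm C A \<Longrightarrow> v \<in> V \<Longrightarrow> (shift A \<mu> ^^ k) v \<in> V"
  by (induction k) (auto intro: shift_V)

lemma shift_lincomb:
  "adm C A \<Longrightarrow> v \<in> V \<Longrightarrow> w \<in> V \<Longrightarrow> shift A \<mu> (\<lambda>i. c * v i + w i) = (\<lambda>i. c * shift A \<mu> v i + shift A \<mu> w i)"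
  unfolding shift_def by (rule ext, subst app_lincomb, assumption+) (simp add: algebra_simps)

lemma shift_pow_lincomb:
  assumes A: "adm C A" and "v \<in> V" "w \<in> V"
  shows "(shift A \<mu> ^^ k) (\<lambda>i. c * v i + w i) = (\<lambda>i. c * (shift A \<mu> ^^ k) v i + (shift A \<mu> ^^ k) w i)"
proof (induction k)
  case (Suc k)
  then show ?case
    using shift_lincomb[OF A shift_pow_V[OF A assms(2)] shift_pow_V[OF A assms(3)]] by simp
qed simp

lemma shift_0: "shift A \<mu> (\<lambda>i. 0) = (\<lambda>i. 0)"
  by (simp add: shift_def app_def)

lemma shift_pow_0: "(shift A \<mu> ^^ k) (\<lambda>i. 0) = (\<lambda>i. 0)"
  by (induction k) (auto simp: shift_0)

definition geig :: "(nat \<Rightarrow> nat \<Rightarrow> complex) \<Rightarrow> complex \<Rightarrow> (nat \<Rightarrow> complex) set" where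
  "geig A \<mu> = {v \<in> V. \<exists>k. (shift A \<mu> ^^ k) v = (\<lambda>i. 0)}"

lemma geig_lincomb:
  assumes A: "adm C A" and "v \<in> geig A \<mu>" "w \<in> geig A \<mu>"
  shows "(\<lambda>i. c * v i + w i) \<in> geig A \<mu>"
proof -
  obtain k l where k: "(shift A \<mu> ^^ k) v = (\<lambda>i. 0)" and l: "(shift A \<mu> ^^ l) w = (\<lambda>i. 0)"
    and V: "v \<in> V" "w \<in> V"
    using assms(2,3) by (auto simp: geig_def)
  have "(shift A \<mu> ^^ (l + k)) v = (\<lambda>i. 0)" "(shift A \<mu> ^^ (k + l)) w = (\<lambda>i. 0)"
    by (simp_all add: funpow_add k l shift_pow_0)
  then have "(shift A \<mu> ^^ (k + l)) (\<lambda>i. c * v i + w i) = (\<lambda>i. 0)"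
    using shift_pow_lincomb[OF A V] by (simp add: add.commute)
  then show ?thesis using V_lincomb[OF V] by (auto simp: geig_def)
qed

text \<open>A zero of the determinant is a limit of zeros of the finite sections (Hurwitz); the
  corresponding null vectors, normalised in \<open>\<ell>\<^sup>1(\<beta>)\<close>, are dominated by \<open>\<theta>\<close>, so that
  a coordinatewise limit along a subsequence is a nonzero null vector.\<close>

lemma fredholm_zero_approx:
  assumes A: "adm C A" and z: "fredholm A z0 = 0" and "0 < e"
  shows "\<exists>n\<ge>k. \<exists>z. dist z z0 < e \<and> sdet A n z = 0"
proof (rule ccontr)
  assume neg: "\<not> ?thesis"
  have "fredholm A z0 \<noteq> 0"
  proof (rule Hurwitz_no_zeros[of "ball z0 e" "\<lambda>n. sdet A (n + k)" "fredholm A"])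
    show "fredholm A holomorphic_on ball z0 e"
      using fredholm_entire[OF A] by (rule holomorphic_on_subset) auto
    show "uniform_limit K (\<lambda>n. sdet A (n + k)) (fredholm A) sequentially" if "compact K" "K \<subseteq> ball z0 e" for K
      using filterlim_compose[OF sdet_uniform_limit[OF A compact_imp_bounded[OF that(1)]] filterlim_add_const_nat_at_top]
      by simp
    \<comment> \<open>Hurwitz's theorem needs a nonconstant limit. A constant one would be zero on
      the ball, hence everywhere by continuation, against the value 1 at the origin.\<close>
    show "\<not> fredholm A constant_on ball z0 e"
    proof
      assume "fredholm A constant_on ball z0 e"
      then have c: "fredholm A w = 0" if "w \<in> ball z0 e" for w
        using z that \<open>0 < e\<close> unfolding constant_on_def by (metis centre_in_ball)
      have "fredholm A 0 = 0"
        by (rule analytic_continuation_open[of "ball z0 e" UNIV "fredholm A" "\<lambda>_. 0" 0])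
          (use \<open>0 < e\<close> c fredholm_entire[OF A] in auto)
      then show False using fredholm_0[OF A] by simp
    qed
    show "sdet A (n + k) w \<noteq> 0" if "w \<in> ball z0 e" for n w
      using neg that by (auto simp: dist_commute)
  qed (use \<open>0 < e\<close> in \<open>auto intro: sdet_holomorphic\<close>)
  then show False using z by simp
qed

lemma fredholm_zero_eigenvector:
  assumes A: "adm C A" and z: "fredholm A z0 = 0"
  shows "\<exists>v\<in>V. v \<noteq> (\<lambda>i. 0) \<and> (\<forall>i. v i = z0 * app A v i)"
proof -
  note C = adm_pos[OF A]
  obtain N Z where NZ: "\<And>k. N k \<ge> k" "\<And>k. dist (Z k) z0 < inverse (real (Suc k))" "\<And>k. sdet A (N k) (Z k) = 0"
  proof -
    have "\<exists>n z. n \<ge> k \<and> dist z z0 < inverse (real (Suc k)) \<and> sdet A n z = 0" for k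
      using fredholm_zero_approx[OF A z, of "inverse (real (Suc k))" k] by auto
    then show thesis using that by metis
  qed
  have "\<exists>v. (\<exists>i<N k. v i \<noteq> 0) \<and> (\<forall>i\<ge>N k. v i = 0) \<and> (\<forall>i<N k. v i = Z k * (\<Sum>j<N k. A i j * v j))" for k
  proof -
    obtain v where v: "\<exists>i<N k. v i \<noteq> 0" "\<forall>i\<ge>N k. v i = 0"
      "\<forall>i<N k. (\<Sum>j<N k. ((if i = j then 1 else 0) - Z k * A i j) * v j) = 0"
      using fdet_null_vector[OF NZ(3)[of k, unfolded sdet_def]] by blast
    have "v i = Z k * (\<Sum>j<N k. A i j * v j)" if "i < N k" for i
    proof -
      have "0 = (\<Sum>j<N k. ((if i = j then 1 else 0) - Z k * A i j) * v j)" using v(3) that by simp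
      also have "\<dots> = (\<Sum>j<N k. (if i = j then v j else 0)) - Z k * (\<Sum>j<N k. A i j * v j)"
        by (rule sum_delta_minus)
      finally show ?thesis using that by simp
    qed
    with v show ?thesis by blast
  qed
  then obtain u where u: "\<And>k. \<exists>i<N k. u k i \<noteq> 0" "\<And>k i. i \<ge> N k \<Longrightarrow> u k i = 0"
    "\<And>k i. i < N k \<Longrightarrow> u k i = Z k * (\<Sum>j<N k. A i j * u k j)"
    by metis
  \<comment> \<open>With this normalisation the null vector equation itself bounds coordinate
    \<open>i\<close> by \<open>M * \<theta> i\<close>, uniformly in \<open>k\<close>. By dominated
    convergence the weighted sum stays equal to 1 in the limit, which keeps the limit from
    vanishing.\<close>
  define s where "s = (\<lambda>k. \<Sum>j<N k. \<beta> j * norm (u k j))"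
  have s: "0 < s k" for k
  proof -
    obtain i where i: "i < N k" "u k i \<noteq> 0" using u(1) by blast
    then have "0 < \<beta> i * norm (u k i)" using \<beta>_pos by simp
    also have "\<dots> \<le> s k"
      unfolding s_def using i \<beta>_pos by (intro member_le_sum) (auto simp: less_imp_le)
    finally show ?thesis .
  qed
  define v where "v = (\<lambda>k i. u k i / of_real (s k))"
  have v0: "v k i = 0" if "i \<ge> N k" for k i using u(2)[OF that] by (simp add: v_def)
  have v_eq: "v k i = Z k * (\<Sum>j<N k. A i j * v k j)" if "i < N k" for k i
    using u(3)[OF that] by (simp add: v_def sum_divide_distrib[symmetric])
  have v_norm: "(\<Sum>j<N k. \<beta> j * norm (v k j)) = 1" for k
  proof -
    have "(\<Sum>j<N k. \<beta> j * norm (v k j)) = (\<Sum>j<N k. \<beta> j * norm (u k j)) / s k"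
      using s[of k] by (simp add: v_def norm_divide sum_divide_distrib)
    then show ?thesis using s[of k] by (simp add: s_def)
  qed
  define M where "M = (norm z0 + 1) * C"
  have M: "0 < M" using C by (auto simp: M_def intro!: mult_pos_pos add_nonneg_pos)
  have Zb: "norm (Z k) \<le> norm z0 + 1" for k
  proof -
    have "inverse (real (Suc k)) \<le> 1" by (simp add: inverse_le_1_iff)
    then show ?thesis
      using NZ(2)[of k] norm_triangle_ineq2[of "Z k" z0] by (simp add: dist_norm)
  qed
  have v_le: "norm (v k i) \<le> M * \<theta> i" for k i
  proof (cases "i < N k")
    case True
    have "norm (\<Sum>j<N k. A i j * v k j) \<le> (\<Sum>j<N k. C * \<theta> i * (\<beta> j * norm (v k j)))"
    proof (rule sum_norm_le)
      fix j
      show "norm (A i j * v k j) \<le> C * \<theta> i * (\<beta> j * norm (v k j))"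
        using mult_right_mono[OF admD[OF A, of i j], of "norm (v k j)"] by (simp add: norm_mult mult_ac)
    qed
    also have "\<dots> = C * \<theta> i" by (simp only: sum_distrib_left[symmetric] v_norm mult_1_right)
    finally have "norm (v k i) \<le> norm (Z k) * (C * \<theta> i)"
      unfolding v_eq[OF True] norm_mult by (rule mult_left_mono) simp
    also have "\<dots> \<le> M * \<theta> i"
      unfolding M_def mult.assoc using Zb C \<theta>_pos[of i] by (intro mult_right_mono) auto
    finally show ?thesis .
  next
    case False
    then show ?thesis using v0 M \<theta>_pos[of i] by simp
  qed
  have "norm (v k i) \<le> M * T" for k i
    using v_le[of k i] mult_left_mono[OF \<theta>_le_T[of i], of M] M by linarith
  then obtain \<phi> where \<phi>: "strict_mono \<phi>" "\<And>i. \<exists>l. (\<lambda>k. v (\<phi> k) i) \<longlonglongrightarrow> l"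
    using function_convergent_subsequence[of UNIV v "M * T"] by (metis UNIV_I countableI_type)
  then obtain w where w: "\<And>i. (\<lambda>k. v (\<phi> k) i) \<longlonglongrightarrow> w i" by metis
  have w_le: "norm (w i) \<le> M * \<theta> i" for i
    using tendsto_norm[OF w[of i]] by (rule tendsto_upperbound) (auto simp: v_le)
  have wV: "w \<in> V" using w_le by (auto simp: V_def)
  have summ: "summable (\<lambda>j. M * T * \<beta> j)" by (intro summable_mult summable_\<beta>)
  have "(\<lambda>k. \<Sum>j. \<beta> j * norm (v (\<phi> k) j)) \<longlonglongrightarrow> (\<Sum>j. \<beta> j * norm (w j))"
  proof (rule conjunct2[OF conjunct2[OF tannerys_theorem[OF _ _ summ]]])
    show "(\<lambda>k. \<beta> j * norm (v (\<phi> k) j)) \<longlonglongrightarrow> \<beta> j * norm (w j)" for j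
      by (intro tendsto_intros w)
    show "\<forall>\<^sub>F (j, k) in sequentially \<times>\<^sub>F sequentially. norm (\<beta> j * norm (v (\<phi> k) j)) \<le> M * T * \<beta> j"
    proof (intro always_eventually allI, clarify)
      fix j k
      have "norm (v (\<phi> k) j) \<le> M * T" by fact
      then show "norm (\<beta> j * norm (v (\<phi> k) j)) \<le> M * T * \<beta> j"
        using mult_left_mono[of _ _ "\<beta> j"] \<beta>_pos[of j] by (simp add: mult_ac)
    qed
  qed simp
  moreover have "(\<Sum>j. \<beta> j * norm (v k j)) = 1" for k
    using suminf_finite[of "{..<N k}" "\<lambda>j. \<beta> j * norm (v k j)"] v0 v_norm by (simp add: not_less)
  ultimately have "(\<Sum>j. \<beta> j * norm (w j)) = 1" by (simp add: LIMSEQ_const_iff)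
  then have w_nz: "w \<noteq> (\<lambda>i. 0)" by auto
  have Zlim: "Z \<longlonglongrightarrow> z0"
  proof (rule metric_tendsto_imp_tendsto[OF LIMSEQ_inverse_real_of_nat])
    show "\<forall>\<^sub>F k in sequentially. dist (Z k) z0 \<le> dist (inverse (real (Suc k))) 0"
      using NZ(2) by (intro always_eventually) (auto simp: less_imp_le)
  qed
  have "w i = z0 * app A w i" for i
  proof -
    have "(\<lambda>k. \<Sum>j. A i j * v (\<phi> k) j) \<longlonglongrightarrow> (\<Sum>j. A i j * w j)"
    proof (rule conjunct2[OF conjunct2[OF tannerys_theorem[of _ _ _ "\<lambda>j. C * \<theta> i * (M * T) * \<beta> j"]]])
      show "(\<lambda>k. A i j * v (\<phi> k) j) \<longlonglongrightarrow> A i j * w j" for j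
        by (intro tendsto_intros w)
      show "\<forall>\<^sub>F (j, k) in sequentially \<times>\<^sub>F sequentially. norm (A i j * v (\<phi> k) j) \<le> C * \<theta> i * (M * T) * \<beta> j"
      proof (intro always_eventually allI, clarify)
        fix j k
        have "norm (v (\<phi> k) j) \<le> M * T" by fact
        then have "norm (A i j) * norm (v (\<phi> k) j) \<le> (C * \<theta> i * \<beta> j) * (M * T)"
          using admD[OF A] C \<theta>_pos[of i] \<beta>_pos[of j] by (intro mult_mono) auto
        then show "norm (A i j * v (\<phi> k) j) \<le> C * \<theta> i * (M * T) * \<beta> j"
          by (simp add: norm_mult mult_ac)
      qed
    qed (auto intro!: summable_mult summable_\<beta>)
    then have "(\<lambda>k. Z (\<phi> k) * (\<Sum>j. A i j * v (\<phi> k) j)) \<longlonglongrightarrow> z0 * app A w i"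
      unfolding app_def using LIMSEQ_subseq_LIMSEQ[OF Zlim \<phi>(1)] by (intro tendsto_mult) (auto simp: o_def)
    \<comment> \<open>A finite section says nothing about coordinates beyond its size, so the
      equation for coordinate \<open>i\<close> holds only from some index on.\<close>
    moreover have "\<forall>\<^sub>F k in sequentially. Z (\<phi> k) * (\<Sum>j. A i j * v (\<phi> k) j) = v (\<phi> k) i"
      using eventually_gt_at_top[of i]
    proof eventually_elim
      case (elim k)
      have "k \<le> \<phi> k" using \<phi>(1) by (rule seq_suble)
      then have "i < N (\<phi> k)" using NZ(1)[of "\<phi> k"] elim by linarith
      moreover have "(\<Sum>j. A i j * v (\<phi> k) j) = (\<Sum>j<N (\<phi> k). A i j * v (\<phi> k) j)"
        using v0 by (intro suminf_finite) (auto simp: not_less)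
      ultimately show ?case by (metis v_eq)
    qed
    ultimately have "(\<lambda>k. v (\<phi> k) i) \<longlonglongrightarrow> z0 * app A w i"
      by (simp add: Lim_transform_eventually)
    then show ?thesis using w LIMSEQ_unique by blast
  qed
  then show ?thesis using wV w_nz by blast
qed

text \<open>The composition of \<open>A\<close> with the projection along \<open>v\<close> onto the
  sequences vanishing at \<open>p\<close>. Row \<open>p\<close> of the result is zero.\<close>

definition deflate :: "(nat \<Rightarrow> complex) \<Rightarrow> nat \<Rightarrow> (nat \<Rightarrow> nat \<Rightarrow> complex) \<Rightarrow> nat \<Rightarrow> nat \<Rightarrow> complex" where
  "deflate v p A i j = A i j - v i / v p * A p j"

lemma adm_deflate:
  assumes A: "adm C A" and "v \<in> V"
  shows "\<exists>C'. adm C' (deflate v p A)"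
proof -
  obtain D where D: "0 < D" "\<And>i. norm (v i) \<le> D * \<theta> i" using VE[OF assms(2)] by blast
  note C = adm_pos[OF A]
  have "norm (deflate v p A i j) \<le> (C + D * inverse (norm (v p)) * (C * \<theta> p)) * \<theta> i * \<beta> j" for i j
  proof -
    have "norm (v i / v p * A p j) \<le> (D * \<theta> i) * inverse (norm (v p)) * (C * \<theta> p * \<beta> j)"
      unfolding norm_mult divide_inverse norm_inverse
      using D admD[OF A, of p j] C \<theta>_pos[of i] by (intro mult_mono) auto
    then show ?thesis
      using norm_triangle_ineq4[of "A i j" "v i / v p * A p j"] admD[OF A, of i j]
      by (simp add: deflate_def algebra_simps)
  qed
  moreover have "0 < C + D * inverse (norm (v p)) * (C * \<theta> p)"
    using C D(1) \<theta>_pos[of p] by (intro add_pos_nonneg mult_nonneg_nonneg) auto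
  ultimately show ?thesis by (auto simp: adm_def)
qed

text \<open>Replacing column \<open>p\<close> of \<open>1 - z A\<close> by \<open>(1 - z A) v\<close> multiplies the finite sections by
  \<open>v p\<close>; up to the truncation error \<open>r\<close> the new column is \<open>(1 - z \<mu>) v\<close>.\<close>

lemma fredholm_deflate:
  assumes A: "adm C A" and v: "v \<in> V" "v p \<noteq> 0" and eig: "\<And>i. app A v i = \<mu> * v i"
  shows "fredholm A z = (1 - z * \<mu>) * fredholm (deflate v p A) z"
proof -
  obtain D where D: "0 < D" "\<And>i. norm (v i) \<le> D * \<theta> i" using VE[OF v(1)] by blast
  note C = adm_pos[OF A]
  obtain C' where A': "adm C' (deflate v p A)" using adm_deflate[OF A v(1)] by blast
  define X where "X = (\<lambda>n x. fdet n (\<lambda>i j. if j = p then x i else (if i = j then 1 else 0) - z * A i j))"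
  define r where "r = (\<lambda>n i. \<mu> * v i - (\<Sum>j<n. A i j * v j))"
  have X_lin: "X n (\<lambda>i. c * x i + d * y i) = c * X n x + d * X n y" if "p < n" for n c x d y
  proof -
    have "X n (\<lambda>i. 0 + c * x i) = X n (\<lambda>i. 0) + c * X n x"
      unfolding X_def by (rule fdet_col_linear[OF that])
    moreover have "X n (\<lambda>i. 0) = 0" unfolding X_def by (rule fdet_zero_col[OF that]) simp
    moreover have "X n (\<lambda>i. c * x i + d * y i) = X n (\<lambda>i. c * x i) + d * X n y"
      unfolding X_def by (rule fdet_col_linear[OF that])
    ultimately show ?thesis by simp
  qed
  have 1: "v p * sdet A n z = (1 - z * \<mu>) * X n v + z * X n (r n)" if "p < n" for n
  proof -
    have "v p * sdet A n z = X n (\<lambda>i. \<Sum>k<n. ((if i = k then 1 else 0) - z * A i k) * v k)"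
      unfolding sdet_def X_def by (rule fdet_replace_col[OF that, symmetric])
    also have "\<dots> = X n (\<lambda>i. (1 - z * \<mu>) * v i + z * r n i)"
      unfolding X_def
    proof (rule fdet_cong)
      fix i j assume "i < n" "j < n"
      have "(\<Sum>k<n. ((if i = k then 1 else 0) - z * A i k) * v k) = (\<Sum>k<n. if i = k then v k else 0) - z * (\<Sum>k<n. A i k * v k)"
        by (rule sum_delta_minus)
      also have "\<dots> = (1 - z * \<mu>) * v i + z * r n i"
        using \<open>i < n\<close> by (simp add: r_def algebra_simps)
      finally show "(if j = p then \<Sum>k<n. ((if i = k then 1 else 0) - z * A i k) * v k
          else (if i = j then 1 else 0) - z * A i j) =
        (if j = p then (1 - z * \<mu>) * v i + z * r n i else (if i = j then 1 else 0) - z * A i j)" by simp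
    qed
    also have "\<dots> = (1 - z * \<mu>) * X n v + z * X n (r n)" by (rule X_lin[OF that])
    finally show ?thesis .
  qed
  have 2: "X n v = v p * sdet (deflate v p A) n z" if p: "p < n" for n
  proof -
    \<comment> \<open>Row reduction in the form of a product. \<open>H\<close> is the identity with
      column \<open>p\<close> replaced by \<open>v / v p\<close> and has determinant 1; factoring it
      out leaves \<open>W\<close>, whose column \<open>p\<close> is concentrated on the diagonal.
      Off row and column \<open>p\<close>, \<open>W\<close> agrees with the section of the deflated
      matrix, whose row \<open>p\<close> is that of the identity, so \<open>fdet_cofactor\<close>
      compares the two.\<close>
    define W where "W = (\<lambda>i j. if j = p then if i = p then v p else 0
      else if i = p then - z * A p j else (if i = j then 1 else 0) - z * deflate v p A i j)"
    define H where "H = (\<lambda>i j. if j = p then v i / v p else if i = j then 1 else 0 :: complex)"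
    have "fdet n H = fdet n (\<lambda>i j. if j = p then \<Sum>k<n. (if i = k then 1 else 0) * (v k / v p) else if i = j then 1 else 0)"
      by (rule fdet_cong) (auto simp: H_def if_distrib[of "\<lambda>c. c * _"] sum_divide_distrib[symmetric] cong: if_cong)
    also have "\<dots> = v p / v p * fdet n (\<lambda>i j. if i = j then 1 else 0)"
      by (rule fdet_replace_col[OF p])
    also have "fdet n (\<lambda>i j. if i = j then 1 else 0) = 1"
    proof -
      have "mat n n (\<lambda>(i, j). if i = j then 1 else 0) = (1\<^sub>m n :: complex mat)" by (rule eq_matI) auto
      then show ?thesis unfolding fdet_def by simp
    qed
    finally have H: "fdet n H = 1" using v(2) by simp
    have "X n v = fdet n (\<lambda>i j. \<Sum>k<n. H i k * W k j)"
      unfolding X_def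
    proof (rule fdet_cong)
      fix i j assume ij: "i < n" "j < n"
      have "(\<Sum>k<n. H i k * W k j) = H i p * W p j + (\<Sum>k\<in>{..<n} - {p}. H i k * W k j)"
        using p by (simp add: sum.remove)
      also have "(\<Sum>k\<in>{..<n} - {p}. H i k * W k j) = (\<Sum>k\<in>{..<n} - {p}. if i = k then W k j else 0)"
        by (intro sum.cong) (auto simp: H_def)
      also have "\<dots> = (if i = p then 0 else W i j)"
        using ij by (auto simp: sum.delta)
      also have "H i p * W p j + (if i = p then 0 else W i j) = (if j = p then v i else (if i = j then 1 else 0) - z * A i j)"
        using v(2) by (auto simp: H_def W_def deflate_def field_simps)
      finally show "(if j = p then v i else (if i = j then 1 else 0) - z * A i j) = (\<Sum>k<n. H i k * W k j)" ..
    qed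
    also have "\<dots> = fdet n W" by (simp add: fdet_mult H)
    finally have XW: "X n v = fdet n W" .
    have "fdet n W * ((if p = p then 1 else 0) - z * deflate v p A p p) = sdet (deflate v p A) n z * W p p"
      unfolding sdet_def
      by (rule fdet_cofactor[OF p]) (use v(2) in \<open>auto simp: W_def deflate_def\<close>)
    then show ?thesis using v(2) by (simp add: XW W_def deflate_def)
  qed
  \<comment> \<open>The remainder column is the tail of a convergent series and has length at most a
    multiple of \<open>tail n\<close>. By Hadamard this one small column suffices, as the others
    contribute at most \<open>expB C z\<close>.\<close>
  have 3: "(\<lambda>n. X n (r n)) \<longlonglongrightarrow> 0"
  proof (rule Lim_null_comparison)
    have "norm (X n (r n)) \<le> C * (D * T) * T * expB C z * tail n" if p: "p < n" for n
    proof -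
      have r_le: "norm (r n i) \<le> C * (D * T) * tail n * \<theta> i" for i
      proof -
        have s: "(\<lambda>j. A i j * v j) sums (\<mu> * v i)" using app_sums[OF A v(1), of i] eig by simp
        then have sm: "summable (\<lambda>j. A i j * v j)" by (rule sums_summable)
        have "r n i = (\<Sum>j. A i (j + n) * v (j + n))"
          using suminf_minus_initial_segment[OF sm, of n] sums_unique[OF s] by (simp add: r_def)
        also have "norm \<dots> \<le> (\<Sum>j. C * \<theta> i * (D * T) * \<beta> (j + n))"
        proof (rule norm_suminf_le)
          show "summable (\<lambda>j. C * \<theta> i * (D * T) * \<beta> (j + n))"
            by (intro summable_mult summable_ignore_initial_segment summable_\<beta>)
          fix j
          have "norm (v (j + n)) \<le> D * T"
            using D(2)[of "j + n"] mult_left_mono[OF \<theta>_le_T[of "j + n"], of D] D(1) by linarith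
          then have "norm (A i (j + n)) * norm (v (j + n)) \<le> (C * \<theta> i * \<beta> (j + n)) * (D * T)"
            using admD[OF A] C \<theta>_pos[of i] \<beta>_pos[of "j + n"] by (intro mult_mono) auto
          then show "norm (A i (j + n) * v (j + n)) \<le> C * \<theta> i * (D * T) * \<beta> (j + n)"
            by (simp add: norm_mult mult_ac)
        qed
        also have "\<dots> = C * \<theta> i * (D * T) * tail n"
          unfolding tail_def by (intro suminf_mult summable_ignore_initial_segment summable_\<beta>)
        finally show ?thesis by (simp add: mult_ac)
      qed
      have tail_nonneg: "0 \<le> tail n" using sum_le_tail[of n n] by simp
      have "norm (X n (r n)) \<le> (\<Prod>j<n. colnorm n (\<lambda>i. if j = p then r n i else (if i = j then 1 else 0) - z * A i j))"
        unfolding X_def by (rule hadamard)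
      also have "\<dots> = colnorm n (r n) * (\<Prod>j\<in>{..<n} - {p}. colnorm n (\<lambda>i. (if i = j then 1 else 0) - z * A i j))"
        using p by (subst prod.remove[of _ p]) (auto intro!: prod.cong)
      also have "\<dots> \<le> (C * (D * T) * tail n * T) * (\<Prod>j\<in>{..<n} - {p}. exp (norm z * C * T * \<beta> j))"
      proof (intro mult_mono prod_mono conjI)
        show "colnorm n (r n) \<le> C * (D * T) * tail n * T"
          using r_le C D(1) T_pos tail_nonneg by (intro colnorm_le) auto
        fix j assume "j \<in> {..<n} - {p}"
        then show "colnorm n (\<lambda>i. (if i = j then 1 else 0) - z * A i j) \<le> exp (norm z * C * T * \<beta> j)"
          by (intro order.trans[OF colnorm_sdet[OF A] exp_ge_add_one_self]) auto
      qed (use C D(1) T_pos tail_nonneg in \<open>auto intro!: prod_nonneg\<close>)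
      also have "\<dots> \<le> (C * (D * T) * tail n * T) * expB C z"
      proof (rule mult_left_mono)
        have "(\<Prod>j\<in>{..<n} - {p}. exp (norm z * C * T * \<beta> j)) \<le> exp (\<Sum>j<n. norm z * C * T * \<beta> j)"
          unfolding exp_sum[OF finite_Diff[OF finite_lessThan], symmetric]
          using C T_pos \<beta>_pos by (intro exp_mono sum_mono2) (auto simp: less_imp_le)
        also have "\<dots> \<le> expB C z" by (rule sum_\<beta>_le[OF C])
        finally show "(\<Prod>j\<in>{..<n} - {p}. exp (norm z * C * T * \<beta> j)) \<le> expB C z" .
      qed (use C D(1) T_pos tail_nonneg in auto)
      finally show ?thesis by (simp add: mult_ac)
    qed
    then show "\<forall>\<^sub>F n in sequentially. norm (X n (r n)) \<le> C * (D * T) * T * expB C z * tail n"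
      by (intro eventually_mono[OF eventually_gt_at_top[of p]])
    show "(\<lambda>n. C * (D * T) * T * expB C z * tail n) \<longlonglongrightarrow> 0"
      by (rule tendsto_mult_right_zero[OF tail_tendsto])
  qed
  have "(\<lambda>n. (1 - z * \<mu>) * (v p * sdet (deflate v p A) n z) + z * X n (r n))
      \<longlonglongrightarrow> (1 - z * \<mu>) * (v p * fredholm (deflate v p A) z) + z * 0"
    by (intro tendsto_intros sdet_tendsto[OF A'] 3)
  moreover have "\<forall>\<^sub>F n in sequentially. (1 - z * \<mu>) * (v p * sdet (deflate v p A) n z) + z * X n (r n) = v p * sdet A n z"
    using eventually_gt_at_top[of p] by eventually_elim (simp add: 1 2)
  ultimately have "(\<lambda>n. v p * sdet A n z) \<longlonglongrightarrow> (1 - z * \<mu>) * (v p * fredholm (deflate v p A) z)"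
    by (simp add: Lim_transform_eventually)
  moreover have "(\<lambda>n. v p * sdet A n z) \<longlonglongrightarrow> v p * fredholm A z"
    by (intro tendsto_intros sdet_tendsto[OF A])
  ultimately have "v p * fredholm A z = (1 - z * \<mu>) * (v p * fredholm (deflate v p A) z)"
    using LIMSEQ_unique by blast
  then show ?thesis using v(2) by simp
qed

lemma geig_subspace: "adm C A \<Longrightarrow> fv.subspace (geig A \<mu>)"
proof (rule fv.subspaceI)
  assume A: "adm C A"
  show 0: "0 \<in> geig A \<mu>"
    using V_0 by (auto simp: geig_def zero_fun_def intro!: exI[of _ 0])
  fix x y assume x: "x \<in> geig A \<mu>"
  show "(\<lambda>i. c * x i) \<in> geig A \<mu>" for c
    using geig_lincomb[OF A x 0, of c] by (simp add: zero_fun_def)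
  assume "y \<in> geig A \<mu>"
  then show "x + y \<in> geig A \<mu>"
    using geig_lincomb[OF A x, of y 1] by (simp add: plus_fun_def)
qed

lemma app_deflate:
  assumes A: "adm C A" and "w \<in> V"
  shows "app (deflate v p A) w i = app A w i - v i / v p * app A w p"
proof -
  have "(\<lambda>j. A i j * w j - v i / v p * (A p j * w j)) sums (app A w i - v i / v p * app A w p)"
    by (intro sums_diff sums_mult app_sums[OF A] assms)
  then show ?thesis
    unfolding app_def[of "deflate v p A"] by (intro sums_unique[symmetric]) (simp add: deflate_def algebra_simps)
qed

text \<open>The same projection as in \<open>deflate\<close>, now acting on sequences.\<close>

definition proj :: "(nat \<Rightarrow> complex) \<Rightarrow> nat \<Rightarrow> (nat \<Rightarrow> complex) \<Rightarrow> nat \<Rightarrow> complex" where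
  "proj v p w = (\<lambda>i. w i - w p / v p * v i)"

lemma proj_V: "v \<in> V \<Longrightarrow> w \<in> V \<Longrightarrow> proj v p w \<in> V"
  using V_lincomb[of v w "- (w p / v p)"] by (simp add: proj_def)

context
  fixes C C' A v p \<mu>
  assumes A: "adm C A" and A': "adm C' (deflate v p A)"
    and v: "v \<in> V" "v p \<noteq> 0" and eig: "\<And>i. app A v i = \<mu> * v i" and \<mu>: "\<mu> \<noteq> 0"
begin

text \<open>The deflated matrix is the projection after \<open>A\<close>, and it annihilates
  \<open>v\<close> because \<open>A\<close> maps \<open>v\<close> into its own line. So projecting
  before applying it makes no difference.\<close>

lemma shift_proj:
  assumes w: "w \<in> V"
  shows "shift (deflate v p A) \<mu> (proj v p w) = proj v p (shift A \<mu> w)"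
proof
  fix i
  have "app (deflate v p A) v i = 0" for i
    using v(2) by (simp add: app_deflate[OF A v(1)] eig)
  moreover have "app (deflate v p A) (\<lambda>i. - (w p / v p) * v i + w i) i
    = - (w p / v p) * app (deflate v p A) v i + app (deflate v p A) w i"
    by (rule app_lincomb[OF A' v(1) w])
  ultimately have "app (deflate v p A) (proj v p w) i = app A w i - v i / v p * app A w p"
    using app_deflate[OF A w, of v p i] by (simp add: proj_def)
  then show "shift (deflate v p A) \<mu> (proj v p w) i = proj v p (shift A \<mu> w) i"
    using v(2) by (simp add: shift_def proj_def field_simps)
qed

lemma shift_pow_proj:
  "w \<in> V \<Longrightarrow> (shift (deflate v p A) \<mu> ^^ k) (proj v p w) = proj v p ((shift A \<mu> ^^ k) w)"
proof (induction k)
  case (Suc k)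
  then show ?case using shift_proj[OF shift_pow_V[OF A Suc.prems]] by simp
qed simp

text \<open>Row \<open>p\<close> of the deflated matrix is zero, so each shift multiplies coordinate
  \<open>p\<close> by - \<mu>, which is nonzero.\<close>

lemma geig_deflate_p:
  assumes "w \<in> geig (deflate v p A) \<mu>"
  shows "w p = 0"
proof -
  obtain k where w: "w \<in> V" "(shift (deflate v p A) \<mu> ^^ k) w = (\<lambda>i. 0)"
    using assms by (auto simp: geig_def)
  have "deflate v p A p j = 0" for j using v(2) by (simp add: deflate_def)
  then have app_p: "app (deflate v p A) u p = 0" for u by (simp add: app_def)
  have "(shift (deflate v p A) \<mu> ^^ k) w p = (- \<mu>) ^ k * w p" for k
    by (induction k) (simp_all add: shift_def app_p)
  with w(2) \<mu> show ?thesis by (metis mult_eq_0_iff neg_equal_0_iff_equal power_not_zero)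
qed

text \<open>Once the deflated shift has annihilated \<open>w\<close>, the original shift has sent it
  into the line of \<open>v\<close>, and one more application kills that line.\<close>

lemma geig_deflate_sub: "geig (deflate v p A) \<mu> \<subseteq> geig A \<mu>"
proof
  fix w assume w: "w \<in> geig (deflate v p A) \<mu>"
  then obtain k where wV: "w \<in> V" and k: "(shift (deflate v p A) \<mu> ^^ k) w = (\<lambda>i. 0)"
    by (auto simp: geig_def)
  have "proj v p w = w" using geig_deflate_p[OF w] by (simp add: proj_def)
  then have "proj v p ((shift A \<mu> ^^ k) w) = (\<lambda>i. 0)"
    using shift_pow_proj[OF wV, of k] k by simp
  then obtain c where c: "(shift A \<mu> ^^ k) w = (\<lambda>i. c * v i)"
    unfolding proj_def fun_eq_iff by (metis eq_iff_diff_eq_0)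
  have "(shift A \<mu> ^^ Suc k) w = shift A \<mu> (\<lambda>i. c * v i + 0)"
    using c by simp
  also have "\<dots> = (\<lambda>i. c * shift A \<mu> v i + shift A \<mu> (\<lambda>i. 0) i)"
    by (rule shift_lincomb[OF A v(1) V_0])
  also have "\<dots> = (\<lambda>i. 0)"
    by (simp add: shift_0) (simp add: shift_def eig)
  finally show "w \<in> geig A \<mu>"
    using wV unfolding geig_def by blast
qed

lemma geig_decomp:
  assumes "w \<in> geig A \<mu>"
  shows "proj v p w \<in> geig (deflate v p A) \<mu>"
proof -
  obtain k where w: "w \<in> V" "(shift A \<mu> ^^ k) w = (\<lambda>i. 0)"
    using assms by (auto simp: geig_def)
  then have "(shift (deflate v p A) \<mu> ^^ k) (proj v p w) = (\<lambda>i. 0)"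
    by (simp add: shift_pow_proj) (simp add: proj_def)
  then show ?thesis using proj_V[OF v(1) w(1)] by (auto simp: geig_def)
qed

lemma v_geig: "v \<in> geig A \<mu>"
  using v(1) eig by (auto simp: geig_def shift_def intro!: exI[of _ "Suc 0"])

text \<open>The deflated generalised eigenspace lies in the hyperplane of sequences vanishing at
  \<open>p\<close>, which \<open>v\<close> avoids, and every \<open>w\<close> differs from its
  projection by a multiple of \<open>v\<close>. So deflation costs exactly one dimension.\<close>

lemma basis_extend:
  assumes B: "finite B" "fv.independent B" "fv.span B = geig (deflate v p A) \<mu>"
  shows "v \<notin> B" "fv.independent (insert v B)" "fv.span (insert v B) = geig A \<mu>"
proof -
  have vB: "v \<notin> fv.span B" using geig_deflate_p[of v] v(2) B(3) by auto
  then show "v \<notin> B" using fv.span_base by blast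
  show "fv.independent (insert v B)" using vB B(2) by (rule fv.independent_insertI)
  show "fv.span (insert v B) = geig A \<mu>"
  proof
    show "fv.span (insert v B) \<subseteq> geig A \<mu>"
      using v_geig geig_deflate_sub fv.span_superset[of B] B(3) geig_subspace[OF A]
      by (intro fv.span_minimal) auto
    show "geig A \<mu> \<subseteq> fv.span (insert v B)"
    proof
      fix w assume "w \<in> geig A \<mu>"
      then have "proj v p w \<in> fv.span B" using geig_decomp B(3) by blast
      then have "w - (\<lambda>i. w p / v p * v i) \<in> fv.span B"
        by (simp add: proj_def fun_diff_def)
      then show "w \<in> fv.span (insert v B)" unfolding fv.span_insert by blast
    qed
  qed
qed

end

text \<open>An eigenvector would, by \<open>fredholm_deflate\<close>, put the factor 1 - z \<mu>
  into the determinant. Hence the shift, and with it each of its powers, is injective.\<close>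

lemma geig_trivial:
  assumes A: "adm C A" and \<mu>: "\<mu> \<noteq> 0" and nz: "fredholm A (1 / \<mu>) \<noteq> 0"
  shows "geig A \<mu> = {\<lambda>i. 0}"
proof -
  have inj: "w = (\<lambda>i. 0)" if w: "w \<in> V" "shift A \<mu> w = (\<lambda>i. 0)" for w
  proof (rule ccontr)
    assume "w \<noteq> (\<lambda>i. 0)"
    then obtain p where "w p \<noteq> 0" by auto
    moreover have "app A w i = \<mu> * w i" for i using w(2) by (simp add: shift_def fun_eq_iff)
    ultimately have "fredholm A (1 / \<mu>) = 0"
      using fredholm_deflate[OF A w(1), of p \<mu> "1 / \<mu>"] \<mu> by simp
    with nz show False by simp
  qed
  have "w = (\<lambda>i. 0)" if "w \<in> V" "(shift A \<mu> ^^ k) w = (\<lambda>i. 0)" for w k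
    using that(2)
  proof (induction k)
    case (Suc k)
    then show ?case using inj[OF shift_pow_V[OF A that(1)]] by simp
  qed simp
  then show ?thesis using V_0 by (auto simp: geig_def intro!: exI[of _ 0])
qed

text \<open>Induction on the order \<open>k\<close> of the zero: a zero yields an eigenvector, and
  deflating it removes one linear factor and one dimension together. The factorisation is assumed on
  a punctured ball only, so that it survives cancelling z - 1/\<mu>; the value at the centre is
  recovered by continuity.\<close>

lemma multiplicity_aux:
  assumes "adm C A" "\<mu> \<noteq> 0" "0 < e" "h holomorphic_on ball (1 / \<mu>) e" "h (1 / \<mu>) \<noteq> 0"
    and "\<And>z. z \<in> ball (1 / \<mu>) e \<Longrightarrow> z \<noteq> 1 / \<mu> \<Longrightarrow> fredholm A z = (z - 1 / \<mu>) ^ k * h z"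
  shows "\<exists>B g. finite B \<and> fv.independent B \<and> fv.span B = geig A \<mu> \<and>
    g holomorphic_on UNIV \<and> g (1 / \<mu>) \<noteq> 0 \<and> (\<forall>z. fredholm A z = (1 - z * \<mu>) ^ card B * g z)"
  using assms
proof (induction k arbitrary: C A h)
  case (0 C A h)
  have "fredholm A \<midarrow>1 / \<mu>\<rightarrow> fredholm A (1 / \<mu>)"
    using fredholm_entire[OF 0(1)] by (meson UNIV_I continuous_on_eq_continuous_at holomorphic_on_imp_continuous_on isContD open_UNIV)
  moreover have "h \<midarrow>1 / \<mu>\<rightarrow> h (1 / \<mu>)"
    using 0(3,4) by (meson centre_in_ball continuous_on_eq_continuous_at holomorphic_on_imp_continuous_on isContD open_ball)
  then have "fredholm A \<midarrow>1 / \<mu>\<rightarrow> h (1 / \<mu>)"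
    by (rule Lim_transform_within_open[of _ _ _ _ "ball (1 / \<mu>) e"]) (use 0 in auto)
  ultimately have "fredholm A (1 / \<mu>) \<noteq> 0"
    using 0(5) LIM_unique by metis
  with geig_trivial[OF 0(1,2)] have "geig A \<mu> = {\<lambda>i. 0}" by simp
  then show ?case using \<open>fredholm A (1 / \<mu>) \<noteq> 0\<close> fredholm_entire[OF 0(1)]
    by (intro exI[of _ "{}"] exI[of _ "fredholm A"]) (auto simp: zero_fun_def fv.independent_empty)
next
  case (Suc k C A h)
  note A = Suc.prems(1) and \<mu> = Suc.prems(2)
  have lim: "fredholm A \<midarrow>1 / \<mu>\<rightarrow> fredholm A (1 / \<mu>)"
    using fredholm_entire[OF A] by (meson UNIV_I continuous_on_eq_continuous_at holomorphic_on_imp_continuous_on isContD open_UNIV)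
  have hc: "h \<midarrow>1 / \<mu>\<rightarrow> h (1 / \<mu>)"
    using Suc.prems(3,4) by (meson centre_in_ball continuous_on_eq_continuous_at holomorphic_on_imp_continuous_on isContD open_ball)
  have "(\<lambda>z. (z - 1 / \<mu>) ^ Suc k * h z) \<midarrow>1 / \<mu>\<rightarrow> (1 / \<mu> - 1 / \<mu>) ^ Suc k * h (1 / \<mu>)"
    by (intro tendsto_intros hc)
  then have "(\<lambda>z. (z - 1 / \<mu>) ^ Suc k * h z) \<midarrow>1 / \<mu>\<rightarrow> 0" by simp
  then have "fredholm A \<midarrow>1 / \<mu>\<rightarrow> 0"
  proof (rule Lim_transform_within_open)
    show "1 / \<mu> \<in> ball (1 / \<mu>) e" using Suc.prems(3) by simp
    show "(z - 1 / \<mu>) ^ Suc k * h z = fredholm A z" if "z \<in> ball (1 / \<mu>) e" "z \<noteq> 1 / \<mu>" for z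
      by (rule Suc.prems(6)[OF that, symmetric])
  qed auto
  then have "fredholm A (1 / \<mu>) = 0" using lim LIM_unique by metis
  then obtain v where v: "v \<in> V" "v \<noteq> (\<lambda>i. 0)" "\<And>i. v i = 1 / \<mu> * app A v i"
    using fredholm_zero_eigenvector[OF A] by blast
  have eig: "app A v i = \<mu> * v i" for i using v(3)[of i] \<mu> by (simp add: field_simps)
  obtain p where p: "v p \<noteq> 0" using v(2) by auto
  let ?A' = "deflate v p A"
  obtain C' where A': "adm C' ?A'" using adm_deflate[OF A v(1)] by blast
  note defl = fredholm_deflate[OF A v(1) p eig]
  have "\<exists>B g. finite B \<and> fv.independent B \<and> fv.span B = geig ?A' \<mu> \<and>
    g holomorphic_on UNIV \<and> g (1 / \<mu>) \<noteq> 0 \<and> (\<forall>z. fredholm ?A' z = (1 - z * \<mu>) ^ card B * g z)"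
  proof (rule Suc.IH[OF A' \<mu> Suc.prems(3)])
    \<comment> \<open>The constant - 1/\<mu> converts the factor 1 - z \<mu> into z -
      1/\<mu>.\<close>
    show "(\<lambda>z. - h z / \<mu>) holomorphic_on ball (1 / \<mu>) e"
      using \<mu> by (intro holomorphic_intros Suc.prems) auto
    show "- h (1 / \<mu>) / \<mu> \<noteq> 0" using Suc.prems by simp
    fix z assume z: "z \<in> ball (1 / \<mu>) e" "z \<noteq> 1 / \<mu>"
    then have "(1 - z * \<mu>) * fredholm ?A' z = (z - 1 / \<mu>) ^ Suc k * h z"
      using Suc.prems(6) defl by simp
    moreover have "1 - z * \<mu> = - \<mu> * (z - 1 / \<mu>)" using \<mu> by (simp add: field_simps)
    ultimately have "(z - 1 / \<mu>) * (- \<mu> * fredholm ?A' z) = (z - 1 / \<mu>) * ((z - 1 / \<mu>) ^ k * h z)"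
      by (simp add: mult_ac)
    then have "- \<mu> * fredholm ?A' z = (z - 1 / \<mu>) ^ k * h z"
      using z(2) by (simp only: mult_cancel_left) simp
    then have "fredholm ?A' z = - ((z - 1 / \<mu>) ^ k * h z) / \<mu>"
      using \<mu> by (metis minus_divide_left minus_mult_left minus_minus nonzero_mult_div_cancel_left)
    then show "fredholm ?A' z = (z - 1 / \<mu>) ^ k * (- h z / \<mu>)"
      by simp
  qed
  then obtain B g where B: "finite B" "fv.independent B" "fv.span B = geig ?A' \<mu>"
    and g: "g holomorphic_on UNIV" "g (1 / \<mu>) \<noteq> 0" "\<And>z. fredholm ?A' z = (1 - z * \<mu>) ^ card B * g z"
    by blast
  note ext = basis_extend[OF A A' v(1) p eig \<mu> B]
  have "fredholm A z = (1 - z * \<mu>) ^ card (insert v B) * g z" for z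
    using defl[of z] g(3)[of z] B(1) ext(1) by (simp add: mult_ac)
  then show ?case using ext B(1) g by (intro exI[of _ "insert v B"] exI[of _ g]) auto
qed

text \<open>The value 1 at the origin excludes the zero function, so every zero has a finite order
  from which to start the induction.\<close>

theorem multiplicity:
  assumes A: "adm C A" and \<mu>: "\<mu> \<noteq> 0"
  shows "\<exists>B g. finite B \<and> fv.independent B \<and> fv.span B = geig A \<mu> \<and>
    g holomorphic_on UNIV \<and> g (1 / \<mu>) \<noteq> 0 \<and> (\<forall>z. fredholm A z = (1 - z * \<mu>) ^ card B * g z)"
proof (cases "fredholm A (1 / \<mu>) = 0")
  case False
  show ?thesis
    by (rule multiplicity_aux[where e = 1 and h = "fredholm A" and k = 0, OF A \<mu>])
      (use False holomorphic_on_subset[OF fredholm_entire[OF A] subset_UNIV] in auto)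
next
  case True
  have "\<not> fredholm A constant_on UNIV"
    using True fredholm_0[OF A] unfolding constant_on_def by (metis UNIV_I zero_neq_one)
  with fredholm_entire[OF A] True obtain h e k where
    "0 < k" "0 < e" "ball (1 / \<mu>) e \<subseteq> UNIV" "h holomorphic_on ball (1 / \<mu>) e"
    "\<And>w. w \<in> ball (1 / \<mu>) e \<Longrightarrow> fredholm A w = (w - 1 / \<mu>) ^ k * h w"
    "\<And>w. w \<in> ball (1 / \<mu>) e \<Longrightarrow> h w \<noteq> 0"
    using holomorphic_factor_zero_nonconstant[of "fredholm A" UNIV "1 / \<mu>"] by (metis UNIV_I connected_UNIV open_UNIV)
  then show ?thesis by (intro multiplicity_aux[OF A \<mu>, of e h k]) auto
qed

text \<open>The derivative of the determinant at the origin is minus the trace by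
  \<open>fredholm_deriv\<close> and minus the sum of the eigenvalues by
  \<open>spec_sum\<close>.\<close>

theorem lidskii:
  assumes A: "adm C A"
  shows "((\<lambda>\<mu>. of_nat (fv.dim (geig A \<mu>)) * \<mu>) has_sum (\<Sum>i. A i i)) {\<mu>. \<mu> \<noteq> 0 \<and> fv.dim (geig A \<mu>) \<noteq> 0}"
proof -
  interpret genus_zero "fredholm A" "\<lambda>\<mu>. fv.dim (geig A \<mu>)" "growthK C" \<rho>
  proof
    fix \<mu> :: complex assume "\<mu> \<noteq> 0"
    from multiplicity[OF A this] obtain B g where
      B: "finite B" "fv.independent B" "fv.span B = geig A \<mu>"
      and g: "g holomorphic_on UNIV" "g (1 / \<mu>) \<noteq> 0" "\<And>z. fredholm A z = (1 - z * \<mu>) ^ card B * g z"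
      by blast
    have "fv.dim (geig A \<mu>) = card B"
      using fv.dim_span_eq_card_independent[OF B(2)] B(3) by simp
    with g show "\<exists>h. h holomorphic_on UNIV \<and> h (1 / \<mu>) \<noteq> 0 \<and>
        (\<forall>z. fredholm A z = (1 - z * \<mu>) ^ fv.dim (geig A \<mu>) * h z)" by auto
  qed (use fredholm_entire[OF A] fredholm_0[OF A] growthK_pos[OF adm_pos[OF A]] \<rho>_pos \<rho>_less fredholm_growth[OF A] in auto)
  show ?thesis using spec_sum fredholm_deriv[OF A] by (simp add: spec_def)
qed

end

section \<open>Fourier coefficients on the torus\<close>

no_notation vec_index (infixl "$" 100)
no_notation fps_nth (infixl "$" 75)

section \<open>The Japanese bracket and lattice sums\<close>

lemma normZ_eq: "(normZ \<xi>)\<^sup>2 = (\<Sum>i\<in>UNIV. (real_of_int (\<xi> i))\<^sup>2)"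
  by (simp add: normZ_def sum_nonneg)

lemma normZ_nonneg: "0 \<le> normZ \<xi>"
  by (simp add: normZ_def sum_nonneg)

lemma japZ_ge_1: "1 \<le> japZ \<xi>"
  by (simp add: japZ_def)

lemma japZ_pos: "0 < japZ \<xi>"
  using japZ_ge_1[of \<xi>] by linarith

lemma normZ_le_japZ: "normZ \<xi> \<le> japZ \<xi>"
  unfolding japZ_def by (rule real_le_rsqrt) simp

lemma japZ_sq: "(japZ \<xi>)\<^sup>2 = 1 + (\<Sum>i\<in>UNIV. (real_of_int (\<xi> i))\<^sup>2)"
  by (simp add: japZ_def normZ_eq[symmetric])

lemma coord_le_japZ: "(1 + \<bar>real_of_int (\<xi> i)\<bar>) / 2 \<le> japZ \<xi>"
proof (rule power2_le_imp_le)
  have "((1 + \<bar>real_of_int (\<xi> i)\<bar>) / 2)\<^sup>2 \<le> 1 + (real_of_int (\<xi> i))\<^sup>2"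
  proof -
    have "0 \<le> (1 - \<bar>real_of_int (\<xi> i)\<bar>)\<^sup>2" by simp
    then show ?thesis by (simp add: power2_eq_square field_simps)
  qed
  also have "(real_of_int (\<xi> i))\<^sup>2 \<le> (\<Sum>i\<in>UNIV. (real_of_int (\<xi> i))\<^sup>2)"
    by (rule member_le_sum) auto
  finally show "((1 + \<bar>real_of_int (\<xi> i)\<bar>) / 2)\<^sup>2 \<le> (japZ \<xi>)\<^sup>2"
    by (simp add: japZ_sq)
qed (use japZ_pos less_imp_le in blast)

lemma normZ_triangle: "normZ (\<lambda>i. \<xi> i + \<zeta> i) \<le> normZ \<xi> + normZ \<zeta>"
  using L2_set_triangle_ineq[of "\<lambda>i. real_of_int (\<xi> i)" "\<lambda>i. real_of_int (\<zeta> i)" UNIV]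
  by (simp add: normZ_def L2_set_def)

lemma peetre: "japZ \<eta> \<le> 2 * japZ \<xi> * japZ (\<lambda>i. \<eta> i - \<xi> i)"
proof -
  let ?a = "normZ \<xi>" and ?b = "normZ (\<lambda>i. \<eta> i - \<xi> i)"
  have "normZ \<eta> \<le> ?a + ?b"
    using normZ_triangle[of \<xi> "\<lambda>i. \<eta> i - \<xi> i"] by simp
  then have "(normZ \<eta>)\<^sup>2 \<le> (?a + ?b)\<^sup>2" using normZ_nonneg by (intro power_mono) auto
  \<comment> \<open>The sum of squares shown to be nonnegative is exactly 4 (1 + a^2) (1 + b^2) - 1
    - (a + b)^2.\<close>
  moreover have "0 \<le> (?a - ?b)\<^sup>2 + 1 + 2 * (1 + ?a\<^sup>2) * (1 + ?b\<^sup>2) + 2 * (?a * ?b)\<^sup>2" by simp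
  ultimately have "1 + (normZ \<eta>)\<^sup>2 \<le> 4 * ((1 + ?a\<^sup>2) * (1 + ?b\<^sup>2))"
    by (simp add: power2_eq_square algebra_simps)
  then have "sqrt (1 + (normZ \<eta>)\<^sup>2) \<le> sqrt (4 * ((1 + ?a\<^sup>2) * (1 + ?b\<^sup>2)))"
    by (rule real_sqrt_le_mono)
  then show ?thesis by (simp add: japZ_def real_sqrt_mult)
qed

lemma sum_int_bound:
  fixes g :: "nat \<Rightarrow> real"
  assumes "summable g" "\<And>k. 0 \<le> g k"
  shows "(\<Sum>t\<in>{-int N..int N}. g (nat \<bar>t\<bar>)) \<le> 2 * suminf g"
proof -
  have "{-int N..int N} \<subseteq> int ` {..N} \<union> (\<lambda>k. - int k) ` {..N}"
  proof
    fix t assume t: "t \<in> {-int N..int N}"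
    show "t \<in> int ` {..N} \<union> (\<lambda>k. - int k) ` {..N}"
      using t by (cases "t \<ge> 0") (auto intro!: image_eqI[of _ _ "nat \<bar>t\<bar>"])
  qed
  then have "(\<Sum>t\<in>{-int N..int N}. g (nat \<bar>t\<bar>)) \<le> (\<Sum>t\<in>int ` {..N} \<union> (\<lambda>k. - int k) ` {..N}. g (nat \<bar>t\<bar>))"
    by (intro sum_mono2) (auto simp: assms)
  also have "\<dots> \<le> (\<Sum>t\<in>int ` {..N}. g (nat \<bar>t\<bar>)) + (\<Sum>t\<in>(\<lambda>k. - int k) ` {..N}. g (nat \<bar>t\<bar>))"
    using sum.union_inter[of "int ` {..N}" "(\<lambda>k. - int k) ` {..N}" "\<lambda>t. g (nat \<bar>t\<bar>)"]
      sum_nonneg[of "int ` {..N} \<inter> (\<lambda>k. - int k) ` {..N}" "\<lambda>t. g (nat \<bar>t\<bar>)"] assms(2) by simp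
  also have "\<dots> = 2 * (\<Sum>k\<le>N. g k)"
    by (subst sum.reindex, simp add: inj_on_def, subst sum.reindex, simp add: inj_on_def) simp
  also have "\<dots> \<le> 2 * suminf g"
    using assms by (intro mult_left_mono sum_le_suminf) auto
  finally show ?thesis .
qed

text \<open>Since the bracket dominates (1 + |\<xi> i|)/2 for each \<open>i\<close>, its power - s,
  split into n equal factors, is at most a product of one-dimensional terms with exponent s/n > 1.
  Over a box the sum of such products factorises.\<close>

lemma japZ_summable:
  assumes "s > real CARD('n::finite)"
  shows "(\<lambda>\<xi>::'n \<Rightarrow> int. japZ \<xi> powr - s) summable_on UNIV"
proof (rule nonneg_bdd_above_summable_on)
  define c where "c = s / real CARD('n)"
  have c: "c > 1" "s = c * real CARD('n)" using assms by (simp_all add: c_def)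
  define g where "g = (\<lambda>k. ((1 + real k) / 2) powr - c)"
  have "summable (\<lambda>k. real k powr - c)"
    using c by (simp add: summable_real_powr_iff)
  then have "summable (\<lambda>k. real (Suc k) powr - c)" by (subst summable_Suc_iff)
  then have "summable (\<lambda>k. (1 / 2) powr - c * real (Suc k) powr - c)" by (rule summable_mult)
  then have g: "summable g" by (simp add: g_def powr_mult[symmetric])
  have g_nonneg: "0 \<le> g k" for k by (simp add: g_def)
  show "bdd_above (sum (\<lambda>\<xi>::'n \<Rightarrow> int. japZ \<xi> powr - s) ` {F. F \<subseteq> UNIV \<and> finite F})"
  proof (rule bdd_aboveI2)
    fix F :: "('n \<Rightarrow> int) set" assume "F \<in> {F. F \<subseteq> UNIV \<and> finite F}"
    then have F: "finite F" by simp
    define N where "N = Max (insert 0 ((\<lambda>(\<xi>, i). nat \<bar>\<xi> i\<bar>) ` (F \<times> UNIV)))"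
    have N: "nat \<bar>\<xi> i\<bar> \<le> N" if "\<xi> \<in> F" for \<xi> i
      unfolding N_def using F that by (intro Max_ge) (auto intro!: image_eqI[of _ _ "(\<xi>, i)"])
    have "(\<Sum>\<xi>\<in>F. japZ \<xi> powr - s) \<le> (\<Sum>\<xi>\<in>F. \<Prod>i\<in>UNIV. g (nat \<bar>\<xi> i\<bar>))"
    proof (rule sum_mono)
      fix \<xi> :: "'n \<Rightarrow> int"
      have "japZ \<xi> powr - s = (\<Prod>i\<in>(UNIV::'n set). japZ \<xi> powr - c)"
        using japZ_pos[of \<xi>] by (simp add: c(2) powr_powr powr_realpow[symmetric])
      also have "\<dots> \<le> (\<Prod>i\<in>UNIV. g (nat \<bar>\<xi> i\<bar>))"
      proof (intro prod_mono conjI)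
        fix i
        show "japZ \<xi> powr - c \<le> g (nat \<bar>\<xi> i\<bar>)"
          unfolding g_def using coord_le_japZ[of \<xi> i] c by (intro powr_mono2') auto
      qed auto
      finally show "japZ \<xi> powr - s \<le> (\<Prod>i\<in>UNIV. g (nat \<bar>\<xi> i\<bar>))" .
    qed
    also have "\<dots> \<le> (\<Sum>\<xi>\<in>PiE UNIV (\<lambda>_. {-int N..int N}). \<Prod>i\<in>(UNIV::'n set). g (nat \<bar>\<xi> i\<bar>))"
    proof (rule sum_mono2)
      show "F \<subseteq> PiE UNIV (\<lambda>_. {-int N..int N})"
      proof
        fix \<xi> assume "\<xi> \<in> F"
        then have "- int N \<le> \<xi> i" "\<xi> i \<le> int N" for i using N[of \<xi> i] by linarith+
        then show "\<xi> \<in> PiE UNIV (\<lambda>_. {-int N..int N})" by auto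
      qed
    qed (auto intro!: finite_PiE prod_nonneg g_nonneg)
    also have "\<dots> = (\<Prod>i\<in>(UNIV::'n set). \<Sum>t\<in>{-int N..int N}. g (nat \<bar>t\<bar>))"
      by (rule prod_sum_PiE[symmetric]) auto
    also have "\<dots> \<le> (\<Prod>i\<in>(UNIV::'n set). 2 * suminf g)"
      by (intro prod_mono conjI sum_nonneg g_nonneg sum_int_bound g)
    finally show "(\<Sum>\<xi>\<in>F. japZ \<xi> powr - s) \<le> (\<Prod>i\<in>(UNIV::'n set). 2 * suminf g)" .
  qed
qed auto

section \<open>Integration over the unit cube\<close>

lemma mem_cube: "x \<in> cube \<longleftrightarrow> (\<forall>i. 0 \<le> x $ i \<and> x $ i \<le> 1)"
proof -
  have One: "(One :: real^'n) \<bullet> axis i 1 = 1" for i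
    using inner_sum_left_Basis[of "axis i 1 :: real^'n" "\<lambda>_. 1"] by (simp add: axis_in_Basis_iff)
  have bas: "(\<forall>b\<in>(Basis :: (real^'n) set). P b) = (\<forall>i. P (axis i 1))" for P
    by (auto simp: Basis_vec_def)
  show ?thesis
    unfolding cube_def mem_box bas One by (simp add: inner_axis)
qed

lemma cube_compact [simp]: "compact cube"
  by (simp add: cube_def)

lemma cube_borel [measurable, simp]: "cube \<in> sets borel"
  by (simp add: cube_def)

lemma measure_cube: "measure lborel (cube :: (real^'n::finite) set) = 1"
  using content_unit[where 'a = "real^'n"] by (simp add: cube_def)

lemma emeasure_cube: "emeasure lborel (cube :: (real^'n::finite) set) = 1"
  using measure_cube[where 'n = 'n] emeasure_eq_ennreal_measure[of lborel "cube :: (real^'n) set"]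
    emeasure_compact_finite[OF cube_compact, where 'a1 = 'n] by (simp add: top.not_eq_extremum)

lemma set_integrable_cube:
  fixes f :: "real^'n::finite \<Rightarrow> 'b :: {banach, second_countable_topology}"
  assumes "continuous_on UNIV f"
  shows "set_integrable lborel cube f"
  unfolding set_integrable_def
  by (intro borel_integrable_compact cube_compact continuous_on_subset[OF assms]) auto

lemma set_integral_const: "(LINT x:(cube :: (real^'n::finite) set)|lborel. c) = (c :: 'b :: {banach, second_countable_topology})"
  unfolding set_lebesgue_integral_def by (simp add: measure_cube emeasure_cube)

lemma norm_set_integral_le:
  fixes f :: "real^'n::finite \<Rightarrow> 'b :: {banach, second_countable_topology}"
  assumes "\<And>x. norm (f x) \<le> B"
  shows "norm (LINT x:cube|lborel. f x) \<le> B"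
proof (cases "set_integrable lborel cube f")
  case True
  have "norm (LINT x:cube|lborel. f x) \<le> (LINT x:cube|lborel. norm (f x))"
    using True by (rule set_integral_norm_bound)
  also have "\<dots> \<le> (LINT x:(cube::(real^'n) set)|lborel. B)"
    by (rule set_integral_mono[OF set_integrable_norm[OF True] set_integrable_cube[OF continuous_on_const]]) (rule assms)
  finally show ?thesis by (simp add: set_integral_const)
next
  \<comment> \<open>The Bochner integral of a function that is not integrable is 0 by convention, so
    the bound remains true.\<close>
  case False
  have "0 \<le> B" using assms norm_ge_zero order_trans by blast
  then show ?thesis
    using False by (simp add: set_lebesgue_integral_def set_integrable_def not_integrable_integral_eq)
qed

lemma AE_coord_neq: "AE x in lborel. (x :: real^'n::finite) $ i \<noteq> c"
proof -
  have "negligible {x :: real^'n. x $ i = c}"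
    using negligible_standard_hyperplane[of "axis i 1 :: real^'n" c] by (simp add: cart_eq_inner_axis)
  moreover have "{x :: real^'n. x $ i = c} \<in> sets borel"
    by (intro borel_closed closed_Collect_eq continuous_intros)
  ultimately have "{x :: real^'n. x $ i = c} \<in> null_sets lborel"
    by (simp add: negligible_iff_null_sets null_sets_completion_iff)
  then show ?thesis by (rule AE_I') auto
qed

text \<open>The shifted cube and the cube differ by a null set and by a slab moved by one period.\<close>

lemma integral_cube_shift:
  fixes f :: "real^'n::finite \<Rightarrow> complex"
  assumes cont: "continuous_on UNIV f" and per: "periodic_fn f" and t: "0 \<le> t" "t \<le> 1"
  shows "(LINT x:cube|lborel. f (x + t *\<^sub>R axis i 1)) = (LINT x:cube|lborel. f x)"
proof -
  define e where "e = (axis i 1 :: real^'n)"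
  have e: "e $ i = 1" "\<And>j. j \<noteq> i \<Longrightarrow> e $ j = 0" by (simp_all add: e_def axis_def)
  have [measurable]: "f \<in> borel_measurable borel"
    using cont by (rule borel_measurable_continuous_onI)
  define A where "A = {x :: real^'n. x \<in> cube \<and> t < x $ i}"
  define B where "B = {x :: real^'n. x \<in> cube \<and> x $ i \<le> t}"
  have coord: "(\<lambda>x::real^'n. x $ i) \<in> borel_measurable borel"
    by (intro borel_measurable_continuous_onI continuous_intros)
  have [measurable]: "A \<in> sets borel" "B \<in> sets borel"
    unfolding A_def B_def using coord by measurable
  have shift: "(\<integral>x. g (x + c) \<partial>lborel) = (\<integral>x. g x \<partial>lborel)"
    if [measurable]: "g \<in> borel_measurable borel" for g :: "real^'n \<Rightarrow> complex" and c
  proof -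
    have "(\<integral>x. g x \<partial>lborel) = (\<integral>x. g x \<partial>distr lborel borel ((+) c))"
      by (simp add: lborel_distr_plus)
    also have "\<dots> = (\<integral>x. g (c + x) \<partial>lborel)" by (rule integral_distr) auto
    finally show ?thesis by (simp add: add.commute)
  qed
  have intf: "integrable lborel (\<lambda>x. indicator S x *\<^sub>R f x)" if "S \<subseteq> cube" "S \<in> sets borel" for S
  proof -
    have "set_integrable lborel S f"
      using set_integrable_subset[OF set_integrable_cube[OF cont], of S] that by simp
    then show ?thesis by (simp add: set_integrable_def)
  qed
  have A: "integrable lborel (\<lambda>x. indicator A x *\<^sub>R f x)" and B: "integrable lborel (\<lambda>x. indicator B x *\<^sub>R f x)"
    by (intro intf; auto simp: A_def B_def)+
  have Bs: "(\<integral>x. indicator B (x - e) *\<^sub>R f x \<partial>lborel) = (\<integral>x. indicator B x *\<^sub>R f x \<partial>lborel)"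
  proof -
    have "(\<integral>x. indicator B (x - e) *\<^sub>R f x \<partial>lborel) = (\<integral>x. indicator B (x + e - e) *\<^sub>R f (x + e) \<partial>lborel)"
      by (rule shift[symmetric]) measurable
    then show ?thesis using per by (simp add: periodic_fn_def e_def)
  qed
  have Bi: "integrable lborel (\<lambda>x. indicator B (x - e) *\<^sub>R f x)"
  proof -
    have "integrable (distr lborel borel ((+) (- e))) (\<lambda>x. indicator B x *\<^sub>R f (x + e))"
      using B per by (simp add: lborel_distr_plus periodic_fn_def e_def)
    then have "integrable lborel (\<lambda>x. indicator B (- e + x) *\<^sub>R f (- e + x + e))"
      by (subst (asm) integrable_distr_eq) auto
    then show ?thesis by (simp add: algebra_simps)
  qed
  have "(LINT x:cube|lborel. f (x + t *\<^sub>R e)) = (\<integral>x. indicator cube (x + t *\<^sub>R e - t *\<^sub>R e) *\<^sub>R f (x + t *\<^sub>R e) \<partial>lborel)"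
    by (simp add: set_lebesgue_integral_def)
  also have "\<dots> = (\<integral>x. indicator cube (x - t *\<^sub>R e) *\<^sub>R f x \<partial>lborel)"
    by (rule shift) measurable
  also have "\<dots> = (\<integral>x. indicator A x *\<^sub>R f x + indicator B (x - e) *\<^sub>R f x \<partial>lborel)"
  proof (rule integral_cong_AE)
    show "AE x in lborel. indicator cube (x - t *\<^sub>R e) *\<^sub>R f x = indicator A x *\<^sub>R f x + indicator B (x - e) *\<^sub>R f x"
      \<comment> \<open>On these two hyperplanes the pieces overlap or leave out a face; everywhere
        else the decomposition is exact.\<close>
      using AE_coord_neq[of i 1] AE_coord_neq[of i t]
    proof eventually_elim
      case (elim x)
      have split: "(\<forall>j. P j) \<longleftrightarrow> (\<forall>j. j \<noteq> i \<longrightarrow> P j) \<and> P i" for P :: "'n \<Rightarrow> bool"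
        by metis
      have c1: "x - t *\<^sub>R e \<in> cube \<longleftrightarrow> (\<forall>j. j \<noteq> i \<longrightarrow> 0 \<le> x $ j \<and> x $ j \<le> 1) \<and> t \<le> x $ i \<and> x $ i \<le> 1 + t"
        unfolding mem_cube by (subst split) (auto simp: e)
      have c2: "x \<in> A \<longleftrightarrow> (\<forall>j. j \<noteq> i \<longrightarrow> 0 \<le> x $ j \<and> x $ j \<le> 1) \<and> t < x $ i \<and> x $ i \<le> 1"
        unfolding A_def mem_Collect_eq mem_cube using t by (subst split) auto
      have c3: "x - e \<in> B \<longleftrightarrow> (\<forall>j. j \<noteq> i \<longrightarrow> 0 \<le> x $ j \<and> x $ j \<le> 1) \<and> 1 \<le> x $ i \<and> x $ i \<le> 1 + t"
        unfolding B_def mem_Collect_eq mem_cube using t by (subst split) (auto simp: e)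
      show ?case
        using c1 c2 c3 elim t by (auto simp: indicator_def)
    qed
  qed measurable
  also have "\<dots> = (\<integral>x. indicator A x *\<^sub>R f x \<partial>lborel) + (\<integral>x. indicator B x *\<^sub>R f x \<partial>lborel)"
    by (simp add: A Bi Bs)
  also have "\<dots> = (\<integral>x. indicator A x *\<^sub>R f x + indicator B x *\<^sub>R f x \<partial>lborel)"
    by (simp add: A B)
  also have "\<dots> = (LINT x:cube|lborel. f x)"
    unfolding set_lebesgue_integral_def by (intro Bochner_Integration.integral_cong) (auto simp: A_def B_def indicator_def)
  finally show ?thesis by (simp add: e_def)
qed

section \<open>Characters and Fourier coefficients\<close>

lemma norm_cexpo [simp]: "norm (cexpo x \<xi>) = 1"
  by (simp add: cexpo_def)

lemma cexpo_continuous: "continuous_on UNIV (\<lambda>x. cexpo x \<xi>)"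
  unfolding cexpo_def dotZ_def by (intro continuous_intros)

lemma cexpo_shift: "cexpo (x + t *\<^sub>R axis i 1) \<xi> = cexpo x \<xi> * exp (\<i> * complex_of_real (2 * pi * (t * real_of_int (\<xi> i))))"
proof -
  have "dotZ (x + t *\<^sub>R axis i 1) \<xi> = dotZ x \<xi> + (\<Sum>j\<in>UNIV. (if j = i then t * real_of_int (\<xi> j) else 0))"
    unfolding dotZ_def sum.distrib[symmetric]
    by (intro sum.cong) (auto simp: axis_def algebra_simps)
  then show ?thesis
    by (simp add: cexpo_def exp_add[symmetric] algebra_simps)
qed

lemma cexpo_periodic: "periodic_fn (\<lambda>x. cexpo x \<xi>)"
  unfolding periodic_fn_def
proof safe
  fix x i
  have "exp (\<i> * complex_of_real (2 * pi * (1 * real_of_int (\<xi> i)))) = 1"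
    using exp_two_pi_i'[of] by (subst exp_eq_1) (auto intro!: exI[of _ "\<xi> i"])
  then show "cexpo (x + axis i 1) \<xi> = cexpo x \<xi>"
    using cexpo_shift[of x 1 i \<xi>] by simp
qed

lemma cnj_cexpo: "cnj (cexpo x \<xi>) = cexpo x (\<lambda>i. - \<xi> i)"
proof -
  have "dotZ x (\<lambda>i. - \<xi> i) = - dotZ x \<xi>"
    by (simp add: dotZ_def sum_negf)
  then show ?thesis
    unfolding cexpo_def exp_cnj by simp
qed

lemma cexpo_mult_cnj: "cnj (cexpo x \<eta>) * cexpo x \<xi> = cexpo x (\<lambda>i. \<xi> i - \<eta> i)"
proof -
  have eq: "dotZ x (\<lambda>i. \<xi> i - \<eta> i) = dotZ x \<xi> - dotZ x \<eta>"
    by (simp add: dotZ_def algebra_simps sum_subtractf)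
  then show ?thesis
    unfolding cexpo_def exp_cnj exp_add[symmetric] eq by (simp add: algebra_simps)
qed

text \<open>For \<zeta> \<noteq> 0, translating by half a period in a coordinate where \<zeta> is
  nonzero reverses the sign of the character but preserves its integral.\<close>

lemma integral_cexpo:
  fixes \<zeta> :: "'n::finite \<Rightarrow> int"
  shows "(LINT x:cube|lborel. cexpo x \<zeta>) = (if \<zeta> = (\<lambda>i. 0) then 1 else 0)"
proof (cases "\<zeta> = (\<lambda>i. 0)")
  case True
  then show ?thesis by (simp add: cexpo_def dotZ_def set_integral_const)
next
  case False
  then obtain i where i: "\<zeta> i \<noteq> 0" by auto
  define t where "t = 1 / (2 * \<bar>real_of_int (\<zeta> i)\<bar>)"
  have "1 \<le> \<bar>real_of_int (\<zeta> i)\<bar>" using i by linarith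
  then have t: "0 \<le> t" "t \<le> 1" by (simp_all add: t_def field_simps)
  let ?I = "LINT x:cube|lborel. cexpo x \<zeta>"
  have eq: "2 * pi * (t * real_of_int (\<zeta> i)) = pi * sgn (real_of_int (\<zeta> i))"
    using i by (simp add: t_def sgn_if field_simps)
  have "exp (\<i> * complex_of_real (2 * pi * (t * real_of_int (\<zeta> i)))) = - 1"
    unfolding eq using i by (auto simp: sgn_if exp_minus)
  then have "?I = (LINT x:cube|lborel. - cexpo x \<zeta>)"
    using integral_cube_shift[OF cexpo_continuous[of \<zeta>] cexpo_periodic t, of i] by (simp add: cexpo_shift)
  then have "?I = - ?I" by (simp add: set_lebesgue_integral_def)
  then show ?thesis using False by simp
qed

lemma set_integrable_cnj_cexpo:
  fixes f :: "'n::finite tfun"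
  assumes "set_integrable lborel cube f"
  shows "set_integrable lborel cube (\<lambda>x. cnj (cexpo x \<xi>) * f x)"
proof -
  have [measurable]: "(\<lambda>x. cnj (cexpo x \<xi>)) \<in> borel_measurable borel"
    by (intro borel_measurable_continuous_onI continuous_on_cnj cexpo_continuous)
  have m: "(\<lambda>x. indicator cube x *\<^sub>R f x) \<in> borel_measurable lborel"
    using assms unfolding set_integrable_def by (rule borel_measurable_integrable)
  have "integrable lborel (\<lambda>x. cnj (cexpo x \<xi>) * (indicator cube x *\<^sub>R f x))"
  proof (rule Bochner_Integration.integrable_bound[OF assms[unfolded set_integrable_def]])
    show "(\<lambda>x. cnj (cexpo x \<xi>) * (indicator cube x *\<^sub>R f x)) \<in> borel_measurable lborel"
      by (rule borel_measurable_times[OF _ m]) measurable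
  qed (auto simp: norm_mult)
  then show ?thesis by (simp add: set_integrable_def)
qed

lemma fhat_lincomb:
  assumes "set_integrable lborel cube f" "set_integrable lborel cube g"
  shows "fhat (\<lambda>x. c * f x + g x) \<xi> = c * fhat f \<xi> + fhat g \<xi>"
proof -
  have "fhat (\<lambda>x. c * f x + g x) \<xi> = (LINT x:cube|lborel. c * (cnj (cexpo x \<xi>) * f x) + cnj (cexpo x \<xi>) * g x)"
    by (simp add: fhat_def algebra_simps)
  also have "\<dots> = c * fhat f \<xi> + fhat g \<xi>"
    unfolding fhat_def
    using assms by (subst set_integral_add) (auto intro!: set_integrable_mult_right set_integrable_cnj_cexpo)
  finally show ?thesis .
qed

lemma fhat_0: "fhat (\<lambda>x. 0) \<xi> = 0"
  by (simp add: fhat_def)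

lemma set_integrable_lincomb:
  fixes f g :: "'n::finite tfun"
  assumes "set_integrable lborel cube f" "set_integrable lborel cube g"
  shows "set_integrable lborel cube (\<lambda>x. c * f x + g x)"
  using assms by (intro set_integral_add(1)) auto

lemma set_integrable_0: "set_integrable lborel cube (\<lambda>x. 0 :: complex)"
  by (simp add: set_integrable_def)

lemma fhat_sum:
  assumes "finite S" "\<And>s. s \<in> S \<Longrightarrow> set_integrable lborel cube (f s)"
  shows "set_integrable lborel cube (\<lambda>x. \<Sum>s\<in>S. c s * f s x) \<and>
    fhat (\<lambda>x. \<Sum>s\<in>S. c s * f s x) \<xi> = (\<Sum>s\<in>S. c s * fhat (f s) \<xi>)"
  using assms
proof (induction S rule: finite_induct)
  case empty
  then show ?case by (simp add: fhat_0 set_integrable_0)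
next
  case (insert a S)
  then show ?case
    using set_integrable_lincomb[of "f a" "\<lambda>x. \<Sum>s\<in>S. c s * f s x" "c a"]
      fhat_lincomb[of "f a" "\<lambda>x. \<Sum>s\<in>S. c s * f s x" "c a" \<xi>] by simp
qed

lemma fhat_cexpo: "fhat (\<lambda>x. cexpo x \<xi>) \<eta> = (if \<xi> = \<eta> then 1 else 0)"
  by (simp add: fhat_def cexpo_mult_cnj integral_cexpo fun_eq_iff)

lemma fhat_bound:
  assumes "\<And>x. norm (f x) \<le> B"
  shows "norm (fhat f \<xi>) \<le> B"
  unfolding fhat_def by (rule norm_set_integral_le) (simp add: norm_mult assms)

lemma fhat_bounded:
  assumes "set_integrable lborel cube f"
  shows "norm (fhat f \<xi>) \<le> (LINT x:cube|lborel. norm (f x))"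
  using set_integral_norm_bound[OF set_integrable_cnj_cexpo[OF assms, of \<xi>]]
  by (simp add: fhat_def norm_mult)

lemma fhat_cexpo_mult: "fhat (\<lambda>x. cexpo x \<xi> * f x) \<eta> = fhat f (\<lambda>i. \<eta> i - \<xi> i)"
proof -
  have "cnj (cexpo x \<eta>) * (cexpo x \<xi> * f x) = cnj (cexpo x (\<lambda>i. \<eta> i - \<xi> i)) * f x" for x
    by (simp only: mult.assoc[symmetric] cexpo_mult_cnj) (simp add: cnj_cexpo)
  then show ?thesis by (simp only: fhat_def)
qed

text \<open>Dominated convergence works along sequences, hence the increments 1/(n + 1) in place of
  a continuous parameter.\<close>

lemma difference_quotient_LIMSEQ:
  fixes f :: "real \<Rightarrow> complex"
  assumes "(f has_vector_derivative D) (at 0)"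
  shows "(\<lambda>n. of_nat (Suc n) * (f (inverse (real (Suc n))) - f 0)) \<longlonglongrightarrow> D"
proof -
  let ?t = "\<lambda>n. inverse (real (Suc n))"
  have "((\<lambda>t. norm (f t - f 0 - (t - 0) *\<^sub>R D) / norm (t - 0)) \<longlongrightarrow> 0) (at 0)"
    using assms unfolding has_vector_derivative_def has_derivative_iff_norm by blast
  moreover have "filterlim ?t (at 0) sequentially"
    unfolding filterlim_at using LIMSEQ_inverse_real_of_nat by auto
  ultimately have "(\<lambda>n. norm (f (?t n) - f 0 - (?t n - 0) *\<^sub>R D) / norm (?t n - 0)) \<longlonglongrightarrow> 0"
    by (rule filterlim_compose)
  moreover have "norm (f (?t n) - f 0 - (?t n - 0) *\<^sub>R D) / norm (?t n - 0) = norm (of_nat (Suc n) * (f (?t n) - f 0) - D)" for n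
  proof -
    have "of_nat (Suc n) * (f (?t n) - f 0) - D = of_nat (Suc n) * (f (?t n) - f 0 - ?t n *\<^sub>R D)"
      by (simp add: scaleR_conv_of_real right_diff_distrib del: of_nat_Suc)
    then show ?thesis
      by (simp add: norm_mult divide_inverse mult.commute del: of_nat_Suc)
  qed
  ultimately have "(\<lambda>n. norm (of_nat (Suc n) * (f (?t n) - f 0) - D)) \<longlonglongrightarrow> 0" by simp
  then show ?thesis by (simp only: tendsto_norm_zero_iff LIM_zero_iff)
qed

text \<open>Integration by parts, as the limit of difference quotients along the invariance of the
  integral under translations.\<close>

lemma fhat_deriv:
  fixes h :: "'n::finite tfun"
  assumes cont: "continuous_on UNIV h" and per: "periodic_fn h"
    and diff: "\<And>x. (\<lambda>t. h (x + t *\<^sub>R axis i 1)) differentiable (at 0)"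
    and bound: "\<And>x. norm (pderiv_dir i h x) \<le> B"
  shows "fhat (pderiv_dir i h) \<zeta> = \<i> * of_real (2 * pi * real_of_int (\<zeta> i)) * fhat h \<zeta>"
proof -
  define e where "e = (axis i 1 :: real^'n)"
  have D0: "((\<lambda>t. h (x + t *\<^sub>R e)) has_vector_derivative pderiv_dir i h x) (at 0)" for x
    using diff[of x] unfolding pderiv_dir_def e_def by (simp add: vector_derivative_works)
  have D: "((\<lambda>t. h (x + t *\<^sub>R e)) has_vector_derivative pderiv_dir i h (x + t *\<^sub>R e)) (at t)" for x t
  proof -
    let ?y = "x + t *\<^sub>R e"
    have 1: "((\<lambda>s. s - t) has_derivative (\<lambda>s. s)) (at t)" by (rule derivative_eq_intros refl | simp)+
    have 2: "((\<lambda>s. h (?y + s *\<^sub>R e)) has_derivative (\<lambda>u. u *\<^sub>R pderiv_dir i h ?y)) (at (t - t))"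
      using D0[of ?y] by (simp add: has_vector_derivative_def)
    have eq: "?y + (s - t) *\<^sub>R e = x + s *\<^sub>R e" for s by (simp add: algebra_simps)
    show ?thesis
      using has_derivative_compose[OF 1 2] unfolding eq has_vector_derivative_def .
  qed
  define q where "q = (\<lambda>n x. of_nat (Suc n) * (h (x + inverse (real (Suc n)) *\<^sub>R e) - h x))"
  \<comment> \<open>The mean value inequality turns the bound on the derivative into a bound on all
    difference quotients, the majorant for dominated convergence.\<close>
  have q_bound: "norm (q n x) \<le> B" for n x
  proof -
    have "norm (h (x + inverse (real (Suc n)) *\<^sub>R e) - h (x + 0 *\<^sub>R e)) \<le> B * norm (inverse (real (Suc n)) - 0)"
    proof (rule differentiable_bound[of UNIV _ "\<lambda>t u. u *\<^sub>R pderiv_dir i h (x + t *\<^sub>R e)"])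
      show "onorm (\<lambda>u. u *\<^sub>R pderiv_dir i h (x + t *\<^sub>R e)) \<le> B" for t
        by (rule onorm_le) (simp add: mult.commute[of B] mult_left_mono bound)
    qed (use D in \<open>auto simp: has_vector_derivative_def\<close>)
    then have "real (Suc n) * norm (h (x + inverse (real (Suc n)) *\<^sub>R e) - h x) \<le> real (Suc n) * (B * inverse (real (Suc n)))"
      by (intro mult_left_mono) auto
    also have "\<dots> = B" by simp
    finally show ?thesis unfolding q_def norm_mult norm_of_nat .
  qed
  have q_lim: "(\<lambda>n. q n x) \<longlonglongrightarrow> pderiv_dir i h x" for x
  proof -
    show ?thesis
      using difference_quotient_LIMSEQ[OF D0[of x]] by (simp add: q_def del: of_nat_Suc)
  qed
  have q_cont: "continuous_on UNIV (q n)" for n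
    unfolding q_def by (intro continuous_intros continuous_on_compose2[OF cont]) auto
  let ?c = "\<lambda>t. \<i> * complex_of_real (2 * pi * (t * real_of_int (\<zeta> i)))"
  have fh: "fhat (q n) \<zeta> = of_nat (Suc n) * (exp (?c (inverse (real (Suc n)))) - 1) * fhat h \<zeta>" for n
  proof -
    let ?t = "inverse (real (Suc n))"
    have t: "0 \<le> ?t" "?t \<le> 1" by (simp_all add: inverse_le_1_iff)
    have sh: "fhat (\<lambda>x. h (x + ?t *\<^sub>R e)) \<zeta> = exp (?c ?t) * fhat h \<zeta>"
    proof -
      have sh0: "cnj (cexpo x \<zeta>) = exp (?c ?t) * cnj (cexpo (x + ?t *\<^sub>R e) \<zeta>)" for x
      proof -
        have one: "exp (?c ?t) * cnj (exp (?c ?t)) = 1"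
          unfolding exp_cnj exp_add[symmetric] by simp
        have "exp (?c ?t) * (cnj (cexpo x \<zeta>) * cnj (exp (?c ?t))) = cnj (cexpo x \<zeta>) * (exp (?c ?t) * cnj (exp (?c ?t)))"
          by (rule mult.left_commute)
        then show ?thesis unfolding e_def cexpo_shift complex_cnj_mult one by simp
      qed
      have eqf: "(\<lambda>x. cnj (cexpo x \<zeta>) * h (x + ?t *\<^sub>R e))
          = (\<lambda>x. exp (?c ?t) * (cnj (cexpo (x + ?t *\<^sub>R e) \<zeta>) * h (x + ?t *\<^sub>R e)))"
        by (rule ext, subst sh0, rule mult.assoc)
      have "fhat (\<lambda>x. h (x + ?t *\<^sub>R e)) \<zeta> = (LINT x:cube|lborel. exp (?c ?t) * (cnj (cexpo (x + ?t *\<^sub>R e) \<zeta>) * h (x + ?t *\<^sub>R e)))"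
        unfolding fhat_def eqf ..
      also have "\<dots> = exp (?c ?t) * (LINT x:cube|lborel. cnj (cexpo (x + ?t *\<^sub>R e) \<zeta>) * h (x + ?t *\<^sub>R e))"
        by simp
      also have "(LINT x:cube|lborel. cnj (cexpo (x + ?t *\<^sub>R e) \<zeta>) * h (x + ?t *\<^sub>R e)) = fhat h \<zeta>"
        unfolding fhat_def e_def
        by (rule integral_cube_shift[OF _ _ t])
          (use per cexpo_periodic[of \<zeta>] in \<open>auto intro!: continuous_intros continuous_on_cnj cexpo_continuous cont simp: periodic_fn_def\<close>)
      finally show ?thesis .
    qed
    have "fhat (q n) \<zeta> = fhat (\<lambda>x. of_nat (Suc n) * h (x + ?t *\<^sub>R e) + (- of_nat (Suc n)) * h x) \<zeta>"
      by (simp add: q_def algebra_simps)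
    also have "\<dots> = of_nat (Suc n) * fhat (\<lambda>x. h (x + ?t *\<^sub>R e)) \<zeta> + fhat (\<lambda>x. (- of_nat (Suc n)) * h x) \<zeta>"
      by (rule fhat_lincomb; intro set_integrable_cube continuous_intros continuous_on_compose2[OF cont]) auto
    also have "fhat (\<lambda>x. (- of_nat (Suc n)) * h x) \<zeta> = (- of_nat (Suc n)) * fhat h \<zeta>"
      using fhat_lincomb[OF set_integrable_cube[OF cont] set_integrable_0, of "- of_nat (Suc n)" \<zeta>] by (simp add: fhat_0)
    finally have "fhat (q n) \<zeta> = of_nat (Suc n) * (exp (?c ?t) * fhat h \<zeta>) + (- of_nat (Suc n)) * fhat h \<zeta>"
      unfolding sh .
    also have "a * (b * c) + (- a) * c = a * (b - 1) * c" for a b c :: complex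
      by (simp add: algebra_simps)
    finally show ?thesis .
  qed
  have "(\<lambda>n. of_nat (Suc n) * (exp (?c (inverse (real (Suc n)))) - 1)) \<longlonglongrightarrow> \<i> * of_real (2 * pi * real_of_int (\<zeta> i))"
  proof -
    have "((\<lambda>t. exp (?c t)) has_vector_derivative \<i> * of_real (2 * pi * real_of_int (\<zeta> i))) (at 0)"
    proof -
      have "((\<lambda>z. exp (\<i> * of_real (2 * pi * real_of_int (\<zeta> i)) * z)) has_field_derivative \<i> * of_real (2 * pi * real_of_int (\<zeta> i))) (at (of_real 0))"
        by (rule derivative_eq_intros refl | simp)+
      from has_vector_derivative_real_field[OF this] show ?thesis by (simp add: mult_ac)
    qed
    from difference_quotient_LIMSEQ[OF this] show ?thesis by (simp del: of_nat_Suc)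
  qed
  then have lim1: "(\<lambda>n. fhat (q n) \<zeta>) \<longlonglongrightarrow> \<i> * of_real (2 * pi * real_of_int (\<zeta> i)) * fhat h \<zeta>"
    unfolding fh by (rule tendsto_mult[OF _ tendsto_const])
  have lim2: "(\<lambda>n. fhat (q n) \<zeta>) \<longlonglongrightarrow> fhat (pderiv_dir i h) \<zeta>"
    unfolding fhat_def set_lebesgue_integral_def
  proof (rule integral_dominated_convergence)
    have m: "(\<lambda>x. indicator cube x *\<^sub>R (cnj (cexpo x \<zeta>) * q n x)) \<in> borel_measurable lborel" for n
      using borel_measurable_continuous_onI[OF q_cont[of n]]
        borel_measurable_continuous_onI[OF continuous_on_cnj[OF cexpo_continuous[of \<zeta>]]] by measurable
    then show "(\<lambda>x. indicator cube x *\<^sub>R (cnj (cexpo x \<zeta>) * q n x)) \<in> borel_measurable lborel" for n .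
    show "(\<lambda>x. indicator cube x *\<^sub>R (cnj (cexpo x \<zeta>) * pderiv_dir i h x)) \<in> borel_measurable lborel"
      by (rule borel_measurable_LIMSEQ_metric[where f = "\<lambda>n x. indicator cube x *\<^sub>R (cnj (cexpo x \<zeta>) * q n x)", OF m])
        (intro tendsto_intros q_lim)
    show "integrable lborel (\<lambda>x. indicator (cube::(real^'n) set) x *\<^sub>R B)"
      using set_integrable_cube[of "\<lambda>_::real^'n. B"] by (simp add: set_integrable_def)
    show "AE x in lborel. (\<lambda>n. indicator cube x *\<^sub>R (cnj (cexpo x \<zeta>) * q n x)) \<longlonglongrightarrow> indicator cube x *\<^sub>R (cnj (cexpo x \<zeta>) * pderiv_dir i h x)"
      by (intro AE_I2 tendsto_intros q_lim)
    show "AE x in lborel. norm (indicator cube x *\<^sub>R (cnj (cexpo x \<zeta>) * q n x)) \<le> indicator (cube::(real^'n) set) x *\<^sub>R B" for n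
      by (intro AE_I2) (auto simp: indicator_def norm_mult q_bound)
  qed
  show ?thesis using LIMSEQ_unique[OF lim2 lim1] .
qed

section \<open>Periodic Besov spaces\<close>

lemma mem_dyadicD:
  assumes "\<xi> \<in> dyadic m"
  shows "normZ \<xi> < 2 ^ Suc m" "0 < m \<Longrightarrow> 2 ^ m \<le> normZ \<xi>" "2 ^ m \<le> japZ \<xi>"
proof -
  show 1: "normZ \<xi> < 2 ^ Suc m" "0 < m \<Longrightarrow> 2 ^ m \<le> normZ \<xi>"
    using assms by (auto simp: dyadic_def split: if_splits)
  show "2 ^ m \<le> japZ \<xi>"
    using 1(2) normZ_le_japZ[of \<xi>] japZ_ge_1[of \<xi>] by (cases "m = 0") auto
qed

lemma dyadic_ex: "\<exists>m. \<xi> \<in> dyadic m"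
proof -
  obtain k where "normZ \<xi> < 2 ^ k" using real_arch_pow[of 2 "normZ \<xi>"] by auto
  also have "(2::real) ^ k \<le> 2 ^ Suc k" by simp
  finally have ex: "normZ \<xi> < 2 ^ Suc k" .
  define m where "m = (LEAST j. normZ \<xi> < 2 ^ Suc j)"
  have m: "normZ \<xi> < 2 ^ Suc m" unfolding m_def using ex by (rule LeastI)
  have "2 ^ m \<le> normZ \<xi>" if m0: "m \<noteq> 0"
  proof -
    obtain j where j: "m = Suc j" using m0 by (cases m) auto
    then have "\<not> normZ \<xi> < 2 ^ Suc j"
      using not_less_Least[of j "\<lambda>j. normZ \<xi> < 2 ^ Suc j"] by (simp only: m_def[symmetric] lessI not_False_eq_True simp_thms)
    then show ?thesis using j by simp
  qed
  with m have "\<xi> \<in> dyadic m" by (auto simp: dyadic_def)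
  then show ?thesis by blast
qed

lemma dyadic_unique:
  assumes "\<xi> \<in> dyadic m" "\<xi> \<in> dyadic l"
  shows "m = l"
proof -
  have *: False if "\<xi> \<in> dyadic m" "\<xi> \<in> dyadic l" "m < l" for m l
  proof -
    have "(2::real) ^ Suc m \<le> 2 ^ l" using that(3) by (intro power_increasing) auto
    with mem_dyadicD[OF that(1)] mem_dyadicD[OF that(2)] that(3) show False by linarith
  qed
  show ?thesis using *[OF assms] *[OF assms(2,1)] by (metis linorder_neqE_nat)
qed

lemma finite_dyadic [simp]: "finite (dyadic m :: ('n::finite \<Rightarrow> int) set)"
proof (rule finite_subset)
  show "(dyadic m :: ('n \<Rightarrow> int) set) \<subseteq> PiE UNIV (\<lambda>_. {- (2 ^ Suc m)..2 ^ Suc m})"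
  proof
    fix \<xi> :: "'n \<Rightarrow> int" assume \<xi>: "\<xi> \<in> dyadic m"
    have "\<bar>\<xi> i\<bar> \<le> 2 ^ Suc m" for i
    proof -
      have "\<bar>real_of_int (\<xi> i)\<bar> \<le> normZ \<xi>"
        unfolding normZ_def by (rule real_le_rsqrt) (simp, rule member_le_sum, auto)
      with mem_dyadicD(1)[OF \<xi>] have "real_of_int \<bar>\<xi> i\<bar> \<le> real_of_int (2 ^ Suc m)" by simp
      then show ?thesis by (simp only: of_int_le_iff)
    qed
    then have "- (2 ^ Suc m) \<le> \<xi> i" "\<xi> i \<le> 2 ^ Suc m" for i
      by (simp_all add: abs_le_iff minus_le_iff del: power_Suc)
    then show "\<xi> \<in> PiE UNIV (\<lambda>_. {- (2 ^ Suc m)..2 ^ Suc m})" by auto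
  qed
qed (auto intro!: finite_PiE)

lemma block_continuous: "continuous_on UNIV (block m f)"
  unfolding block_def by (intro continuous_intros cexpo_continuous)

lemma fhat_block: "fhat (block m f) \<eta> = (if \<eta> \<in> dyadic m then fhat f \<eta> else 0)"
proof -
  have "fhat (block m f) \<eta> = (\<Sum>\<xi>\<in>dyadic m. fhat f \<xi> * fhat (\<lambda>x. cexpo x \<xi>) \<eta>)"
    unfolding block_def mult.commute[of "cexpo _ _"]
    by (rule conjunct2[OF fhat_sum[OF finite_dyadic set_integrable_cube[OF cexpo_continuous]]])
  then show ?thesis by (simp add: fhat_cexpo if_distrib cong: if_cong)
qed

section \<open>Norms of powers of order \<open>p\<close>\<close>

lemma Lp_norm_nonneg: "0 \<le> Lp_norm p g"
  by (simp add: Lp_norm_def)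

lemma Lp_norm_le:
  assumes "\<And>x. norm (g x) \<le> B" "0 < p"
  shows "Lp_norm p g \<le> B"
proof -
  have B: "0 \<le> B" using assms(1) norm_ge_zero order_trans by blast
  have "norm (LINT x:cube|lborel. norm (g x) powr p) \<le> B powr p"
    using assms by (intro norm_set_integral_le) (simp add: powr_mono2)
  then have "Lp_norm p g \<le> (B powr p) powr (1 / p)"
    unfolding Lp_norm_def using assms(2)
    by (intro powr_mono2) (auto intro!: Bochner_Integration.integral_nonneg simp: set_lebesgue_integral_def)
  then show ?thesis using assms(2) B by (simp add: powr_powr)
qed

lemma Lp_integrable:
  fixes g :: "'n::finite tfun"
  assumes "continuous_on UNIV g" "0 < p"
  shows "set_integrable lborel cube (\<lambda>x. norm (g x) powr p)"
  using assms by (intro set_integrable_cube continuous_on_powr' continuous_intros) auto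

lemma Lp_integral_nonneg: "0 \<le> (LINT x:cube|lborel. norm (g x) powr p)"
  unfolding set_lebesgue_integral_def by (intro Bochner_Integration.integral_nonneg) simp

text \<open>A crude form of Hoelder's inequality, from \<open>t \<le> e + t\<^sup>p e\<^sup>1\<^sup>-\<^sup>p\<close> with \<open>e\<close> the \<open>L\<^sup>p\<close> norm.\<close>

lemma integral_le_Lp:
  fixes g :: "'n::finite tfun"
  assumes cont: "continuous_on UNIV g" and p: "1 < p"
  shows "(LINT x:cube|lborel. norm (g x)) \<le> 2 * Lp_norm p g"
proof -
  define P where "P = (LINT x:cube|lborel. norm (g x) powr p)"
  have P: "0 \<le> P" unfolding P_def by (rule Lp_integral_nonneg)
  note int = Lp_integrable[OF cont, of p]
  have bd: "(LINT x:cube|lborel. norm (g x)) \<le> e + P * e powr (1 - p)" if e: "0 < e" for e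
  proof -
    have "(LINT x:cube|lborel. norm (g x)) \<le> (LINT x:cube|lborel. e + norm (g x) powr p * e powr (1 - p))"
    proof (rule set_integral_mono)
      show "set_integrable lborel cube (\<lambda>x. norm (g x))"
        by (intro set_integrable_cube continuous_intros cont)
      show "set_integrable lborel cube (\<lambda>x. e + norm (g x) powr p * e powr (1 - p))"
        using int p by (intro set_integral_add(1) set_integrable_cube[OF continuous_on_const] set_integrable_mult_left) auto
      fix x
      show "norm (g x) \<le> e + norm (g x) powr p * e powr (1 - p)"
      proof (cases "norm (g x) \<le> e")
        case True
        then show ?thesis by (simp add: add_increasing2)
      next
        case False
        then have "e powr (p - 1) \<le> norm (g x) powr (p - 1)" using e p by (intro powr_mono2) auto
        then have "e powr (p - 1) * e powr (1 - p) * norm (g x) \<le> norm (g x) powr (p - 1) * e powr (1 - p) * norm (g x)"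
          by (intro mult_right_mono) auto
        also have "e powr (p - 1) * e powr (1 - p) = 1" using e by (simp add: powr_add[symmetric])
        also have "norm (g x) powr (p - 1) * e powr (1 - p) * norm (g x) = norm (g x) powr p * e powr (1 - p)"
        proof -
          have "norm (g x) powr p = norm (g x) powr (p - 1) * norm (g x) powr 1"
            using powr_add[of "norm (g x)" "p - 1" 1] by simp
          then show ?thesis using False e by (simp add: mult_ac)
        qed
        finally show ?thesis using e by simp
      qed
    qed
    also have "\<dots> = e + P * e powr (1 - p)"
      using int p by (subst set_integral_add) (auto intro!: set_integrable_cube simp: P_def set_integral_const)
    finally show ?thesis .
  qed
  define L where "L = Lp_norm p g"
  have L: "L = P powr (1 / p)" by (simp add: L_def Lp_norm_def P_def)
  show ?thesis
  proof (cases "P = 0")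
    case True
    have "(LINT x:cube|lborel. norm (g x)) \<le> 0"
    proof (rule field_le_epsilon)
      fix e :: real assume "0 < e"
      from bd[OF this] show "(LINT x:cube|lborel. norm (g x)) \<le> 0 + e"
        unfolding True by (simp only: mult_zero_left add_0_left add_0_right)
    qed
    then show ?thesis using Lp_norm_nonneg[of p g] by linarith
  next
    case False
    then have Lp: "0 < L" using P by (simp add: L)
    have "P = L powr p" using False P p by (simp add: L powr_powr)
    then have "P * L powr (1 - p) = L" using Lp by (simp add: powr_add[symmetric])
    with bd[OF Lp] show ?thesis by (simp add: L_def)
  qed
qed

lemma Lp_norm_scale:
  fixes g :: "'n::finite tfun"
  assumes "0 < p"
  shows "Lp_norm p (\<lambda>x. c * g x) = norm c * Lp_norm p g"
proof -
  have "(LINT x:cube|lborel. norm (c * g x) powr p) = norm c powr p * (LINT x:cube|lborel. norm (g x) powr p)"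
    by (simp add: norm_mult powr_mult)
  then show ?thesis
    unfolding Lp_norm_def using assms Lp_integral_nonneg[of g p] by (simp add: powr_mult powr_powr)
qed

text \<open>A quasi-triangle inequality, which is enough to show that the Besov space is closed
  under sums. One factor 2 comes from |g + h| \<le> 2 max, the other, under the root, from G + H
  \<le> 2 max.\<close>

lemma Lp_norm_add:
  fixes g h :: "'n::finite tfun"
  assumes g: "continuous_on UNIV g" and h: "continuous_on UNIV h" and p: "0 < p"
  shows "Lp_norm p (\<lambda>x. g x + h x) \<le> (2 * 2 powr (1 / p)) * max (Lp_norm p g) (Lp_norm p h)"
proof -
  define G where "G = (LINT x:cube|lborel. norm (g x) powr p)"
  define H where "H = (LINT x:cube|lborel. norm (h x) powr p)"
  have GH: "0 \<le> G" "0 \<le> H" unfolding G_def H_def by (rule Lp_integral_nonneg)+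
  have "(LINT x:cube|lborel. norm (g x + h x) powr p)
      \<le> (LINT x:cube|lborel. 2 powr p * (norm (g x) powr p + norm (h x) powr p))"
  proof (rule set_integral_mono)
    show "set_integrable lborel cube (\<lambda>x. norm (g x + h x) powr p)"
      by (intro Lp_integrable continuous_intros g h p)
    show "set_integrable lborel cube (\<lambda>x. 2 powr p * (norm (g x) powr p + norm (h x) powr p))"
      by (intro set_integrable_mult_right set_integral_add(1) Lp_integrable g h p)
    fix x
    let ?m = "max (norm (g x)) (norm (h x))"
    have "norm (g x + h x) powr p \<le> (2 * ?m) powr p"
      using p norm_triangle_ineq[of "g x" "h x"] by (intro powr_mono2) auto
    also have "\<dots> = 2 powr p * ?m powr p" by (simp add: powr_mult)
    also have "?m powr p \<le> norm (g x) powr p + norm (h x) powr p"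
      by (simp add: max_def)
    finally show "norm (g x + h x) powr p \<le> 2 powr p * (norm (g x) powr p + norm (h x) powr p)"
      by simp
  qed
  also have "\<dots> = 2 powr p * (G + H)"
    unfolding G_def H_def by (simp add: set_integral_add(2) Lp_integrable g h p)
  also have "\<dots> \<le> 2 powr p * (2 * max G H)" by (intro mult_left_mono) auto
  finally have "Lp_norm p (\<lambda>x. g x + h x) \<le> (2 powr p * (2 * max G H)) powr (1 / p)"
    unfolding Lp_norm_def using p Lp_integral_nonneg[of "\<lambda>x. g x + h x" p] by (intro powr_mono2) auto
  also have "\<dots> = 2 * 2 powr (1 / p) * (max G H) powr (1 / p)"
    using p GH by (simp add: powr_mult powr_powr)
  also have "(max G H) powr (1 / p) = max (Lp_norm p g) (Lp_norm p h)"
  proof -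
    have "mono_on {0..} (\<lambda>t::real. t powr (1 / p))"
      using p by (auto intro!: mono_onI powr_mono2)
    then show ?thesis
      using GH unfolding Lp_norm_def G_def[symmetric] H_def[symmetric]
      by (auto simp: max_def mono_on_def intro!: antisym)
  qed
  finally show ?thesis .
qed

locale besov_params =
  fixes w p q :: real
  assumes w_pos: "0 < w" and p_gt_1: "1 < p" and q_ge_1: "1 \<le> q"
begin

abbreviation E :: "'n::finite tfun set" where "E \<equiv> besov w p q"
abbreviation N :: "'n::finite tfun \<Rightarrow> real" where "N \<equiv> besov_norm w p q"

definition bterm :: "'n::finite tfun \<Rightarrow> nat \<Rightarrow> real" where
  "bterm f m = 2 powr (real m * w * q) * Lp_norm p (block m f) powr q"

lemma bterm_nonneg: "0 \<le> bterm f m"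
  by (simp add: bterm_def)

lemma N_eq: "N f = (\<Sum>m. bterm f m) powr (1 / q)"
  by (simp add: besov_norm_def bterm_def)

lemma E_iff: "f \<in> E \<longleftrightarrow> periodic_fn f \<and> set_integrable lborel cube f \<and> summable (bterm f)"
  by (simp add: besov_def bterm_def[abs_def])

lemma N_nonneg: "0 \<le> N f"
  by (simp add: N_eq)

text \<open>The weighted Wiener algebra embeds into the Besov space with constant one: on a cube of
  measure 1 the norm of a block is at most the sum of its coefficients, and the \<ell>^q norm of a
  sequence is at most its \<ell>^1 norm.\<close>

lemma wiener_E:
  fixes f :: "'n::finite tfun"
  assumes per: "periodic_fn f" and int: "set_integrable lborel cube f"
    and sum: "(\<lambda>\<xi>. japZ \<xi> powr w * norm (fhat f \<xi>)) summable_on UNIV"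
  shows "f \<in> E" "N f \<le> (\<Sum>\<^sub>\<infinity>\<xi>. japZ \<xi> powr w * norm (fhat f \<xi>))"
proof -
  let ?J = "\<lambda>\<xi>. japZ \<xi> powr w * norm (fhat f \<xi>)"
  define s where "s = infsum ?J UNIV"
  define x where "x = (\<lambda>m. 2 powr (real m * w) * Lp_norm p (block m f))"
  have x_nonneg: "0 \<le> x m" for m by (simp add: x_def Lp_norm_nonneg)
  have s: "0 \<le> s" unfolding s_def by (intro infsum_nonneg) simp
  have x_le: "x m \<le> (\<Sum>\<xi>\<in>dyadic m. ?J \<xi>)" for m
  proof -
    have "Lp_norm p (block m f) \<le> (\<Sum>\<xi>\<in>dyadic m. norm (fhat f \<xi>))"
    proof (rule Lp_norm_le)
      fix x show "norm (block m f x) \<le> (\<Sum>\<xi>\<in>dyadic m. norm (fhat f \<xi>))"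
        unfolding block_def by (rule sum_norm_le) (simp add: norm_mult)
    qed (use p_gt_1 in simp)
    then have "x m \<le> (\<Sum>\<xi>\<in>dyadic m. 2 powr (real m * w) * norm (fhat f \<xi>))"
      unfolding x_def sum_distrib_left[symmetric] by (intro mult_left_mono) auto
    also have "\<dots> \<le> (\<Sum>\<xi>\<in>dyadic m. ?J \<xi>)"
    proof (intro sum_mono mult_right_mono)
      fix \<xi> :: "'n \<Rightarrow> int" assume "\<xi> \<in> dyadic m"
      then have "2 powr real m \<le> japZ \<xi>" using mem_dyadicD(3) by (simp add: powr_realpow)
      then have "(2 powr real m) powr w \<le> japZ \<xi> powr w" using w_pos by (intro powr_mono2) auto
      then show "2 powr (real m * w) \<le> japZ \<xi> powr w" by (simp add: powr_powr)
    qed auto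
    finally show ?thesis .
  qed
  have part: "(\<Sum>m\<in>A. x m) \<le> s" if "finite A" for A
  proof -
    have "(\<Sum>m\<in>A. x m) \<le> (\<Sum>m\<in>A. \<Sum>\<xi>\<in>dyadic m. ?J \<xi>)" by (intro sum_mono x_le)
    also have "\<dots> = (\<Sum>\<xi>\<in>(\<Union>m\<in>A. dyadic m). ?J \<xi>)"
    proof (rule sum.UNION_disjoint[symmetric])
      show "\<forall>i\<in>A. \<forall>j\<in>A. i \<noteq> j \<longrightarrow> dyadic i \<inter> (dyadic j :: ('n \<Rightarrow> int) set) = {}"
        using dyadic_unique by (metis disjoint_iff)
    qed (use that in auto)
    also have "\<dots> \<le> s"
      unfolding s_def using that by (intro finite_sum_le_infsum sum) auto
    finally show ?thesis .
  qed
  have bterm_x: "bterm f m = x m powr q" for m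
    by (simp add: bterm_def x_def powr_mult Lp_norm_nonneg powr_powr)
  \<comment> \<open>No single term exceeds the total \<open>s\<close>, so q - 1 of the q powers can
    be replaced by powers of \<open>s\<close>.\<close>
  have bterm_le: "bterm f m \<le> s powr (q - 1) * x m" for m
  proof (cases "x m = 0")
    case True
    then show ?thesis by (simp add: bterm_x)
  next
    case False
    then have "0 < x m" using x_nonneg[of m] by simp
    then have "x m powr q = x m powr (q - 1) * x m"
      using powr_add[of "x m" "q - 1" 1] by simp
    also have "\<dots> \<le> s powr (q - 1) * x m"
      using part[of "{m}"] q_ge_1 x_nonneg[of m] by (intro mult_right_mono powr_mono2) auto
    finally show ?thesis by (simp add: bterm_x)
  qed
  have sums: "(\<Sum>m<M. bterm f m) \<le> s powr q" for M
  proof -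
    have "(\<Sum>m<M. bterm f m) \<le> s powr (q - 1) * (\<Sum>m<M. x m)"
      unfolding sum_distrib_left by (intro sum_mono bterm_le)
    also have "\<dots> \<le> s powr (q - 1) * s" using part by (intro mult_left_mono) auto
    also have "\<dots> = s powr q"
      using s powr_add[of s "q - 1" 1] by (cases "s = 0") auto
    finally show ?thesis .
  qed
  have sm: "summable (bterm f)"
    by (rule summableI_nonneg_bounded[OF bterm_nonneg sums])
  then show "f \<in> E" using per int by (simp add: E_iff)
  have "suminf (bterm f) \<le> s powr q" by (rule suminf_le_const[OF sm sums])
  then have "N f \<le> (s powr q) powr (1 / q)"
    unfolding N_eq using q_ge_1 sm by (intro powr_mono2) (auto intro!: suminf_nonneg bterm_nonneg)
  then show "N f \<le> s" using q_ge_1 s by (simp add: powr_powr)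
qed

lemma fhat_le_N:
  assumes "u \<in> E"
  shows "norm (fhat u \<xi>) \<le> 2 * N u"
proof -
  obtain m where m: "\<xi> \<in> dyadic m" using dyadic_ex by blast
  let ?L = "Lp_norm p (block m u)"
  have sm: "summable (bterm u)" using assms by (simp add: E_iff)
  have "norm (fhat u \<xi>) = norm (fhat (block m u) \<xi>)" using m by (simp add: fhat_block)
  also have "\<dots> \<le> (LINT x:cube|lborel. norm (block m u x))"
    by (intro fhat_bounded set_integrable_cube block_continuous)
  also have "\<dots> \<le> 2 * ?L" by (rule integral_le_Lp[OF block_continuous p_gt_1])
  also have "?L \<le> N u"
  proof -
    have "1 * ?L powr q \<le> bterm u m"
      unfolding bterm_def using w_pos q_ge_1 by (intro mult_right_mono) (auto intro!: ge_one_powr_ge_zero)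
    also have "\<dots> \<le> suminf (bterm u)"
      using sum_le_suminf[OF sm, of "{m}"] by (simp add: bterm_nonneg)
    finally have "(?L powr q) powr (1 / q) \<le> N u"
      unfolding N_eq using q_ge_1 by (intro powr_mono2) auto
    then show ?thesis using q_ge_1 Lp_norm_nonneg[of p "block m u"] by (simp add: powr_powr)
  qed
  finally show ?thesis by simp
qed

lemma N_0: "(\<And>\<xi>. fhat u \<xi> = 0) \<Longrightarrow> N u = 0"
proof -
  assume "\<And>\<xi>. fhat u \<xi> = 0"
  then have "block m u = (\<lambda>x. 0)" for m by (auto simp: block_def)
  then show ?thesis using p_gt_1 q_ge_1 by (simp add: N_eq bterm_def Lp_norm_def)
qed

lemma N_eq_0_iff: "u \<in> E \<Longrightarrow> N u = 0 \<longleftrightarrow> (\<forall>\<xi>. fhat u \<xi> = 0)"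
  using fhat_le_N[of u] N_0[of u] by fastforce

lemma E_integrable: "u \<in> E \<Longrightarrow> set_integrable lborel cube u"
  by (simp add: E_iff)

lemma block_lincomb:
  assumes "set_integrable lborel cube u" "set_integrable lborel cube v"
  shows "block m (\<lambda>x. c * u x + v x) = (\<lambda>x. c * block m u x + block m v x)"
  unfolding block_def fhat_lincomb[OF assms] by (simp add: algebra_simps sum.distrib sum_distrib_left)

lemma E_lincomb:
  assumes u: "u \<in> E" and v: "v \<in> E"
  shows "(\<lambda>x. c * u x + v x) \<in> E"
proof -
  define B where "B = 2 * 2 powr (1 / p)"
  have B: "0 < B" by (simp add: B_def)
  have ui: "set_integrable lborel cube u" "set_integrable lborel cube v"
    using u v by (auto simp: E_iff)
  have le: "bterm (\<lambda>x. c * u x + v x) m \<le> B powr q * (norm c powr q * bterm u m + bterm v m)" for m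
  proof -
    let ?U = "norm c * Lp_norm p (block m u)" and ?V = "Lp_norm p (block m v)"
    have nn: "0 \<le> ?U" "0 \<le> ?V" by (auto simp: Lp_norm_nonneg)
    have "Lp_norm p (block m (\<lambda>x. c * u x + v x)) \<le> B * max ?U ?V"
      using Lp_norm_add[of "\<lambda>x. c * block m u x" "block m v" p] p_gt_1
      by (simp add: block_lincomb[OF ui] Lp_norm_scale B_def continuous_intros block_continuous)
    then have "Lp_norm p (block m (\<lambda>x. c * u x + v x)) powr q \<le> (B * max ?U ?V) powr q"
      using q_ge_1 by (intro powr_mono2) (auto simp: Lp_norm_nonneg)
    also have "\<dots> = B powr q * (max ?U ?V) powr q" using B nn by (simp add: powr_mult)
    also have "\<dots> \<le> B powr q * (?U powr q + ?V powr q)"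
      by (rule mult_left_mono) (auto simp: max_def)
    also have "?U powr q = norm c powr q * Lp_norm p (block m u) powr q"
      by (simp add: powr_mult Lp_norm_nonneg)
    finally have "Lp_norm p (block m (\<lambda>x. c * u x + v x)) powr q
        \<le> B powr q * (norm c powr q * Lp_norm p (block m u) powr q + ?V powr q)" .
    then have "2 powr (real m * w * q) * Lp_norm p (block m (\<lambda>x. c * u x + v x)) powr q
        \<le> 2 powr (real m * w * q) * (B powr q * (norm c powr q * Lp_norm p (block m u) powr q + ?V powr q))"
      by (intro mult_left_mono) auto
    then show ?thesis by (simp add: bterm_def algebra_simps)
  qed
  have "summable (bterm (\<lambda>x. c * u x + v x))"
  proof (rule summable_comparison_test')
    show "summable (\<lambda>m. B powr q * (norm c powr q * bterm u m + bterm v m))"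
      using u v by (intro summable_mult summable_add) (simp_all add: E_iff)
    show "norm (bterm (\<lambda>x. c * u x + v x) m) \<le> B powr q * (norm c powr q * bterm u m + bterm v m)" if "0 \<le> m" for m
      using le[of m] bterm_nonneg[of "\<lambda>x. c * u x + v x" m] by simp
  qed
  then show ?thesis
    using u v set_integrable_lincomb[OF ui] by (auto simp: E_iff periodic_fn_def)
qed

lemma E_0: "(\<lambda>x. 0) \<in> E"
  by (rule wiener_E(1)) (auto simp: fhat_0 set_integrable_0 periodic_fn_def)

lemma N_scale:
  assumes "u \<in> E"
  shows "N (\<lambda>x. c * u x) = norm c * N u"
proof -
  have "block m (\<lambda>x. c * u x) = (\<lambda>x. c * block m u x)" for m
    using block_lincomb[OF E_integrable[OF assms] set_integrable_0, of m c]
    by (simp add: block_def fhat_0)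
  then have "bterm (\<lambda>x. c * u x) m = norm c powr q * bterm u m" for m
    using p_gt_1 by (simp add: bterm_def Lp_norm_scale powr_mult Lp_norm_nonneg)
  then have "bterm (\<lambda>x. c * u x) = (\<lambda>m. norm c powr q * bterm u m)" by auto
  then have "suminf (bterm (\<lambda>x. c * u x)) = norm c powr q * suminf (bterm u)"
    using assms by (simp add: suminf_mult E_iff)
  moreover have "0 \<le> suminf (bterm u)" using assms by (intro suminf_nonneg bterm_nonneg) (simp add: E_iff)
  ultimately show ?thesis
    using q_ge_1 by (simp add: N_eq powr_mult powr_powr)
qed

text \<open>Cutting at whole dyadic blocks leaves a remainder whose norm is that of the tail of the
  block series. So it never exceeds the norm of \<open>u\<close> and tends to 0, without any
  multiplier theorem.\<close>

definition trunc :: "nat \<Rightarrow> 'n::finite tfun \<Rightarrow> 'n tfun" where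
  "trunc M u = (\<lambda>x. \<Sum>\<xi>\<in>(\<Union>m<M. dyadic m). fhat u \<xi> * cexpo x \<xi>)"

lemma cexpo_E: "(\<lambda>x. cexpo x \<xi>) \<in> E"
proof (rule wiener_E(1)[OF cexpo_periodic set_integrable_cube[OF cexpo_continuous]])
  have "(\<lambda>\<eta>. japZ \<eta> powr w * norm (fhat (\<lambda>x. cexpo x \<xi>) \<eta>)) summable_on {\<xi>}" by simp
  then show "(\<lambda>\<eta>. japZ \<eta> powr w * norm (fhat (\<lambda>x. cexpo x \<xi>) \<eta>)) summable_on UNIV"
    by (rule summable_on_cong_neutral[THEN iffD1, rotated -1]) (auto simp: fhat_cexpo)
qed

lemma E_sum: "finite S \<Longrightarrow> (\<And>s. s \<in> S \<Longrightarrow> f s \<in> E) \<Longrightarrow> (\<lambda>x. \<Sum>s\<in>S. c s * f s x) \<in> E"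
proof (induction S rule: finite_induct)
  case empty
  then show ?case by (simp add: E_0)
next
  case (insert a S)
  then show ?case using E_lincomb[of "f a" "\<lambda>x. \<Sum>s\<in>S. c s * f s x" "c a"] by simp
qed

lemma trunc_E: "trunc M u \<in> E"
  unfolding trunc_def by (rule E_sum) (auto intro: cexpo_E)

lemma fhat_trunc: "fhat (trunc M u) \<eta> = (if \<eta> \<in> (\<Union>m<M. dyadic m) then fhat u \<eta> else 0)"
proof -
  have fin: "finite (\<Union>m<M. dyadic m :: ('a \<Rightarrow> int) set)" by simp
  have "fhat (trunc M u) \<eta> = (\<Sum>\<xi>\<in>(\<Union>m<M. dyadic m). fhat u \<xi> * fhat (\<lambda>x. cexpo x \<xi>) \<eta>)"
    unfolding trunc_def
    by (rule conjunct2[OF fhat_sum[OF fin set_integrable_cube[OF cexpo_continuous]]])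
  then show ?thesis using fin by (simp add: fhat_cexpo if_distrib cong: if_cong)
qed

lemma trunc_diff:
  assumes u: "u \<in> E"
  shows "(\<lambda>x. u x - trunc M u x) \<in> E" "N (\<lambda>x. u x - trunc M u x) \<le> N u"
    "(\<lambda>M. N (\<lambda>x. u x - trunc M u x)) \<longlonglongrightarrow> 0"
proof -
  have eq: "(\<lambda>x. u x - trunc M u x) = (\<lambda>x. (-1) * trunc M u x + u x)" for M by auto
  show "(\<lambda>x. u x - trunc M u x) \<in> E" unfolding eq by (rule E_lincomb[OF trunc_E u])
  have fh: "fhat (\<lambda>x. u x - trunc M u x) \<eta> = (if \<eta> \<in> (\<Union>m<M. dyadic m) then 0 else fhat u \<eta>)" for M \<eta>
    unfolding eq fhat_lincomb[OF E_integrable[OF trunc_E] E_integrable[OF u]] by (simp add: fhat_trunc)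
  have bl: "block m (\<lambda>x. u x - trunc M u x) = (if m < M then (\<lambda>x. 0) else block m u)" for m M
  proof (cases "m < M")
    case True
    then show ?thesis by (auto simp: block_def fh intro!: ext sum.neutral)
  next
    case False
    then have "fhat (\<lambda>x. u x - trunc M u x) \<eta> = fhat u \<eta>" if "\<eta> \<in> dyadic m" for \<eta>
      unfolding fh using that dyadic_unique by auto
    then show ?thesis using False by (simp add: block_def)
  qed
  have tm: "bterm (\<lambda>x. u x - trunc M u x) m = (if m < M then 0 else bterm u m)" for m M
    using p_gt_1 q_ge_1 by (simp add: bterm_def bl Lp_norm_def)
  have sm: "summable (bterm u)" using u by (simp add: E_iff)
  have sumM: "suminf (bterm (\<lambda>x. u x - trunc M u x)) = (\<Sum>m. bterm u (m + M))" for M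
  proof -
    have "summable (\<lambda>m. if m < M then 0 else bterm u m)"
      by (rule summable_comparison_test'[OF sm]) (auto simp: bterm_nonneg)
    from suminf_split_initial_segment[OF this, of M]
    have "(\<Sum>m. if m < M then 0 else bterm u m) = (\<Sum>m. bterm u (m + M))" by simp
    moreover have "bterm (\<lambda>x. u x - trunc M u x) = (\<lambda>m. if m < M then 0 else bterm u m)"
      using tm by auto
    ultimately show ?thesis by simp
  qed
  have nn: "0 \<le> (\<Sum>m. bterm u (m + M))" for M
    by (intro suminf_nonneg summable_ignore_initial_segment sm bterm_nonneg)
  show "N (\<lambda>x. u x - trunc M u x) \<le> N u"
    unfolding N_eq sumM
    using q_ge_1 nn suminf_split_initial_segment[OF sm, of M] sum_nonneg[of "{..<M}" "bterm u"] bterm_nonneg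
    by (intro powr_mono2) auto
  have "(\<lambda>M. (\<Sum>m. bterm u (m + M)) powr (1 / q)) \<longlonglongrightarrow> 0 powr (1 / q)"
    using q_ge_1 nn by (intro tendsto_powr' suminf_exist_split2[OF sm] tendsto_const) (auto intro!: always_eventually)
  then show "(\<lambda>M. N (\<lambda>x. u x - trunc M u x)) \<longlonglongrightarrow> 0"
    unfolding N_eq sumM using q_ge_1 by simp
qed

section \<open>Continuous functionals and the dual norm\<close>

lemma dual_bdd:
  assumes L: "L \<in> dual_space E N"
  shows "bdd_above {norm (L u) |u. u \<in> E \<and> N u \<le> 1}"
proof -
  obtain C where C: "\<And>u. u \<in> E \<Longrightarrow> norm (L u) \<le> C * N u"
    using L unfolding dual_space_def by blast
  show ?thesis
  proof (rule bdd_aboveI)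
    fix t assume "t \<in> {norm (L u) |u. u \<in> E \<and> N u \<le> 1}"
    then obtain u where u: "u \<in> E" "N u \<le> 1" "t = norm (L u)" by blast
    have "t \<le> C * N u" using C u by simp
    also have "\<dots> \<le> \<bar>C\<bar> * 1" using u(2) N_nonneg[of u] by (intro mult_mono) auto
    finally show "t \<le> \<bar>C\<bar> * 1" .
  qed
qed

lemma dual_norm_nonneg:
  assumes L: "L \<in> dual_space E N"
  shows "0 \<le> dual_norm E N L"
proof -
  have "norm (L (\<lambda>x. 0)) \<le> dual_norm E N L"
    unfolding dual_norm_def
    by (intro cSup_upper dual_bdd[OF L] CollectI exI[of _ "\<lambda>x. 0"]) (simp add: E_0 N_0 fhat_0)
  then show ?thesis using norm_ge_zero order_trans by blast
qed

lemma dual_bound: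
  assumes L: "L \<in> dual_space E N" and u: "u \<in> E"
  shows "norm (L u) \<le> dual_norm E N L * N u"
proof -
  have lin: "L (\<lambda>x. c * f x + g x) = c * L f + L g" if "f \<in> E" "g \<in> E" for c f g
    using L that by (auto simp: dual_space_def)
  obtain C where C: "\<And>u. u \<in> E \<Longrightarrow> norm (L u) \<le> C * N u"
    using L unfolding dual_space_def by blast
  have L0: "L (\<lambda>x. 0) = 0" using lin[OF E_0 E_0, of 1] by simp
  have Lsc: "L (\<lambda>x. c * f x) = c * L f" if "f \<in> E" for c f
    using lin[OF that E_0, of c] L0 by simp
  show ?thesis
  proof (cases "N u = 0")
    case True
    then show ?thesis using C[OF u] by simp
  next
    case False
    then have Nu: "0 < N u" using N_nonneg[of u] by simp
    define v where "v = (\<lambda>x. inverse (of_real (N u)) * u x)"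
    have vE: "v \<in> E" unfolding v_def using E_lincomb[OF u E_0, of "inverse (of_real (N u))"] by simp
    have Nv: "N v = 1" unfolding v_def N_scale[OF u] using Nu by (simp add: norm_inverse)
    have "norm (L v) \<le> dual_norm E N L"
      unfolding dual_norm_def
      using vE Nv by (intro cSup_upper dual_bdd[OF L] CollectI exI[of _ v]) auto
    moreover have "L v = inverse (of_real (N u)) * L u" unfolding v_def by (rule Lsc[OF u])
    ultimately have "norm (L u) / N u \<le> dual_norm E N L"
      using Nu by (simp add: norm_divide inverse_eq_divide)
    then show ?thesis using Nu by (simp add: pos_divide_le_eq)
  qed
qed

end

section \<open>Periodic pseudo-differential operators\<close>

lemma pderiv_dir_periodic:
  assumes "periodic_fn h"
  shows "periodic_fn (pderiv_dir i h)"
proof -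
  have "h (x + axis l 1 + t *\<^sub>R axis i 1) = h (x + t *\<^sub>R axis i 1)" for x l t
    using assms unfolding periodic_fn_def by (metis add.assoc add.commute)
  then show ?thesis by (simp add: periodic_fn_def pderiv_dir_def)
qed

lemma fhat_mdiff:
  fixes g :: "'n::finite tfun"
  assumes g: "smooth_fn g" "periodic_fn g"
    and bound: "\<And>is. length is \<le> M \<Longrightarrow> \<exists>B. \<forall>x. norm (mdiff is g x) \<le> B"
  shows "j \<le> M \<Longrightarrow> periodic_fn (mdiff (replicate j i) g) \<and>
    fhat (mdiff (replicate j i) g) \<zeta> = (\<i> * of_real (2 * pi * real_of_int (\<zeta> i))) ^ j * fhat g \<zeta>"
proof (induction j)
  case 0
  then show ?case using g by simp
next
  case (Suc j)
  obtain B where B: "\<And>x. norm (mdiff (replicate (Suc j) i) g x) \<le> B"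
    using bound[of "replicate (Suc j) i"] Suc.prems by auto
  let ?h = "mdiff (replicate j i) g"
  have "fhat (pderiv_dir i ?h) \<zeta> = \<i> * of_real (2 * pi * real_of_int (\<zeta> i)) * fhat ?h \<zeta>"
  proof (rule fhat_deriv)
    show "continuous_on UNIV ?h" "\<And>x. (\<lambda>t. ?h (x + t *\<^sub>R axis i 1)) differentiable at 0"
      using g(1) unfolding smooth_fn_def by blast+
    show "periodic_fn ?h" using Suc by simp
    show "norm (pderiv_dir i ?h x) \<le> B" for x using B[of x] by simp
  qed
  moreover have "periodic_fn (pderiv_dir i ?h)" using Suc by (intro pderiv_dir_periodic) simp
  ultimately show ?case using Suc by simp
qed

text \<open>Integration by parts 2k times in the coordinate where |\<zeta> i| is largest suffices,
  because for \<zeta> \<noteq> 0 the squared bracket of \<zeta> is at most (n + 1) (\<zeta> i)^2.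
  Derivatives of lower order satisfy the estimate of order 2k too, as the bracket is at least 1 and
  \<delta> \<ge> 0.\<close>

lemma symbol_decay:
  fixes a :: "real^'n::finite \<Rightarrow> ('n \<Rightarrow> int) \<Rightarrow> complex"
  assumes a: "a \<in> symbol_class m \<rho> \<delta> (2 * k)" and \<delta>: "0 \<le> \<delta>"
  shows "\<exists>C>0. (\<forall>x \<xi>. norm (a x \<xi>) \<le> C * japZ \<xi> powr (m + 2 * real k * \<delta>)) \<and>
    (\<forall>\<xi> \<zeta>. norm (fhat (\<lambda>x. a x \<xi>) \<zeta>) \<le> C * japZ \<xi> powr (m + 2 * real k * \<delta>) * japZ \<zeta> powr - (2 * real k))"
proof -
  let ?M = "m + 2 * real k * \<delta>"
  have per: "periodic_fn (\<lambda>x. a x \<xi>)" and sm: "smooth_fn (\<lambda>x. a x \<xi>)" for \<xi>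
    using a by (auto simp: symbol_class_def)
  have "\<exists>C. \<forall>x \<xi>. norm (mdiff is (\<lambda>y. a y \<xi>) x) \<le> C * japZ \<xi> powr (m + \<delta> * real (length is))"
    if "length is \<le> 2 * k" for "is" :: "'n list"
    using a that by (auto simp: symbol_class_def)
  then obtain D where D: "\<And>is x \<xi>. length is \<le> 2 * k \<Longrightarrow>
      norm (mdiff is (\<lambda>y. a y \<xi>) x) \<le> D is * japZ \<xi> powr (m + \<delta> * real (length is))"
    by metis
  have D': "norm (mdiff is (\<lambda>y. a y \<xi>) x) \<le> \<bar>D is\<bar> * japZ \<xi> powr ?M" if "length is \<le> 2 * k" for "is" x \<xi>
  proof -
    have "\<delta> * real (length is) \<le> \<delta> * (2 * real k)"
      using that \<delta> by (intro mult_left_mono) auto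
    then have "japZ \<xi> powr (m + \<delta> * real (length is)) \<le> japZ \<xi> powr ?M"
      using japZ_ge_1[of \<xi>] by (intro powr_mono) (auto simp: mult_ac)
    then have "D is * japZ \<xi> powr (m + \<delta> * real (length is)) \<le> \<bar>D is\<bar> * japZ \<xi> powr ?M"
      by (intro mult_mono) auto
    with D[OF that] show ?thesis using order_trans by blast
  qed
  define B where "B = \<bar>D []\<bar> + (\<Sum>i\<in>UNIV. \<bar>D (replicate (2 * k) i)\<bar>)"
  have B: "\<bar>D []\<bar> \<le> B" "\<bar>D (replicate (2 * k) i)\<bar> \<le> B" for i
    unfolding B_def using member_le_sum[of i UNIV "\<lambda>i. \<bar>D (replicate (2 * k) i)\<bar>"]
    by (auto intro: sum_nonneg order_trans)
  define n where "n = real CARD('n)"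
  \<comment> \<open>The power of n + 1 pays for replacing the largest coordinate by the bracket; the
    final 1 keeps \<open>C\<close> positive when \<open>B\<close> is 0.\<close>
  define C where "C = (n + 1) ^ k * B + 1"
  have Bn: "0 \<le> B" using B(1) by linarith
  have n: "0 \<le> n" by (simp add: n_def)
  have BC: "B \<le> C"
    using mult_right_mono[of 1 "(n + 1) ^ k" B] Bn n by (simp add: C_def one_le_power)
  have C: "0 < C" using Bn n by (auto simp: C_def intro: add_nonneg_pos)
  have bound0: "norm (a x \<xi>) \<le> B * japZ \<xi> powr ?M" for x \<xi>
    using D'[of "[]" \<xi> x] mult_right_mono[OF B(1), of "japZ \<xi> powr ?M"] by simp
  have "norm (fhat (\<lambda>x. a x \<xi>) \<zeta>) \<le> C * japZ \<xi> powr ?M * japZ \<zeta> powr - (2 * real k)" for \<xi> \<zeta>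
  proof (cases "\<zeta> = (\<lambda>i. 0)")
    case True
    have "norm (fhat (\<lambda>x. a x \<xi>) \<zeta>) \<le> B * japZ \<xi> powr ?M"
      by (rule fhat_bound[OF bound0])
    also have "\<dots> \<le> C * japZ \<xi> powr ?M" using BC by (intro mult_right_mono) auto
    also have "japZ \<zeta> = 1" by (simp add: True japZ_def normZ_def)
    then have "C * japZ \<xi> powr ?M = C * japZ \<xi> powr ?M * japZ \<zeta> powr - (2 * real k)" by simp
    finally show ?thesis .
  next
    case False
    obtain i where i: "\<And>j. \<bar>\<zeta> j\<bar> \<le> \<bar>\<zeta> i\<bar>"
    proof -
      have "\<exists>i. \<forall>j. \<bar>\<zeta> j\<bar> \<le> \<bar>\<zeta> i\<bar>"
      proof -
        have "Max (range (\<lambda>j. \<bar>\<zeta> j\<bar>)) \<in> range (\<lambda>j. \<bar>\<zeta> j\<bar>)" by (rule Max_in) auto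
        then obtain i where "Max (range (\<lambda>j. \<bar>\<zeta> j\<bar>)) = \<bar>\<zeta> i\<bar>" by (elim rangeE)
        then show ?thesis by (metis Max_ge finite_class.finite_UNIV finite_imageI rangeI)
      qed
      then show thesis using that by blast
    qed
    obtain j where "\<zeta> j \<noteq> 0" using False by auto
    with i[of j] have zi: "1 \<le> \<bar>real_of_int (\<zeta> i)\<bar>" by linarith
    let ?z = "\<bar>real_of_int (\<zeta> i)\<bar>"
    have "(japZ \<zeta>)\<^sup>2 \<le> (n + 1) * ?z\<^sup>2"
    proof -
      have "(\<Sum>j\<in>UNIV. (real_of_int (\<zeta> j))\<^sup>2) \<le> (\<Sum>j\<in>(UNIV::'n set). ?z\<^sup>2)"
      proof (rule sum_mono)
        fix j
        have "\<bar>real_of_int (\<zeta> j)\<bar> \<le> ?z" using i[of j] by linarith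
        then show "(real_of_int (\<zeta> j))\<^sup>2 \<le> ?z\<^sup>2" using abs_le_square_iff by fastforce
      qed
      also have "\<dots> = n * ?z\<^sup>2" by (simp add: n_def)
      finally show ?thesis using zi one_le_power[OF zi, of 2] by (simp add: japZ_sq algebra_simps)
    qed
    then have "((japZ \<zeta>)\<^sup>2) ^ k \<le> ((n + 1) * ?z\<^sup>2) ^ k" by (rule power_mono) simp
    then have jap: "japZ \<zeta> ^ (2 * k) \<le> (n + 1) ^ k * ?z ^ (2 * k)"
      by (simp add: power_mult power_mult_distrib)
    have "fhat (mdiff (replicate (2 * k) i) (\<lambda>x. a x \<xi>)) \<zeta> = (\<i> * of_real (2 * pi * real_of_int (\<zeta> i))) ^ (2 * k) * fhat (\<lambda>x. a x \<xi>) \<zeta>"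
      by (rule conjunct2[OF fhat_mdiff[OF sm per, of "2 * k"]]) (use D' in blast)+
    then have "(2 * pi * ?z) ^ (2 * k) * norm (fhat (\<lambda>x. a x \<xi>) \<zeta>) = norm (fhat (mdiff (replicate (2 * k) i) (\<lambda>x. a x \<xi>)) \<zeta>)"
      by (simp add: norm_mult norm_power abs_mult)
    also have "\<dots> \<le> \<bar>D (replicate (2 * k) i)\<bar> * japZ \<xi> powr ?M"
      by (rule fhat_bound) (use D'[of "replicate (2 * k) i"] in simp)
    also have "\<dots> \<le> B * japZ \<xi> powr ?M" using B by (intro mult_right_mono) auto
    finally have "(2 * pi * ?z) ^ (2 * k) * norm (fhat (\<lambda>x. a x \<xi>) \<zeta>) \<le> B * japZ \<xi> powr ?M" .
    moreover have "?z ^ (2 * k) \<le> (2 * pi * ?z) ^ (2 * k)"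
    proof (rule power_mono)
      show "?z \<le> 2 * pi * ?z" using mult_right_mono[of 1 "2 * pi" ?z] pi_gt3 by simp
    qed simp
    ultimately have 1: "?z ^ (2 * k) * norm (fhat (\<lambda>x. a x \<xi>) \<zeta>) \<le> B * japZ \<xi> powr ?M"
      by (meson mult_right_mono norm_ge_zero order_trans)
    have "japZ \<zeta> ^ (2 * k) * norm (fhat (\<lambda>x. a x \<xi>) \<zeta>) \<le> (n + 1) ^ k * ?z ^ (2 * k) * norm (fhat (\<lambda>x. a x \<xi>) \<zeta>)"
      using jap by (rule mult_right_mono) simp
    also have "\<dots> \<le> (n + 1) ^ k * (B * japZ \<xi> powr ?M)"
      using 1 n by (simp only: mult.assoc) (intro mult_left_mono, auto)
    also have "\<dots> \<le> C * japZ \<xi> powr ?M"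
      unfolding mult.assoc[symmetric] by (intro mult_right_mono) (auto simp: C_def)
    finally have "japZ \<zeta> powr (2 * real k) * norm (fhat (\<lambda>x. a x \<xi>) \<zeta>) \<le> C * japZ \<xi> powr ?M"
      using powr_realpow[OF japZ_pos[of \<zeta>], of "2 * k"] by simp
    then show ?thesis using japZ_pos[of \<zeta>] by (simp add: powr_minus field_simps)
  qed
  moreover have "norm (a x \<xi>) \<le> C * japZ \<xi> powr ?M" for x \<xi>
    using bound0[of x \<xi>] mult_right_mono[OF BC powr_ge_zero[of "japZ \<xi>" ?M]] by linarith
  ultimately show ?thesis using C by blast
qed

lemma infsum_finite_sum:
  fixes h :: "'b \<Rightarrow> 'a \<Rightarrow> real"
  assumes "finite F" "\<And>\<eta>. \<eta> \<in> F \<Longrightarrow> h \<eta> summable_on X"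
  shows "(\<lambda>\<xi>. \<Sum>\<eta>\<in>F. h \<eta> \<xi>) summable_on X \<and> (\<Sum>\<eta>\<in>F. infsum (h \<eta>) X) = (\<Sum>\<^sub>\<infinity>\<xi>\<in>X. \<Sum>\<eta>\<in>F. h \<eta> \<xi>)"
  using assms
  by (induction F rule: finite_induct) (auto simp: infsum_add intro!: summable_on_add)

text \<open>\<open>s\<close> is the decay in the frequency of the symbol and \<open>t\<close> the
  decay of the matrix off its diagonal. In the application s = - (m + 2k \<delta>) and t = 2k, so
  \<open>s_large\<close> stems from r \<le> 2/3 and \<open>t_large\<close> from the upper bound on
  the smoothness.\<close>

locale periodic_operator = besov_params w p q for w p q :: real +
  fixes a :: "real^'n::finite \<Rightarrow> ('n \<Rightarrow> int) \<Rightarrow> complex" and C s t :: real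
  assumes a_cont: "\<And>\<xi>. continuous_on UNIV (\<lambda>x. a x \<xi>)"
    and a_per: "\<And>\<xi>. periodic_fn (\<lambda>x. a x \<xi>)"
    and C_pos: "0 < C"
    and a_bound: "\<And>x \<xi>. norm (a x \<xi>) \<le> C * japZ \<xi> powr - s"
    and a_decay: "\<And>\<xi> \<zeta>. norm (fhat (\<lambda>x. a x \<xi>) \<zeta>) \<le> C * japZ \<xi> powr - s * japZ \<zeta> powr - t"
    and s_large: "3 / 2 * real CARD('n) + w < s"
    and t_large: "real CARD('n) + w < t"
begin

text \<open>The operator on arbitrary bounded coefficient sequences, including those that are not
  the coefficients of any function. This is its second factor through the bounded sequences.\<close>

definition S :: "(('n \<Rightarrow> int) \<Rightarrow> complex) \<Rightarrow> 'n tfun" where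
  "S v x = (\<Sum>\<^sub>\<infinity>\<xi>. cexpo x \<xi> * a x \<xi> * v \<xi>)"

definition A :: "('n \<Rightarrow> int) \<Rightarrow> ('n \<Rightarrow> int) \<Rightarrow> complex" where
  "A \<eta> \<xi> = fhat (\<lambda>x. a x \<xi>) (\<lambda>i. \<eta> i - \<xi> i)"

lemma Top_eq: "Top a u = S (fhat u)"
  by (simp add: Top_def S_def fun_eq_iff)

lemma japZ_summable_s: "(\<lambda>\<xi>::'n \<Rightarrow> int. japZ \<xi> powr - s) summable_on UNIV"
  using s_large w_pos by (intro japZ_summable) simp

text \<open>The series has a summable majorant independent of \<open>x\<close>. Uniform convergence
  makes its sum continuous and lets Fourier coefficients be taken term by term.\<close>

lemma S_props:
  assumes v: "\<And>\<xi>. norm (v \<xi>) \<le> D"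
  shows "continuous_on UNIV (S v)" "periodic_fn (S v)" "((\<lambda>\<xi>. A \<eta> \<xi> * v \<xi>) has_sum fhat (S v) \<eta>) UNIV"
    "(\<lambda>\<xi>. cexpo x \<xi> * a x \<xi> * v \<xi>) summable_on UNIV"
proof -
  have D: "0 \<le> D" using v norm_ge_zero order_trans by blast
  let ?f = "\<lambda>\<xi> x. cexpo x \<xi> * a x \<xi> * v \<xi>"
  have f_le: "norm (?f \<xi> x) \<le> japZ \<xi> powr - s * (C * D)" for \<xi> x
    using mult_mono[OF a_bound[of x \<xi>] v[of \<xi>]] C_pos by (simp add: norm_mult mult_ac)
  have f_cont: "continuous_on UNIV (\<lambda>x. ?f \<xi> x)" for \<xi>
    by (intro continuous_intros cexpo_continuous a_cont)
  have summ: "(\<lambda>\<xi>::'n \<Rightarrow> int. japZ \<xi> powr - s * (C * D)) summable_on UNIV"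
    by (intro summable_on_cmult_left japZ_summable_s)
  have ul: "uniform_limit UNIV (\<lambda>X x. \<Sum>\<xi>\<in>X. ?f \<xi> x) (S v) (finite_subsets_at_top UNIV)"
    unfolding S_def[abs_def] by (rule Weierstrass_m_test_general[OF _ summ]) (rule f_le)
  show "(\<lambda>\<xi>. ?f \<xi> x) summable_on UNIV"
    by (rule abs_summable_summable, rule Infinite_Sum.abs_summable_on_comparison_test'[OF summ f_le])
  show cont: "continuous_on UNIV (S v)"
    by (rule uniform_limit_theorem[OF _ ul]) (auto intro!: always_eventually continuous_on_sum f_cont)
  show "periodic_fn (S v)"
    by (simp add: S_def periodic_fn_def cexpo_periodic[unfolded periodic_fn_def, rule_format]
        a_per[unfolded periodic_fn_def, rule_format])
  have fh: "fhat (\<lambda>x. \<Sum>\<xi>\<in>X. ?f \<xi> x) \<eta> = (\<Sum>\<xi>\<in>X. A \<eta> \<xi> * v \<xi>)" if "finite X" for X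
  proof -
    have "fhat (\<lambda>x. \<Sum>\<xi>\<in>X. v \<xi> * (cexpo x \<xi> * a x \<xi>)) \<eta> = (\<Sum>\<xi>\<in>X. v \<xi> * fhat (\<lambda>x. cexpo x \<xi> * a x \<xi>) \<eta>)"
      by (rule conjunct2[OF fhat_sum[OF that]]) (intro set_integrable_cube continuous_intros cexpo_continuous a_cont)
    then show ?thesis by (simp add: fhat_cexpo_mult A_def mult_ac)
  qed
  show "((\<lambda>\<xi>. A \<eta> \<xi> * v \<xi>) has_sum fhat (S v) \<eta>) UNIV"
    unfolding has_sum_def
  proof (rule tendstoI)
    fix e :: real assume "0 < e"
    then have "\<forall>\<^sub>F X in finite_subsets_at_top UNIV. \<forall>x\<in>UNIV. dist (\<Sum>\<xi>\<in>X. ?f \<xi> x) (S v x) < e / 2"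
      by (intro uniform_limitD[OF ul]) simp
    moreover have "\<forall>\<^sub>F X in finite_subsets_at_top UNIV. finite (X :: ('n \<Rightarrow> int) set)"
      by (rule eventually_finite_subsets_at_top_weakI)
    ultimately show "\<forall>\<^sub>F X in finite_subsets_at_top UNIV. dist (\<Sum>\<xi>\<in>X. A \<eta> \<xi> * v \<xi>) (fhat (S v) \<eta>) < e"
    proof eventually_elim
      case (elim X)
      have "(\<Sum>\<xi>\<in>X. A \<eta> \<xi> * v \<xi>) - fhat (S v) \<eta> = fhat (\<lambda>x. (- 1) * S v x + (\<Sum>\<xi>\<in>X. ?f \<xi> x)) \<eta>"
        by (subst fhat_lincomb) (auto intro!: set_integrable_cube cont continuous_on_sum f_cont simp: fh elim)
      also have "norm \<dots> \<le> e / 2"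
        by (rule fhat_bound) (use elim in \<open>auto simp: dist_norm algebra_simps less_imp_le\<close>)
      finally show ?case using \<open>0 < e\<close> by (simp add: dist_norm)
    qed
  qed
qed

definition G :: real where "G = (\<Sum>\<^sub>\<infinity>\<zeta>::'n \<Rightarrow> int. japZ \<zeta> powr (w - t))"

lemma japZ_summable_t: "(\<lambda>\<zeta>::'n \<Rightarrow> int. japZ \<zeta> powr (w - t)) summable_on UNIV"
  using japZ_summable[of "t - w", where 'n = 'n] t_large by simp

lemma japZ_summable_sw: "(\<lambda>\<zeta>::'n \<Rightarrow> int. japZ \<zeta> powr (w - s)) summable_on UNIV"
  using japZ_summable[of "s - w", where 'n = 'n] s_large by simp

definition K :: real where "K = C * 2 powr w * G"

lemma G_nonneg: "0 \<le> G"
  unfolding G_def by (rule infsum_nonneg) simp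

lemma K_nonneg: "0 \<le> K"
  using G_nonneg C_pos by (simp add: K_def)

text \<open>By Peetre's inequality the weight at \<eta> splits into one at \<xi> and one at \<eta> -
  \<xi>, each of which the decay of the matrix absorbs.\<close>

lemma A_weighted: "japZ \<eta> powr w * norm (A \<eta> \<xi>) \<le> C * 2 powr w * japZ \<xi> powr (w - s) * japZ (\<lambda>i. \<eta> i - \<xi> i) powr (w - t)"
proof -
  let ?d = "\<lambda>i. \<eta> i - \<xi> i"
  have "japZ \<eta> powr w \<le> (2 * japZ \<xi> * japZ ?d) powr w"
    using peetre[of \<eta> \<xi>] japZ_pos[of \<eta>] w_pos by (intro powr_mono2) auto
  also have "\<dots> = 2 powr w * japZ \<xi> powr w * japZ ?d powr w"
    using japZ_pos[of \<xi>] japZ_pos[of ?d] by (simp add: powr_mult)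
  finally have "japZ \<eta> powr w * norm (A \<eta> \<xi>) \<le> (2 powr w * japZ \<xi> powr w * japZ ?d powr w) * (C * japZ \<xi> powr - s * japZ ?d powr - t)"
    unfolding A_def using a_decay[of \<xi> ?d] by (intro mult_mono) auto
  also have "\<dots> = C * 2 powr w * (japZ \<xi> powr w * japZ \<xi> powr - s) * (japZ ?d powr w * japZ ?d powr - t)"
    by (simp add: mult_ac)
  finally show ?thesis by (simp add: powr_add[symmetric])
qed

text \<open>Summing \<open>A_weighted\<close> over the output frequency \<eta> first costs the
  constant \<open>G\<close> and leaves a weighted \<ell>^1 norm of \<open>v\<close>;
  \<open>wiener_E\<close> then gives the Besov norm. Restricting \<eta> to finite sets makes the
  interchange of sums elementary.\<close>

lemma S_E:
  assumes v: "\<And>\<xi>. norm (v \<xi>) \<le> D"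
  shows "S v \<in> E" "N (S v) \<le> K * (\<Sum>\<^sub>\<infinity>\<xi>. japZ \<xi> powr (w - s) * norm (v \<xi>))"
    "(\<lambda>\<xi>. japZ \<xi> powr (w - s) * norm (v \<xi>)) summable_on UNIV"
proof -
  note props = S_props[OF v]
  have D: "0 \<le> D" using v norm_ge_zero order_trans by blast
  let ?c = "\<lambda>\<xi>. japZ \<xi> powr (w - s) * norm (v \<xi>)"
  show c_summ: "?c summable_on UNIV"
  proof (rule summable_on_comparison_test[where f = "\<lambda>\<xi>. japZ \<xi> powr (w - s) * D"])
    show "(\<lambda>\<xi>::'n \<Rightarrow> int. japZ \<xi> powr (w - s) * D) summable_on UNIV" by (intro summable_on_cmult_left japZ_summable_sw)
  qed (auto intro!: mult_left_mono v)
  let ?B = "K * infsum ?c UNIV"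
  have part: "(\<Sum>\<eta>\<in>F. japZ \<eta> powr w * norm (fhat (S v) \<eta>)) \<le> ?B" if F: "finite F" for F
  proof -
    let ?h = "\<lambda>\<eta> \<xi>. japZ \<eta> powr w * norm (A \<eta> \<xi> * v \<xi>)"
    have h_le: "?h \<eta> \<xi> \<le> (C * 2 powr w) * (?c \<xi> * japZ (\<lambda>i. \<eta> i - \<xi> i) powr (w - t))" for \<eta> \<xi>
      using mult_right_mono[OF A_weighted[of \<eta> \<xi>], of "norm (v \<xi>)"] by (simp add: norm_mult mult_ac)
    have jap_le: "japZ \<zeta> powr (w - t) \<le> 1" for \<zeta> :: "'n \<Rightarrow> int"
      using japZ_ge_1[of \<zeta>] t_large powr_mono[of "w - t" 0 "japZ \<zeta>"] by simp
    have h_summ: "?h \<eta> summable_on UNIV" for \<eta>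
    proof (rule summable_on_comparison_test[where f = "\<lambda>\<xi>. ?c \<xi> * (C * 2 powr w)"])
      show "(\<lambda>\<xi>. ?c \<xi> * (C * 2 powr w)) summable_on UNIV" by (intro summable_on_cmult_left c_summ)
      fix \<xi>
      have "?c \<xi> * japZ (\<lambda>i. \<eta> i - \<xi> i) powr (w - t) \<le> ?c \<xi> * 1"
        by (intro mult_left_mono jap_le) auto
      then have "(C * 2 powr w) * (?c \<xi> * japZ (\<lambda>i. \<eta> i - \<xi> i) powr (w - t)) \<le> (C * 2 powr w) * (?c \<xi> * 1)"
        by (rule mult_left_mono) (use C_pos in auto)
      then show "?h \<eta> \<xi> \<le> ?c \<xi> * (C * 2 powr w)"
        using h_le[of \<eta> \<xi>] by (simp only: mult.commute mult_1_right)
    qed auto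
    have "japZ \<eta> powr w * norm (fhat (S v) \<eta>) \<le> infsum (?h \<eta>) UNIV" for \<eta>
    proof -
      have nrm: "(\<lambda>\<xi>. norm (A \<eta> \<xi> * v \<xi>)) summable_on UNIV"
        using summable_on_cmult_right[OF h_summ[of \<eta>], of "japZ \<eta> powr - w"] japZ_pos[of \<eta>]
        by (simp add: mult.assoc[symmetric] powr_add[symmetric])
      have "norm (fhat (S v) \<eta>) \<le> (\<Sum>\<^sub>\<infinity>\<xi>. norm (A \<eta> \<xi> * v \<xi>))"
        using norm_infsum_bound[OF nrm] infsumI[OF props(3), of \<eta>] by simp
      then have "japZ \<eta> powr w * norm (fhat (S v) \<eta>) \<le> japZ \<eta> powr w * (\<Sum>\<^sub>\<infinity>\<xi>. norm (A \<eta> \<xi> * v \<xi>))"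
        by (intro mult_left_mono) auto
      then show ?thesis by (simp add: infsum_cmult_right[OF nrm])
    qed
    then have "(\<Sum>\<eta>\<in>F. japZ \<eta> powr w * norm (fhat (S v) \<eta>)) \<le> (\<Sum>\<eta>\<in>F. infsum (?h \<eta>) UNIV)"
      by (intro sum_mono)
    also have "\<dots> = (\<Sum>\<^sub>\<infinity>\<xi>. \<Sum>\<eta>\<in>F. ?h \<eta> \<xi>)"
      by (rule conjunct2[OF infsum_finite_sum[OF F h_summ]])
    also have "\<dots> \<le> (\<Sum>\<^sub>\<infinity>\<xi>. K * ?c \<xi>)"
    proof (rule infsum_mono)
      show "(\<lambda>\<xi>. \<Sum>\<eta>\<in>F. ?h \<eta> \<xi>) summable_on UNIV"
        by (rule conjunct1[OF infsum_finite_sum[OF F h_summ]])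
      show "(\<lambda>\<xi>. K * ?c \<xi>) summable_on UNIV" by (intro summable_on_cmult_right c_summ)
      fix \<xi> :: "'n \<Rightarrow> int"
      have "(\<Sum>\<eta>\<in>F. japZ (\<lambda>i. \<eta> i - \<xi> i) powr (w - t)) = (\<Sum>\<zeta>\<in>(\<lambda>\<eta> i. \<eta> i - \<xi> i) ` F. japZ \<zeta> powr (w - t))"
        by (subst sum.reindex) (auto simp: inj_on_def fun_eq_iff)
      also have "\<dots> \<le> G"
        unfolding G_def using F by (intro finite_sum_le_infsum japZ_summable_t) auto
      finally have g: "(\<Sum>\<eta>\<in>F. japZ (\<lambda>i. \<eta> i - \<xi> i) powr (w - t)) \<le> G" .
      have "(\<Sum>\<eta>\<in>F. ?h \<eta> \<xi>) \<le> (\<Sum>\<eta>\<in>F. (C * 2 powr w) * (?c \<xi> * japZ (\<lambda>i. \<eta> i - \<xi> i) powr (w - t)))"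
        by (intro sum_mono h_le)
      also have "\<dots> = (C * 2 powr w) * (?c \<xi> * (\<Sum>\<eta>\<in>F. japZ (\<lambda>i. \<eta> i - \<xi> i) powr (w - t)))"
        by (simp only: sum_distrib_left)
      also have "\<dots> \<le> (C * 2 powr w) * (?c \<xi> * G)"
        using g C_pos by (intro mult_left_mono) auto
      finally show "(\<Sum>\<eta>\<in>F. ?h \<eta> \<xi>) \<le> K * ?c \<xi>" by (simp add: K_def mult_ac)
    qed
    also have "\<dots> = ?B" by (rule infsum_cmult_right[OF c_summ])
    finally show ?thesis .
  qed
  have sum: "(\<lambda>\<eta>. japZ \<eta> powr w * norm (fhat (S v) \<eta>)) summable_on UNIV"
    by (rule nonneg_bdd_above_summable_on) (auto intro!: bdd_aboveI2 part)
  show "S v \<in> E" by (rule wiener_E(1)[OF props(2) set_integrable_cube[OF props(1)] sum])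
  have "N (S v) \<le> (\<Sum>\<^sub>\<infinity>\<eta>. japZ \<eta> powr w * norm (fhat (S v) \<eta>))"
    by (rule wiener_E(2)[OF props(2) set_integrable_cube[OF props(1)] sum])
  also have "\<dots> \<le> ?B" by (rule infsum_le_finite_sums[OF sum part])
  finally show "N (S v) \<le> ?B" .
qed

lemma Top_E: "u \<in> E \<Longrightarrow> Top a u \<in> E"
  unfolding Top_eq using S_E(1)[of "fhat u" "2 * N u"] fhat_le_N[of u] by blast

lemma S_lincomb:
  assumes "\<And>\<xi>. norm (v \<xi>) \<le> D" "\<And>\<xi>. norm (v' \<xi>) \<le> D'"
  shows "S (\<lambda>\<xi>. c * v \<xi> + v' \<xi>) x = c * S v x + S v' x"
proof -
  have "S (\<lambda>\<xi>. c * v \<xi> + v' \<xi>) x = (\<Sum>\<^sub>\<infinity>\<xi>. c * (cexpo x \<xi> * a x \<xi> * v \<xi>) + cexpo x \<xi> * a x \<xi> * v' \<xi>)"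
    by (simp add: S_def algebra_simps)
  also have "\<dots> = c * S v x + S v' x"
    unfolding S_def
    by (subst infsum_add) (auto intro!: summable_on_cmult_right S_props(4) assms simp: infsum_cmult_right[OF S_props(4)[OF assms(1)]])
  finally show ?thesis .
qed

section \<open>The nuclear representation\<close>

definition b :: "nat \<Rightarrow> 'n \<Rightarrow> int" where "b = from_nat_into UNIV"

lemma b_bij: "bij b"
proof -
  have "infinite (UNIV :: ('n \<Rightarrow> int) set)"
    using finite_fun_UNIVD2[where 'a = 'n and 'b = int] infinite_UNIV_int by blast
  then show ?thesis unfolding b_def by (intro bij_betw_from_nat_into) auto
qed

lemma b_inj: "b i = b j \<longleftrightarrow> i = j"
  using b_bij by (metis bij_pointE)

lemma has_sum_b: "(f has_sum l) UNIV \<Longrightarrow> ((\<lambda>j. f (b j)) has_sum l) UNIV"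
  using has_sum_reindex_bij_betw[OF b_bij, of f l] by simp

lemma summable_b: "f summable_on UNIV \<Longrightarrow> (\<lambda>j. f (b j)) summable_on UNIV"
  using summable_on_reindex_bij_betw[OF b_bij, of f] by simp

text \<open>The Fourier coefficients of the character at \<xi>, so that
  \<open>S (delta \<xi>)\<close> is the image of that character.\<close>

definition delta :: "('n \<Rightarrow> int) \<Rightarrow> ('n \<Rightarrow> int) \<Rightarrow> complex" where
  "delta \<xi> \<eta> = (if \<eta> = \<xi> then 1 else 0)"

lemma delta_le: "norm (delta \<xi> \<eta>) \<le> 1"
  by (simp add: delta_def)

lemma N_S_delta: "N (S (delta \<xi>)) \<le> K * japZ \<xi> powr (w - s)"
proof -
  have "N (S (delta \<xi>)) \<le> K * (\<Sum>\<^sub>\<infinity>\<eta>. japZ \<eta> powr (w - s) * norm (delta \<xi> \<eta>))"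
    by (rule S_E(2)[OF delta_le])
  also have "(\<Sum>\<^sub>\<infinity>\<eta>. japZ \<eta> powr (w - s) * norm (delta \<xi> \<eta>)) = (\<Sum>\<^sub>\<infinity>\<eta>\<in>{\<xi>}. japZ \<eta> powr (w - s))"
    by (rule infsum_cong_neutral) (auto simp: delta_def)
  finally show ?thesis by simp
qed

lemma coeff_dual: "(\<lambda>u. fhat u \<xi>) \<in> dual_space E N"
  unfolding dual_space_def using fhat_lincomb[OF E_integrable E_integrable] fhat_le_N by blast

lemma dual_norm_coeff: "dual_norm E N (\<lambda>u. fhat u \<xi>) \<le> 2"
  unfolding dual_norm_def
proof (rule cSup_least)
  show "{norm (fhat u \<xi>) |u. u \<in> E \<and> N u \<le> 1} \<noteq> {}"
    using E_0 by (auto simp: fhat_0 N_0 intro!: exI[of _ "\<lambda>x. 0"])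
  fix y assume "y \<in> {norm (fhat u \<xi>) |u. u \<in> E \<and> N u \<le> 1}"
  then obtain u where u: "u \<in> E" "N u \<le> 1" "y = norm (fhat u \<xi>)" by blast
  then show "y \<le> 2" using fhat_le_N[OF u(1), of \<xi>] by linarith
qed

text \<open>The functionals have norm at most 2 and the images of the characters decay like the
  power w - s of the bracket. Convergence is not inherited from the Fourier series of
  \<open>u\<close>, which would depend on the enumeration; it comes from the weighted \<ell>^1 bound
  of \<open>S_E\<close>.\<close>

lemma nuclear_rep_coeff:
  assumes r: "0 < r" and rs: "real CARD('n) < r * (s - w)"
  shows "nuclear_rep r E N (Top a) (\<lambda>j u. fhat u (b j)) (\<lambda>j. S (delta (b j)))"
  unfolding nuclear_rep_def
proof (intro conjI allI ballI)
  fix j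
  show "(\<lambda>u. fhat u (b j)) \<in> dual_space E N" by (rule coeff_dual)
  show "S (delta (b j)) \<in> E" by (rule S_E(1)[OF delta_le])
next
  let ?g = "\<lambda>\<xi>::'n \<Rightarrow> int. japZ \<xi> powr - (r * (s - w)) * (2 powr r * K powr r)"
  have "?g summable_on UNIV" by (intro summable_on_cmult_left japZ_summable rs)
  then have g: "summable (\<lambda>j. ?g (b j))" using summable_b summable_on_imp_summable by blast
  show "summable (\<lambda>j. dual_norm E N (\<lambda>u. fhat u (b j)) powr r * N (S (delta (b j))) powr r)"
  proof (rule summable_comparison_test'[OF g])
    fix j
    have "dual_norm E N (\<lambda>u. fhat u (b j)) powr r \<le> 2 powr r"
      using dual_norm_coeff dual_norm_nonneg[OF coeff_dual] r by (intro powr_mono2) auto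
    moreover have "N (S (delta (b j))) powr r \<le> (K * japZ (b j) powr (w - s)) powr r"
      using N_S_delta N_nonneg r by (intro powr_mono2) auto
    moreover have "(K * japZ (b j) powr (w - s)) powr r = K powr r * japZ (b j) powr - (r * (s - w))"
      using K_nonneg by (simp add: powr_mult powr_powr algebra_simps)
    ultimately have "dual_norm E N (\<lambda>u. fhat u (b j)) powr r * N (S (delta (b j))) powr r \<le> 2 powr r * (K powr r * japZ (b j) powr - (r * (s - w)))"
      by (intro mult_mono) auto
    then show "norm (dual_norm E N (\<lambda>u. fhat u (b j)) powr r * N (S (delta (b j))) powr r) \<le> ?g (b j)"
      by (simp add: mult_ac)
  qed
next
  fix u :: "'n tfun" assume u: "u \<in> E"
  \<comment> \<open>The coefficients left over after \<open>M\<close> terms. The error of the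
    partial sum is \<open>S (v M)\<close>, bounded by the tail of an absolutely convergent
    series.\<close>
  define v where "v = (\<lambda>M \<xi>. if \<xi> \<in> b ` {..<M} then 0 else fhat u \<xi>)"
  have v_le: "norm (v M \<xi>) \<le> 2 * N u" for M \<xi>
    using fhat_le_N[OF u, of \<xi>] N_nonneg[of u] by (simp add: v_def)
  have eq: "Top a u x - (\<Sum>j<M. fhat u (b j) * S (delta (b j)) x) = S (v M) x" for M x
  proof (induction M)
    case 0
    then show ?case by (simp add: Top_eq v_def)
  next
    case (Suc M)
    have "v (Suc M) = (\<lambda>\<xi>. - fhat u (b M) * delta (b M) \<xi> + v M \<xi>)"
    proof
      fix \<xi> show "v (Suc M) \<xi> = - fhat u (b M) * delta (b M) \<xi> + v M \<xi>"
        by (cases "\<xi> = b M") (auto simp: v_def delta_def b_inj lessThan_Suc)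
    qed
    then have "S (v (Suc M)) x = - fhat u (b M) * S (delta (b M)) x + S (v M) x"
      using S_lincomb[of "delta (b M)" 1 "v M" "2 * N u" "- fhat u (b M)" x, OF delta_le v_le] by simp
    then show ?case using Suc by simp
  qed
  let ?H = "\<lambda>\<xi>. japZ \<xi> powr (w - s) * norm (fhat u \<xi>)"
  have H: "(?H has_sum infsum ?H UNIV) UNIV"
    using S_E(3)[of "fhat u", OF fhat_le_N[OF u]] by simp
  have N_le: "N (\<lambda>x. Top a u x - (\<Sum>j<M. fhat u (b j) * S (delta (b j)) x)) \<le> K * (infsum ?H UNIV - (\<Sum>j<M. ?H (b j)))" for M
  proof -
    have "(?H has_sum (\<Sum>\<xi>\<in>b ` {..<M}. ?H \<xi>)) (b ` {..<M})" by (rule has_sum_finite) simp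
    from has_sum_Diff[OF H this] have "(?H has_sum (infsum ?H UNIV - (\<Sum>\<xi>\<in>b ` {..<M}. ?H \<xi>))) (UNIV - b ` {..<M})" by simp
    then have hs: "((\<lambda>\<xi>. japZ \<xi> powr (w - s) * norm (v M \<xi>)) has_sum (infsum ?H UNIV - (\<Sum>\<xi>\<in>b ` {..<M}. ?H \<xi>))) UNIV"
      by (rule has_sum_cong_neutral[THEN iffD1, rotated -1]) (auto simp: v_def)
    have rs: "(\<Sum>\<xi>\<in>b ` {..<M}. ?H \<xi>) = (\<Sum>j<M. ?H (b j))"
      by (subst sum.reindex) (auto simp: inj_on_def b_inj)
    have "(\<Sum>\<^sub>\<infinity>\<xi>. japZ \<xi> powr (w - s) * norm (v M \<xi>)) = infsum ?H UNIV - (\<Sum>j<M. ?H (b j))"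
      using infsumI[OF hs] unfolding rs .
    then show ?thesis unfolding eq using S_E(2)[of "v M", OF v_le] by simp
  qed
  show "(\<lambda>M. N (\<lambda>x. Top a u x - (\<Sum>j<M. fhat u (b j) * S (delta (b j)) x))) \<longlonglongrightarrow> 0"
  proof (rule tendsto_sandwich[OF _ _ tendsto_const])
    have "(\<lambda>j. ?H (b j)) sums infsum ?H UNIV" using has_sum_b[OF H] by (rule has_sum_imp_sums)
    then have "(\<lambda>M. K * (infsum ?H UNIV - (\<Sum>j<M. ?H (b j)))) \<longlonglongrightarrow> K * (infsum ?H UNIV - infsum ?H UNIV)"
      unfolding sums_def by (intro tendsto_intros)
    then show "(\<lambda>M. K * (infsum ?H UNIV - (\<Sum>j<M. ?H (b j)))) \<longlonglongrightarrow> 0" by simp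
  qed (use N_le N_nonneg in \<open>auto intro!: always_eventually\<close>)
qed

section \<open>Trace and eigenvalues\<close>

lemma A_diag: "A \<xi> \<xi> = (LINT x:cube|lborel. a x \<xi>)"
  by (simp add: A_def fhat_def cexpo_def dotZ_def)

lemma A_diag_summable: "(\<lambda>\<xi>. A \<xi> \<xi>) summable_on UNIV"
proof (rule abs_summable_summable, rule Infinite_Sum.abs_summable_on_comparison_test')
  show "(\<lambda>\<xi>::'n \<Rightarrow> int. C * japZ \<xi> powr - s) summable_on UNIV"
    by (intro summable_on_cmult_right japZ_summable_s)
  fix \<xi> :: "'n \<Rightarrow> int"
  have "japZ (\<lambda>i. \<xi> i - \<xi> i) = 1" by (simp add: japZ_def normZ_def)
  then show "norm (A \<xi> \<xi>) \<le> C * japZ \<xi> powr - s"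
    using a_decay[of \<xi> "\<lambda>i. \<xi> i - \<xi> i"] by (simp add: A_def)
qed

lemma fhat_Top_cexpo: "fhat (Top a (\<lambda>x. cexpo x \<xi>)) \<eta> = A \<eta> \<xi>"
proof -
  have "fhat (\<lambda>x. cexpo x \<xi>) = delta \<xi>" by (auto simp: fhat_cexpo delta_def)
  then have "((\<lambda>\<zeta>. A \<eta> \<zeta> * delta \<xi> \<zeta>) has_sum fhat (Top a (\<lambda>x. cexpo x \<xi>)) \<eta>) UNIV"
    using S_props(3)[OF delta_le[of \<xi>], of \<eta>] by (simp add: Top_eq)
  moreover have "((\<lambda>\<zeta>. A \<eta> \<zeta> * delta \<xi> \<zeta>) has_sum A \<eta> \<xi>) UNIV"
    by (rule has_sum_finite_neutralI[of "{\<xi>}"]) (auto simp: delta_def)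
  ultimately show ?thesis using has_sum_unique by blast
qed

text \<open>The dyadic truncations are contractions converging strongly to the identity, so the trace
  of any representation is the limit of the traces of its truncations, which only involve the
  diagonal entries of the operator.\<close>

lemma trace_unique:
  assumes r: "0 < r" "r \<le> 1" and rep: "nuclear_rep r E N (Top a) e y"
  shows "(\<lambda>j. e j (y j)) sums (\<Sum>\<^sub>\<infinity>\<xi>. A \<xi> \<xi>)"
proof -
  have e: "e j \<in> dual_space E N" and y: "y j \<in> E" for j
    using rep by (auto simp: nuclear_rep_def)
  have conv: "(\<lambda>M. N (\<lambda>x. Top a u x - (\<Sum>j<M. e j u * y j x))) \<longlonglongrightarrow> 0" if "u \<in> E" for u
    using rep that by (auto simp: nuclear_rep_def)
  define m where "m = (\<lambda>j. dual_norm E N (e j) * N (y j))"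
  have m_nonneg: "0 \<le> m j" for j
    unfolding m_def using dual_norm_nonneg[OF e] N_nonneg by (intro mult_nonneg_nonneg)
  have mr: "summable (\<lambda>j. m j powr r)"
    using rep dual_norm_nonneg[OF e] N_nonneg by (simp add: nuclear_rep_def m_def powr_mult)
  \<comment> \<open>The terms tend to 0, so eventually they are at most 1, and then r \<le> 1 makes
    each at most its r-th power.\<close>
  have m_summ: "summable m"
  proof (rule summable_comparison_test_ev[OF _ mr])
    have "\<forall>\<^sub>F j in sequentially. m j powr r < 1"
      using summable_LIMSEQ_zero[OF mr] by (rule order_tendstoD) simp
    then show "\<forall>\<^sub>F j in sequentially. norm (m j) \<le> m j powr r"
    proof eventually_elim
      case (elim j)
      then have "m j \<le> 1" using r m_nonneg[of j] by (smt (verit) ge_one_powr_ge_zero)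
      then show ?case using m_nonneg[of j] r powr_mono'[of r 1 "m j"] by (cases "m j = 0") auto
    qed
  qed
  have lin: "e j (\<lambda>x. c * f x + g x) = c * e j f + e j g" if "f \<in> E" "g \<in> E" for j c f g
    using e[of j] that by (auto simp: dual_space_def)
  have e0: "e j (\<lambda>x. 0) = 0" for j using lin[OF E_0 E_0, of j 1] by simp
  have lin_sum: "e j (\<lambda>x. \<Sum>\<xi>\<in>F. c \<xi> * f \<xi> x) = (\<Sum>\<xi>\<in>F. c \<xi> * e j (f \<xi>))"
    if "finite F" "\<And>\<xi>. f \<xi> \<in> E" for j F c and f :: "('n \<Rightarrow> int) \<Rightarrow> 'n tfun"
    using that(1)
  proof (induction F rule: finite_induct)
    case empty
    then show ?case by (simp add: e0)
  next
    case (insert \<xi> F)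
    have "(\<lambda>x. \<Sum>\<xi>\<in>F. c \<xi> * f \<xi> x) \<in> E" using insert.hyps that(2) by (intro E_sum)
    from lin[OF that(2) this, of j "c \<xi>"] insert show ?case by simp
  qed
  define F where "F = (\<lambda>M. \<Union>m<M. dyadic m :: ('n \<Rightarrow> int) set)"
  have F: "finite (F M)" for M by (simp add: F_def)
  \<comment> \<open>The representation converges in norm at the character \<xi>, and the coefficient
    at \<xi> is continuous, so it may be applied term by term; the result is the diagonal
    entry.\<close>
  have coef: "(\<lambda>j. fhat (y j) \<xi> * e j (\<lambda>x. cexpo x \<xi>)) sums A \<xi> \<xi>" for \<xi>
  proof -
    let ?c = "\<lambda>x. cexpo x \<xi>"
    have bound: "norm (A \<xi> \<xi> - (\<Sum>j<J. fhat (y j) \<xi> * e j ?c)) \<le> 2 * N (\<lambda>x. Top a ?c x - (\<Sum>j<J. e j ?c * y j x))" for J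
    proof -
      have sE: "(\<lambda>x. \<Sum>j<J. e j ?c * y j x) \<in> E" by (intro E_sum y) auto
      have eq: "(\<lambda>x. Top a ?c x - (\<Sum>j<J. e j ?c * y j x)) = (\<lambda>x. (-1) * (\<Sum>j<J. e j ?c * y j x) + Top a ?c x)" by auto
      have "(\<lambda>x. Top a ?c x - (\<Sum>j<J. e j ?c * y j x)) \<in> E"
        unfolding eq by (intro E_lincomb sE Top_E cexpo_E)
      from fhat_le_N[OF this, of \<xi>]
      have "norm (fhat (\<lambda>x. Top a ?c x - (\<Sum>j<J. e j ?c * y j x)) \<xi>) \<le> 2 * N (\<lambda>x. Top a ?c x - (\<Sum>j<J. e j ?c * y j x))" .
      moreover have "fhat (\<lambda>x. Top a ?c x - (\<Sum>j<J. e j ?c * y j x)) \<xi> = A \<xi> \<xi> - (\<Sum>j<J. fhat (y j) \<xi> * e j ?c)"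
      proof -
        have "fhat (\<lambda>x. \<Sum>j<J. e j ?c * y j x) \<xi> = (\<Sum>j<J. e j ?c * fhat (y j) \<xi>)"
          by (rule conjunct2[OF fhat_sum]) (auto intro: E_integrable y)
        then show ?thesis
          unfolding eq fhat_lincomb[OF E_integrable[OF sE] E_integrable[OF Top_E[OF cexpo_E]]]
          by (simp add: fhat_Top_cexpo mult.commute)
      qed
      ultimately show ?thesis by simp
    qed
    have "(\<lambda>J. A \<xi> \<xi> - (\<Sum>j<J. fhat (y j) \<xi> * e j ?c)) \<longlonglongrightarrow> 0"
      by (rule Lim_null_comparison[OF always_eventually[OF allI[OF bound]]])
        (rule tendsto_mult_right_zero[OF conv[OF cexpo_E]])
    from tendsto_diff[OF tendsto_const[of "A \<xi> \<xi>"] this] show ?thesis by (simp add: sums_def)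
  qed
  have e_trunc: "e j (trunc M (y j)) = (\<Sum>\<xi>\<in>F M. fhat (y j) \<xi> * e j (\<lambda>x. cexpo x \<xi>))" for j M
  proof -
    have F_eq: "(\<Union>m<M. dyadic m) = F M" by (simp add: F_def)
    show ?thesis unfolding trunc_def F_eq by (rule lin_sum[OF F cexpo_E])
  qed
  have e_diff: "norm (e j (y j) - e j (trunc M (y j))) \<le> dual_norm E N (e j) * N (\<lambda>x. y j x - trunc M (y j) x)" for j M
  proof -
    have "(\<lambda>x. y j x - trunc M (y j) x) = (\<lambda>x. (-1) * trunc M (y j) x + y j x)" by auto
    then have "e j (\<lambda>x. y j x - trunc M (y j) x) = e j (y j) - e j (trunc M (y j))"
      using lin[OF trunc_E y, of j "-1" M] by simp
    then show ?thesis using dual_bound[OF e trunc_diff(1)[OF y], of j j M] by simp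
  qed
  \<comment> \<open>For fixed \<open>M\<close> the sum over \<open>j\<close> meets only finitely
    many frequencies. The majorant \<open>2 * m j\<close> for passing to the limit arises by writing
    a truncation as the function minus its remainder, neither exceeding the norm of
    \<open>y j\<close>.\<close>
  have "(\<lambda>M. \<Sum>j. e j (trunc M (y j))) \<longlonglongrightarrow> (\<Sum>j. e j (y j))"
  proof (rule conjunct2[OF conjunct2[OF tannerys_theorem]])
    show "(\<lambda>M. e j (trunc M (y j))) \<longlonglongrightarrow> e j (y j)" for j
    proof -
      have "(\<lambda>M. e j (y j) - e j (trunc M (y j))) \<longlonglongrightarrow> 0"
        by (rule Lim_null_comparison[OF always_eventually[OF allI[OF e_diff]]])
          (rule tendsto_mult_right_zero[OF trunc_diff(3)[OF y]])
      from tendsto_diff[OF tendsto_const[of "e j (y j)"] this] show ?thesis by simp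
    qed
    show "summable (\<lambda>j. 2 * m j)" by (intro summable_mult m_summ)
    show "\<forall>\<^sub>F (j, M) in sequentially \<times>\<^sub>F sequentially. norm (e j (trunc M (y j))) \<le> 2 * m j"
    proof (intro always_eventually allI, clarify)
      fix j M
      have "norm (e j (trunc M (y j))) \<le> norm (e j (y j)) + norm (e j (y j) - e j (trunc M (y j)))"
        by (metis norm_minus_commute norm_triangle_sub)
      also have "norm (e j (y j)) \<le> m j" unfolding m_def by (rule dual_bound[OF e y])
      also have "norm (e j (y j) - e j (trunc M (y j))) \<le> m j"
        unfolding m_def by (rule order_trans[OF e_diff mult_left_mono[OF trunc_diff(2)[OF y] dual_norm_nonneg[OF e]]])
      finally show "norm (e j (trunc M (y j))) \<le> 2 * m j" by simp
    qed
  qed simp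
  moreover have "(\<Sum>j. e j (trunc M (y j))) = (\<Sum>\<xi>\<in>F M. A \<xi> \<xi>)" for M
    unfolding e_trunc by (intro sums_unique[symmetric] sums_sum coef)
  moreover have "(\<lambda>M. \<Sum>\<xi>\<in>F M. A \<xi> \<xi>) \<longlonglongrightarrow> (\<Sum>\<^sub>\<infinity>\<xi>. A \<xi> \<xi>)"
  proof (rule filterlim_compose[OF infsum_tendsto[OF A_diag_summable]])
    show "filterlim F (finite_subsets_at_top UNIV) sequentially"
      unfolding filterlim_finite_subsets_at_top
    proof safe
      fix X :: "('n \<Rightarrow> int) set" assume X: "finite X"
      have "\<forall>\<^sub>F M in sequentially. \<forall>\<xi>\<in>X. \<xi> \<in> F M"
        unfolding eventually_ball_finite_distrib[OF X]
      proof
        fix \<xi> :: "'n \<Rightarrow> int"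
        obtain l where "\<xi> \<in> dyadic l" using dyadic_ex by blast
        then show "\<forall>\<^sub>F M in sequentially. \<xi> \<in> F M"
          unfolding F_def by (intro eventually_mono[OF eventually_gt_at_top[of l]]) auto
      qed
      then show "\<forall>\<^sub>F M in sequentially. finite (F M) \<and> X \<subseteq> F M \<and> F M \<subseteq> UNIV"
        by eventually_elim (use F in auto)
    qed
  qed
  ultimately have "(\<Sum>j. e j (y j)) = (\<Sum>\<^sub>\<infinity>\<xi>. A \<xi> \<xi>)"
    using LIMSEQ_unique by simp
  moreover have "summable (\<lambda>j. e j (y j))"
    by (rule summable_comparison_test'[OF m_summ]) (use dual_bound[OF e y] in \<open>simp add: m_def\<close>)
  ultimately show ?thesis by (simp add: sums_iff)
qed

text \<open>Twice the exponent is n + w > n, which gives square summability with a margin.\<close>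

definition \<theta> :: "nat \<Rightarrow> real" where
  "\<theta> i = japZ (b i) powr - ((real CARD('n) + w) / 2)"

text \<open>The exponent is what remains of - s, so that \<theta> times \<beta> is the power - s of
  the bracket.\<close>

definition \<beta> :: "nat \<Rightarrow> real" where
  "\<beta> i = japZ (b i) powr ((real CARD('n) + w) / 2 - s)"

text \<open>By \<open>s_large\<close> the decay exponent of \<beta> exceeds n + w/2. Any \<rho>
  strictly between n / (n + w/2) and 1 would do; the numerator n + w/4 picks the midpoint.\<close>

definition \<rho> :: real where
  "\<rho> = (real CARD('n) + w / 4) / (real CARD('n) + w / 2)"

lemma weights: "weights \<theta> \<beta> \<rho>"
proof
  let ?n = "real CARD('n)"
  have n: "0 < ?n" by simp
  show "0 < \<theta> i" "0 < \<beta> i" for i using japZ_pos[of "b i"] by (simp_all add: \<theta>_def \<beta>_def)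
  show \<rho>: "0 < \<rho>" "\<rho> < 1" using n w_pos by (simp_all add: \<rho>_def add_pos_pos divide_less_eq)
  have "(\<lambda>\<xi>::'n \<Rightarrow> int. japZ \<xi> powr - (?n + w)) summable_on UNIV"
    using w_pos by (intro japZ_summable) simp
  then have "summable (\<lambda>i. japZ (b i) powr - (?n + w))"
    using summable_b summable_on_imp_summable by blast
  moreover have "japZ (b i) powr - (?n + w) = (\<theta> i)\<^sup>2" for i
    unfolding \<theta>_def power2_eq_square powr_add[symmetric]
    by (rule arg_cong[of _ _ "(powr) (japZ (b i))"]) (simp add: field_simps)
  ultimately show "summable (\<lambda>i. (\<theta> i)\<^sup>2)" by simp
  have "?n < (s - (?n + w) / 2) * \<rho>"
  proof -
    have "?n < (?n + w / 2) * \<rho>" using n w_pos by (simp add: \<rho>_def)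
    also have "\<dots> \<le> (s - (?n + w) / 2) * \<rho>" using s_large \<rho> by (intro mult_right_mono) (auto simp: field_simps)
    finally show ?thesis .
  qed
  then have "(\<lambda>\<xi>::'n \<Rightarrow> int. japZ \<xi> powr - ((s - (?n + w) / 2) * \<rho>)) summable_on UNIV"
    by (rule japZ_summable)
  then have "summable (\<lambda>i. japZ (b i) powr - ((s - (?n + w) / 2) * \<rho>))"
    using summable_b summable_on_imp_summable by blast
  moreover have "japZ (b i) powr - ((s - (?n + w) / 2) * \<rho>) = \<beta> i powr \<rho>" for i
    by (simp add: \<beta>_def powr_powr algebra_simps)
  ultimately show "summable (\<lambda>i. \<beta> i powr \<rho>)" by simp
qed

interpretation W: weights \<theta> \<beta> \<rho> by (rule weights)

text \<open>Conjugating by the weight \<open>\<theta>\<close> turns the coefficient matrix into one dominated by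
  \<open>\<theta> \<otimes> \<beta>\<close> without changing its spectrum.\<close>

definition B :: "nat \<Rightarrow> nat \<Rightarrow> complex" where
  "B i j = of_real (\<theta> i / \<theta> j) * A (b i) (b j)"

lemma adm_B: "W.adm C B"
  unfolding W.adm_def
proof (intro conjI allI)
  fix i j
  have th: "0 < \<theta> i" "0 < \<theta> j" by (rule W.\<theta>_pos)+
  let ?d = "\<lambda>l. b i l - b j l"
  have "norm (A (b i) (b j)) \<le> C * japZ (b j) powr - s * japZ ?d powr - t"
    unfolding A_def by (rule a_decay)
  also have "\<dots> \<le> C * japZ (b j) powr - s * 1"
    using japZ_ge_1[of ?d] t_large w_pos powr_mono[of "- t" 0 "japZ ?d"] C_pos
    by (intro mult_left_mono) (auto simp: add_nonneg_nonneg less_imp_le)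
  finally have "norm (B i j) \<le> \<theta> i / \<theta> j * (C * japZ (b j) powr - s)"
    unfolding B_def norm_mult norm_of_real abs_of_pos[OF divide_pos_pos[OF th]]
    using th by (intro mult_left_mono) auto
  also have "japZ (b j) powr - s = \<theta> j * \<beta> j"
    by (simp add: \<theta>_def \<beta>_def powr_add[symmetric])
  finally show "norm (B i j) \<le> C * \<theta> i * \<beta> j" using th by (simp add: mult_ac)
qed (rule C_pos)

text \<open>Carries the Besov space into \<open>W.V\<close> and the operator into \<open>B\<close>.
  It is injective up to functions of norm zero, which the definitions of eigenvalue and multiplicity
  also disregard.\<close>

definition \<Phi> :: "'n tfun \<Rightarrow> nat \<Rightarrow> complex" where
  "\<Phi> u i = of_real (\<theta> i) * fhat u (b i)"

lemma \<Phi>_eq_0: "u \<in> E \<Longrightarrow> N u = 0 \<longleftrightarrow> \<Phi> u = (\<lambda>i. 0)"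
proof -
  assume u: "u \<in> E"
  have "\<Phi> u = (\<lambda>i. 0) \<longleftrightarrow> (\<forall>i. fhat u (b i) = 0)"
    using W.\<theta>_pos by (auto simp: \<Phi>_def fun_eq_iff less_imp_neq[symmetric])
  also have "\<dots> \<longleftrightarrow> (\<forall>\<xi>. fhat u \<xi> = 0)" using b_bij by (metis bij_pointE)
  finally show ?thesis using N_eq_0_iff[OF u] by simp
qed

lemma \<Phi>_lincomb: "u \<in> E \<Longrightarrow> v \<in> E \<Longrightarrow> \<Phi> (\<lambda>x. c * u x + v x) = (\<lambda>i. c * \<Phi> u i + \<Phi> v i)"
  unfolding \<Phi>_def by (rule ext, subst fhat_lincomb) (auto simp: E_integrable algebra_simps)

lemma weighted_V:
  assumes "\<And>\<xi>. norm (x \<xi>) \<le> D"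
  shows "(\<lambda>i. of_real (\<theta> i) * x (b i)) \<in> W.V"
  unfolding W.V_def
proof (intro CollectI exI[of _ D] allI)
  fix i
  show "norm (of_real (\<theta> i) * x (b i)) \<le> D * \<theta> i"
    using mult_left_mono[OF assms[of "b i"], of "\<theta> i"] W.\<theta>_pos[of i] by (simp add: norm_mult mult.commute)
qed

lemma app_B:
  assumes x: "\<And>\<xi>. norm (x \<xi>) \<le> D"
  shows "W.app B (\<lambda>i. of_real (\<theta> i) * x (b i)) = \<Phi> (S x)"
proof
  fix i
  have "(\<lambda>j. A (b i) (b j) * x (b j)) sums fhat (S x) (b i)"
    using has_sum_b[OF S_props(3)[OF x]] by (rule has_sum_imp_sums)
  then have "(\<lambda>j. of_real (\<theta> i) * (A (b i) (b j) * x (b j))) sums (of_real (\<theta> i) * fhat (S x) (b i))"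
    by (rule sums_mult)
  moreover have "of_real (\<theta> i) * (A (b i) (b j) * x (b j)) = B i j * (of_real (\<theta> j) * x (b j))" for j
    using W.\<theta>_pos[of j] by (simp add: B_def)
  ultimately show "W.app B (\<lambda>i. of_real (\<theta> i) * x (b i)) i = \<Phi> (S x) i"
    unfolding W.app_def \<Phi>_def by (simp add: sums_iff)
qed

lemma \<Phi>_V: "u \<in> E \<Longrightarrow> \<Phi> u \<in> W.V"
  using weighted_V[of "fhat u", OF fhat_le_N[of u]] by (simp add: \<Phi>_def[abs_def])

lemma \<Phi>_Top: "u \<in> E \<Longrightarrow> \<Phi> (Top a u) = W.app B (\<Phi> u)"
  using app_B[of "fhat u", OF fhat_le_N[of u]] by (simp add: \<Phi>_def[abs_def] Top_eq)

definition opshift :: "complex \<Rightarrow> 'n tfun \<Rightarrow> 'n tfun" where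
  "opshift \<mu> = (\<lambda>v x. Top a v x - \<mu> * v x)"

lemma opshift_eq: "opshift \<mu> v = (\<lambda>x. (- \<mu>) * v x + Top a v x)"
  by (simp add: opshift_def)

lemma opshift_E: "u \<in> E \<Longrightarrow> opshift \<mu> u \<in> E"
  unfolding opshift_eq by (intro E_lincomb Top_E)

lemma \<Phi>_opshift: "u \<in> E \<Longrightarrow> \<Phi> (opshift \<mu> u) = W.shift B \<mu> (\<Phi> u)"
  unfolding opshift_eq by (subst \<Phi>_lincomb) (auto simp: Top_E \<Phi>_Top W.shift_def)

lemma opshift_pow: "u \<in> E \<Longrightarrow> (opshift \<mu> ^^ k) u \<in> E \<and> \<Phi> ((opshift \<mu> ^^ k) u) = (W.shift B \<mu> ^^ k) (\<Phi> u)"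
  by (induction k) (auto simp: opshift_E \<Phi>_opshift)

lemma gen_eigenspace_iff: "u \<in> gen_eigenspace E N (Top a) \<mu> \<longleftrightarrow> u \<in> E \<and> \<Phi> u \<in> W.geig B \<mu>"
proof -
  have "N ((opshift \<mu> ^^ k) u) = 0 \<longleftrightarrow> (W.shift B \<mu> ^^ k) (\<Phi> u) = (\<lambda>i. 0)" if "u \<in> E" for k
    using \<Phi>_eq_0 opshift_pow[OF that] by metis
  then show ?thesis
    unfolding gen_eigenspace_def W.geig_def opshift_def[symmetric] using \<Phi>_V by auto
qed

text \<open>\<Phi> need not be onto \<open>W.V\<close>, but a generalised eigenvector for \<mu>
  \<noteq> 0 lies in the range of \<open>B\<close>, since it can be solved for from the vanishing of
  a power of the shift. Elements of that range are coefficients of functions in the space, because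
  \<open>S\<close> accepts all bounded sequences.\<close>

lemma geig_range:
  assumes v: "v \<in> W.geig B \<mu>" and \<mu>: "\<mu> \<noteq> 0"
  shows "\<exists>u\<in>E. \<Phi> u = v"
proof -
  have "\<exists>v'\<in>W.V. v = W.app B v'" if "v \<in> W.V" "(W.shift B \<mu> ^^ k) v = (\<lambda>i. 0)" for k v
    using that
  proof (induction k arbitrary: v)
    case 0
    then show ?case using W.V_0 by (intro bexI[of _ "\<lambda>i. 0"]) (auto simp: W.app_def)
  next
    case (Suc k)
    have "(W.shift B \<mu> ^^ k) (W.shift B \<mu> v) = (\<lambda>i. 0)" using Suc.prems(2) by (simp add: funpow_swap1)
    then obtain v' where v': "v' \<in> W.V" "W.shift B \<mu> v = W.app B v'"
      using Suc.IH[OF W.shift_V[OF adm_B Suc.prems(1)]] by blast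
    \<comment> \<open>From (B - \<mu>) v = B v' one gets \<mu> v = B (v - v'), and division by \<mu>
      presents \<open>v\<close> as an image.\<close>
    have \<mu>v: "W.app B (\<lambda>i. (-1) * v' i + v i) i = \<mu> * v i" for i
      using W.app_lincomb[OF adm_B v'(1) Suc.prems(1), of "-1" i] fun_cong[OF v'(2), of i]
      by (simp add: W.shift_def algebra_simps)
    have dV: "(\<lambda>i. (-1) * v' i + v i) \<in> W.V" by (rule W.V_lincomb[OF v'(1) Suc.prems(1)])
    have "W.app B (\<lambda>i. inverse \<mu> * ((-1) * v' i + v i)) = v"
    proof
      fix i
      have "W.app B (\<lambda>i. inverse \<mu> * ((-1) * v' i + v i) + 0) i = inverse \<mu> * (\<mu> * v i) + W.app B (\<lambda>i. 0) i"
        unfolding \<mu>v[symmetric] by (rule W.app_lincomb[OF adm_B dV W.V_0])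
      then show "W.app B (\<lambda>i. inverse \<mu> * ((-1) * v' i + v i)) i = v i"
        using \<mu> by (simp add: W.app_def)
    qed
    then show ?case using W.V_scale[OF dV, of "inverse \<mu>"] by metis
  qed
  then obtain v' where v': "v' \<in> W.V" "v = W.app B v'" using v by (auto simp: W.geig_def)
  obtain D where D: "\<And>i. norm (v' i) \<le> D * \<theta> i" using v'(1) by (auto simp: W.V_def)
  \<comment> \<open>Removing the weight: domination of \<open>v'\<close> by \<theta> is precisely
    boundedness of \<open>x\<close>.\<close>
  define x where "x = (\<lambda>\<xi>. v' (inv_into UNIV b \<xi>) / of_real (\<theta> (inv_into UNIV b \<xi>)))"
  have x: "norm (x \<xi>) \<le> D" for \<xi>
    using D[of "inv_into UNIV b \<xi>"] W.\<theta>_pos[of "inv_into UNIV b \<xi>"] by (simp add: x_def norm_divide divide_le_eq)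
  have "(\<lambda>i. of_real (\<theta> i) * x (b i)) = v'"
    using W.\<theta>_pos b_bij by (auto simp: x_def bij_is_inj less_imp_neq[symmetric])
  then have "\<Phi> (S x) = v" using app_B[of x D, OF x] v'(2) by simp
  then show ?thesis using S_E(1)[of x D, OF x] by blast
qed

lemma \<Phi>_sum: "finite X \<Longrightarrow> (\<And>s. s \<in> X \<Longrightarrow> f s \<in> E) \<Longrightarrow> \<Phi> (\<lambda>x. \<Sum>s\<in>X. c s * f s x) = (\<lambda>i. \<Sum>s\<in>X. c s * \<Phi> (f s) i)"
proof (induction X rule: finite_induct)
  case empty
  then show ?case by (simp add: \<Phi>_def fhat_0)
next
  case (insert z X)
  then show ?case
    using \<Phi>_lincomb[of "f z" "\<lambda>x. \<Sum>s\<in>X. c s * f s x" "c z"] by (simp add: E_sum)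
qed

lemma sum_fun_apply: "(\<Sum>x\<in>X. g x) i = (\<Sum>x\<in>X. g x i)" for g :: "'b \<Rightarrow> nat \<Rightarrow> complex"
  by (induction X rule: infinite_finite_induct) auto

lemma geig_basis:
  assumes "\<mu> \<noteq> 0"
  shows "\<exists>X. finite X \<and> fv.independent X \<and> fv.span X = W.geig B \<mu> \<and> card X = fv.dim (W.geig B \<mu>)"
proof -
  obtain X where X: "finite X" "fv.independent X" "fv.span X = W.geig B \<mu>"
    using W.multiplicity[OF adm_B assms] by blast
  then show ?thesis using fv.dim_span_eq_card_independent[OF X(2)] by auto
qed

text \<open>\<Phi> preserves independence because independence modulo norm zero corresponds to
  independence of coefficients. This bounds independent sets from above; \<open>geig_range\<close>
  lifts a basis back and attains the bound.\<close>

lemma alg_mult_eq: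
  assumes \<mu>: "\<mu> \<noteq> 0"
  shows "alg_mult E N (Top a) \<mu> = enat (fv.dim (W.geig B \<mu>))"
  unfolding alg_mult_def
proof (rule Sup_eqI)
  let ?P = "\<lambda>X. finite X \<and> X \<subseteq> gen_eigenspace E N (Top a) \<mu> \<and>
      (\<forall>c. N (\<lambda>x. \<Sum>s\<in>X. c s * s x) = 0 \<longrightarrow> (\<forall>s\<in>X. c s = 0))"
  obtain X where X: "finite X" "fv.independent X" "fv.span X = W.geig B \<mu>" "card X = fv.dim (W.geig B \<mu>)"
    using geig_basis[OF \<mu>] by blast
  show "m \<le> enat (fv.dim (W.geig B \<mu>))" if m: "m \<in> {enat (card Y) |Y. ?P Y}" for m
  proof -
    obtain Y where Y: "finite Y" "Y \<subseteq> gen_eigenspace E N (Top a) \<mu>"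
      "\<And>c. N (\<lambda>x. \<Sum>s\<in>Y. c s * s x) = 0 \<Longrightarrow> \<forall>s\<in>Y. c s = 0" "m = enat (card Y)"
      using m by blast
    have YE: "s \<in> E" "\<Phi> s \<in> W.geig B \<mu>" if "s \<in> Y" for s using that Y(2) gen_eigenspace_iff by auto
    have ind: "\<forall>s\<in>Y. c s = 0" if "(\<lambda>i. \<Sum>s\<in>Y. c s * \<Phi> s i) = (\<lambda>i. 0)" for c
    proof (rule Y(3))
      have "(\<lambda>x. \<Sum>s\<in>Y. c s * s x) \<in> E" using Y(1) YE by (intro E_sum)
      then show "N (\<lambda>x. \<Sum>s\<in>Y. c s * s x) = 0"
        using \<Phi>_eq_0 \<Phi>_sum[OF Y(1), of "\<lambda>s. s" c] YE(1) that by simp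
    qed
    have inj: "inj_on \<Phi> Y"
    proof (rule inj_onI, rule ccontr)
      fix s s' assume s: "s \<in> Y" "s' \<in> Y" "\<Phi> s = \<Phi> s'" "s \<noteq> s'"
      \<comment> \<open>The coefficients of \<open>s - s'\<close>, which has norm zero when the two
        images agree, against independence.\<close>
      define c where "c = (\<lambda>z. if z = s then 1 else if z = s' then - 1 else 0 :: complex)"
      have red: "(\<Sum>z\<in>Y. c z * \<Phi> z i) = (\<Sum>z\<in>{s, s'}. c z * \<Phi> z i)" for i
        using s Y(1) by (intro sum.mono_neutral_right) (auto simp: c_def)
      have "(\<Sum>z\<in>{s, s'}. c z * \<Phi> z i) = 0" for i
        using s(4) fun_cong[OF s(3), of i] by (simp add: c_def)
      then have "(\<lambda>i. \<Sum>z\<in>Y. c z * \<Phi> z i) = (\<lambda>i. 0)" by (simp only: red)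
      from bspec[OF ind[OF this] s(1)] show False by (simp add: c_def)
    qed
    have "fv.independent (\<Phi> ` Y)"
      unfolding fv.independent_explicit_finite_subsets
    proof (intro allI impI ballI)
      fix Z c v assume Z: "Z \<subseteq> \<Phi> ` Y" "finite Z" and sum: "(\<Sum>v\<in>Z. (\<lambda>i. c v * v i)) = 0" and v: "v \<in> Z"
      define c' where "c' = (\<lambda>s. if \<Phi> s \<in> Z then c (\<Phi> s) else 0)"
      have "(\<Sum>s\<in>Y. c' s * \<Phi> s i) = 0" for i
      proof -
        have "(\<Sum>s\<in>Y. c' s * \<Phi> s i) = (\<Sum>v\<in>\<Phi> ` Y. (if v \<in> Z then c v else 0) * v i)"
          by (simp add: sum.reindex[OF inj] c'_def)
        also have "\<dots> = (\<Sum>v\<in>Z. c v * v i)"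
          using Z Y(1) by (intro sum.mono_neutral_cong_right) auto
        also have "\<dots> = 0" using fun_cong[OF sum, of i] by (simp add: sum_fun_apply)
        finally show ?thesis .
      qed
      then have "\<forall>s\<in>Y. c' s = 0" by (intro ind) simp
      moreover obtain s where "s \<in> Y" "v = \<Phi> s" using v Z(1) by blast
      ultimately show "c v = 0" using v by (auto simp: c'_def)
    qed
    moreover have "\<Phi> ` Y \<subseteq> fv.span X" using YE X(3) by auto
    ultimately have "card (\<Phi> ` Y) \<le> card X"
      using fv.independent_span_bound[OF X(1)] by blast
    then show ?thesis using X(4) Y(4) inj by (simp add: card_image)
  qed
  show "enat (fv.dim (W.geig B \<mu>)) \<le> m" if ub: "\<And>z. z \<in> {enat (card Y) |Y. ?P Y} \<Longrightarrow> z \<le> m" for m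
  proof -
    have "\<exists>u\<in>E. \<Phi> u = v" if "v \<in> X" for v
      using geig_range[OF _ \<mu>] that X(3) fv.span_base by metis
    then obtain g where g: "\<And>v. v \<in> X \<Longrightarrow> g v \<in> E \<and> \<Phi> (g v) = v" by metis
    have inj: "inj_on g X" using g by (metis inj_onI)
    have "?P (g ` X)"
    proof (intro conjI allI impI)
      show "finite (g ` X)" using X(1) by simp
      show "g ` X \<subseteq> gen_eigenspace E N (Top a) \<mu>"
        using g X(3) fv.span_base by (auto simp: gen_eigenspace_iff)
      fix c assume c: "N (\<lambda>x. \<Sum>s\<in>g ` X. c s * s x) = 0"
      have gE: "s \<in> E" if "s \<in> g ` X" for s using that g by auto
      have "(\<lambda>x. \<Sum>s\<in>g ` X. c s * s x) \<in> E" using X(1) gE by (intro E_sum) auto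
      with c have "(\<lambda>i. \<Sum>s\<in>g ` X. c s * \<Phi> s i) = (\<lambda>i. 0)"
        using \<Phi>_eq_0 \<Phi>_sum[of "g ` X" "\<lambda>s. s" c] X(1) gE by simp
      then have "(\<Sum>v\<in>X. c (g v) * v i) = 0" for i
        using g by (simp add: sum.reindex[OF inj] fun_eq_iff)
      then have "(\<Sum>v\<in>X. (\<lambda>i. c (g v) * v i)) = 0" by (auto simp: sum_fun_apply)
      from X(2)[unfolded fv.independent_explicit_finite_subsets, rule_format, of X "\<lambda>v. c (g v)", OF subset_refl X(1) this]
      have "\<forall>v\<in>X. c (g v) = 0" by blast
      then show "\<forall>s\<in>g ` X. c s = 0" by simp
    qed
    then have "enat (card (g ` X)) \<le> m" by (intro ub) blast
    then show ?thesis using X(4) inj by (simp add: card_image)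
  qed
qed

lemma is_eigenvalue_iff:
  assumes \<mu>: "\<mu> \<noteq> 0"
  shows "is_eigenvalue E N (Top a) \<mu> \<longleftrightarrow> fv.dim (W.geig B \<mu>) \<noteq> 0"
proof -
  obtain X where X: "finite X" "fv.independent X" "fv.span X = W.geig B \<mu>" "card X = fv.dim (W.geig B \<mu>)"
    using geig_basis[OF \<mu>] by blast
  have dim0: "fv.dim (W.geig B \<mu>) = 0 \<longleftrightarrow> W.geig B \<mu> = {\<lambda>i. 0}"
  proof
    assume "fv.dim (W.geig B \<mu>) = 0"
    then have "X = {}" using X by simp
    then show "W.geig B \<mu> = {\<lambda>i. 0}" using X(3) by (simp add: zero_fun_def)
  next
    assume "W.geig B \<mu> = {\<lambda>i. 0}"
    then have "X \<subseteq> {0}" using X(3) fv.span_superset[of X] by (simp add: zero_fun_def)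
    moreover have "0 \<notin> X" using X(2) fv.dependent_zero by blast
    ultimately have "X = {}" by blast
    then show "fv.dim (W.geig B \<mu>) = 0" using X(4) by simp
  qed
  have eig: "is_eigenvalue E N (Top a) \<mu> \<longleftrightarrow> (\<exists>u\<in>E. \<Phi> u \<noteq> (\<lambda>i. 0) \<and> W.shift B \<mu> (\<Phi> u) = (\<lambda>i. 0))"
  proof -
    have "N u \<noteq> 0 \<and> N (\<lambda>x. Top a u x - \<mu> * u x) = 0 \<longleftrightarrow> \<Phi> u \<noteq> (\<lambda>i. 0) \<and> W.shift B \<mu> (\<Phi> u) = (\<lambda>i. 0)" if "u \<in> E" for u
      using \<Phi>_eq_0[OF that] \<Phi>_eq_0[OF opshift_E[OF that]] \<Phi>_opshift[OF that] by (simp add: opshift_def)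
    then show ?thesis by (auto simp: is_eigenvalue_def)
  qed
  show ?thesis
  proof
    assume "is_eigenvalue E N (Top a) \<mu>"
    then obtain u where u: "u \<in> E" "\<Phi> u \<noteq> (\<lambda>i. 0)" "W.shift B \<mu> (\<Phi> u) = (\<lambda>i. 0)" using eig by blast
    then have "\<Phi> u \<in> W.geig B \<mu>"
      using \<Phi>_V[OF u(1)] by (auto simp: W.geig_def intro!: exI[of _ "Suc 0"])
    then show "fv.dim (W.geig B \<mu>) \<noteq> 0" using u(2) dim0 by auto
  next
    assume "fv.dim (W.geig B \<mu>) \<noteq> 0"
    then have ne: "W.geig B \<mu> \<noteq> {\<lambda>i. 0}" unfolding dim0 .
    have z: "(\<lambda>i. 0) \<in> W.geig B \<mu>" using W.V_0 by (auto simp: W.geig_def intro!: exI[of _ 0])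
    obtain v where v: "v \<in> W.geig B \<mu>" "v \<noteq> (\<lambda>i. 0)"
    proof -
      have "\<not> W.geig B \<mu> \<subseteq> {\<lambda>i. 0}" using ne z by (simp only: subset_singleton_iff) (auto simp: z)
      then obtain u where "u \<in> W.geig B \<mu>" "u \<notin> {\<lambda>i. 0}" by (metis subsetI)
      then show thesis using that by simp
    qed
    then obtain k where k: "(W.shift B \<mu> ^^ k) v = (\<lambda>i. 0)" by (auto simp: W.geig_def)
    \<comment> \<open>The last nonzero iterate of the shift on a generalised eigenvector is an
      eigenvector.\<close>
    define l where "l = (LEAST k. (W.shift B \<mu> ^^ k) v = (\<lambda>i. 0))"
    have l: "(W.shift B \<mu> ^^ l) v = (\<lambda>i. 0)" unfolding l_def using k by (rule LeastI)
    then obtain l' where l': "l = Suc l'" using v(2) by (cases l) auto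
    define z where "z = (W.shift B \<mu> ^^ l') v"
    have "z \<noteq> (\<lambda>i. 0)"
      unfolding z_def using not_less_Least[of l' "\<lambda>k. (W.shift B \<mu> ^^ k) v = (\<lambda>i. 0)"] l' by (simp add: l_def)
    moreover have z0: "W.shift B \<mu> z = (\<lambda>i. 0)" using l l' by (simp add: z_def)
    moreover have "z \<in> W.geig B \<mu>"
    proof -
      have "z \<in> W.V" unfolding z_def using v(1) by (intro W.shift_pow_V[OF adm_B]) (auto simp: W.geig_def)
      moreover have "(W.shift B \<mu> ^^ Suc 0) z = (\<lambda>i. 0)" using z0 by simp
      ultimately show ?thesis unfolding W.geig_def by blast
    qed
    then obtain u where "u \<in> E" "\<Phi> u = z" using geig_range[OF _ \<mu>] by blast
    ultimately show "is_eigenvalue E N (Top a) \<mu>" using eig by blast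
  qed
qed

theorem eigenvalue_sum:
  "((\<lambda>\<mu>. \<mu> * of_nat (the_enat (alg_mult E N (Top a) \<mu>))) has_sum (\<Sum>\<^sub>\<infinity>\<xi>. A \<xi> \<xi>))
    {\<mu>. \<mu> \<noteq> 0 \<and> is_eigenvalue E N (Top a) \<mu>}"
proof -
  have "(\<lambda>j. A (b j) (b j)) sums (\<Sum>\<^sub>\<infinity>\<xi>. A \<xi> \<xi>)"
    by (intro has_sum_imp_sums has_sum_b) (simp add: A_diag_summable)
  moreover have "B i i = A (b i) (b i)" for i using W.\<theta>_pos[of i] by (simp add: B_def)
  ultimately have "(\<Sum>i. B i i) = (\<Sum>\<^sub>\<infinity>\<xi>. A \<xi> \<xi>)" by (simp add: sums_iff)
  with W.lidskii[OF adm_B]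
  have "((\<lambda>\<mu>. of_nat (fv.dim (W.geig B \<mu>)) * \<mu>) has_sum (\<Sum>\<^sub>\<infinity>\<xi>. A \<xi> \<xi>)) {\<mu>. \<mu> \<noteq> 0 \<and> fv.dim (W.geig B \<mu>) \<noteq> 0}"
    by simp
  moreover have "{\<mu>. \<mu> \<noteq> 0 \<and> fv.dim (W.geig B \<mu>) \<noteq> 0} = {\<mu>. \<mu> \<noteq> 0 \<and> is_eigenvalue E N (Top a) \<mu>}"
    using is_eigenvalue_iff by auto
  ultimately have "((\<lambda>\<mu>. of_nat (fv.dim (W.geig B \<mu>)) * \<mu>) has_sum (\<Sum>\<^sub>\<infinity>\<xi>. A \<xi> \<xi>)) {\<mu>. \<mu> \<noteq> 0 \<and> is_eigenvalue E N (Top a) \<mu>}"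
    by (simp only:)
  then show ?thesis
    by (rule has_sum_cong[THEN iffD1, rotated]) (simp add: alg_mult_eq mult.commute)
qed

end

theorem theorem4p2:
  fixes a :: "real^'n::finite \<Rightarrow> ('n \<Rightarrow> int) \<Rightarrow> complex"
    and r \<alpha> \<rho> \<delta> m w1 p1 q1 :: real and k :: nat
  defines "E \<equiv> besov w1 p1 q1 :: 'n tfun set"
      and "N \<equiv> besov_norm w1 p1 q1 :: 'n tfun \<Rightarrow> real"
  assumes "0 < r" "r \<le> 2/3" "0 < \<alpha>" "\<alpha> \<le> 1/2"
    and "0 \<le> \<rho>" "\<rho> \<le> 1" "0 \<le> \<delta>" "\<delta> \<le> 1"
    and "real k > real CARD('n) / 2"
    and "a \<in> symbol_class m \<rho> \<delta> (2 * k)"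
    and "w1 = \<alpha> * real CARD('n)" "0 < w1" "w1 < 2 * real k - real CARD('n)"
    and "1 < p1" "p1 \<le> 2"
    and "q1 = inverse (\<alpha> + 1 / (p1 / (p1 - 1)))"
    and "m < - real CARD('n) / r - w1 - 2 * real k * \<delta>"
  shows "r_nuclear r E N (Top a) \<and>
    (\<forall>e y. nuclear_rep r E N (Top a) e y \<longrightarrow>
        (\<lambda>j. e j (y j)) sums (\<Sum>\<^sub>\<infinity>\<xi>. LINT x:cube|lborel. a x \<xi>)) \<and>
    ((\<lambda>\<xi>. LINT x:cube|lborel. a x \<xi>) summable_on UNIV) \<and>
    (\<forall>\<mu>. \<mu> \<noteq> 0 \<and> is_eigenvalue E N (Top a) \<mu> \<longrightarrow> alg_mult E N (Top a) \<mu> \<noteq> \<infinity>) \<and>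
    ((\<lambda>\<mu>. \<mu> * of_nat (the_enat (alg_mult E N (Top a) \<mu>))) has_sum
        (\<Sum>\<^sub>\<infinity>\<xi>. LINT x:cube|lborel. a x \<xi>)) {\<mu>. \<mu> \<noteq> 0 \<and> is_eigenvalue E N (Top a) \<mu>}"
proof -
  let ?n = "real CARD('n)"
  define s where "s = - (m + 2 * real k * \<delta>)"
  have n: "0 < ?n" by simp
  have rs: "?n < r * (s - w1)"
  proof -
    have "?n / r < s - w1" using assms(19) by (simp add: s_def)
    then show ?thesis using \<open>0 < r\<close> by (simp add: divide_less_eq mult.commute)
  qed
  \<comment> \<open>Here r \<le> 2/3 becomes the coefficient 3/2.\<close>
  have s_large: "3 / 2 * ?n + w1 < s"
  proof -
    have "0 < r * (s - w1)" using rs n by linarith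
    then have "0 < s - w1" using \<open>0 < r\<close> by (simp add: zero_less_mult_iff)
    then have "r * (s - w1) \<le> 2 / 3 * (s - w1)" using \<open>r \<le> 2/3\<close> by (intro mult_right_mono) auto
    with rs have "?n < 2 / 3 * (s - w1)" by (rule less_le_trans)
    then show ?thesis by (simp add: field_simps)
  qed
  \<comment> \<open>Both \<alpha> and 1/p1' = 1 - 1/p1 are at most 1/2, the latter because p1 \<le>
    2, so the reciprocal of q1 is at most 1.\<close>
  have q: "1 \<le> q1"
  proof -
    have "1 / (p1 / (p1 - 1)) = 1 - 1 / p1" using \<open>1 < p1\<close> by (simp add: field_simps)
    moreover have "1 / 2 \<le> 1 / p1" "1 / p1 < 1" using \<open>1 < p1\<close> \<open>p1 \<le> 2\<close> by (auto simp: field_simps)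
    ultimately have "0 < \<alpha> + 1 / (p1 / (p1 - 1))" "\<alpha> + 1 / (p1 / (p1 - 1)) \<le> 1"
      using \<open>0 < \<alpha>\<close> \<open>\<alpha> \<le> 1/2\<close> by linarith+
    then show ?thesis unfolding assms(18) by (rule one_le_inverse)
  qed
  obtain C where C: "0 < C" "\<And>x \<xi>. norm (a x \<xi>) \<le> C * japZ \<xi> powr - s"
    "\<And>\<xi> \<zeta>. norm (fhat (\<lambda>x. a x \<xi>) \<zeta>) \<le> C * japZ \<xi> powr - s * japZ \<zeta> powr - (2 * real k)"
    using symbol_decay[OF assms(12) \<open>0 \<le> \<delta>\<close>] unfolding s_def minus_minus by blast
  interpret periodic_operator w1 p1 q1 a C s "2 * real k"
  proof
    have "smooth_fn (\<lambda>x. a x \<xi>)" for \<xi> using assms(12) by (simp add: symbol_class_def)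
    then have "continuous_on UNIV (mdiff [] (\<lambda>x. a x \<xi>))" for \<xi> unfolding smooth_fn_def by blast
    then show "continuous_on UNIV (\<lambda>x. a x \<xi>)" for \<xi> by simp
    show "periodic_fn (\<lambda>x. a x \<xi>)" for \<xi> using assms(12) by (simp add: symbol_class_def)
  qed (use C s_large q assms in auto)
  have "r_nuclear r E N (Top a)"
    unfolding r_nuclear_def assms(1,2) using Top_E nuclear_rep_coeff[OF \<open>0 < r\<close> rs] by blast
  moreover have "(\<lambda>j. e j (y j)) sums (\<Sum>\<^sub>\<infinity>\<xi>. LINT x:cube|lborel. a x \<xi>)" if "nuclear_rep r E N (Top a) e y" for e y
    using trace_unique[of r e y] that assms(1-4) by (simp add: A_diag)
  moreover have "(\<lambda>\<xi>. LINT x:cube|lborel. a x \<xi>) summable_on UNIV"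
    using A_diag_summable by (simp add: A_diag)
  moreover have "alg_mult E N (Top a) \<mu> \<noteq> \<infinity>" if "\<mu> \<noteq> 0" for \<mu>
    using alg_mult_eq[OF that] by (simp add: assms(1,2))
  moreover have "((\<lambda>\<mu>. \<mu> * of_nat (the_enat (alg_mult E N (Top a) \<mu>))) has_sum
        (\<Sum>\<^sub>\<infinity>\<xi>. LINT x:cube|lborel. a x \<xi>)) {\<mu>. \<mu> \<noteq> 0 \<and> is_eigenvalue E N (Top a) \<mu>}"
    using eigenvalue_sum by (simp add: A_diag assms(1,2))
  ultimately show ?thesis by blast
qed

end
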